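(* Let $I=(I,\preceq)$ be a finite connected non-negative poset of corank $\operatorname{crk}_I\geq 0$ and Dynkin type $\mathrm{Dyn}_I=\mathbb{A}_{|I|-\operatorname{crk}_I}$, and put $n:=|I|$. (a) $I$ is either positive or principal, that is, $\operatorname{crk}_I\in\{0,1\}$. (b) If $I$ is positive, then: (b1) $I$ is strongly Gram $\mathbb{Z}$-congruent with the one-peak poset ${}_0\mathbb{A}_{n-1}^*$; (b2) $\mathrm{cox}_I(t)=t^{n}+t^{n-1}+\cdots+t+1\in\mathbb{Z}[t]$; (b3) $\mathbf{c}_I=n+1$. (c) If $I$ is principal, then: (c1) $I$ is strongly Gram $\mathbb{Z}$-congruent with the canonical two peak poset ${}_p\widetilde{\mathbb{A}}_{n}$, where $p:=c(I)$ is the cycle index of $I$; (c2) $\mathrm{cox}_I(t)=t^n-t^p-t^{n-p}+1\in\mathbb{Z}[t]$; (c3) $\mathbf{c}_I=\infty$ and $\check{\mathbf{c}}_I=\operatorname{lcm}(p,n-p)$.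
   Context: A finite poset $I=(\{1,\dots,n\},\preceq)$ has incidence matrix $C_I=[c_{ij}]\in\mathbb{M}_n(\mathbb{Z})$ with $c_{ij}=1$ if $i\preceq j$ and $c_{ij}=0$ otherwise, symmetric Gram matrix $G_I=\tfrac12(C_I+C_I^{tr})$, and incidence quadratic form $q_I(x)=x C_I x^{tr}=\sum_{i\preceq j}x_ix_j$ on $\mathbb{Z}^n$; $\operatorname{Ker} q_I=\{v\in\mathbb{Z}^n: q_I(v)=0\}$. Its Hasse digraph $\mathcal{H}(I)$ has an arrow $i\to j$ iff $i\prec j$ and no $k$ lies strictly between; $I$ is connected if $\mathcal{H}(I)$ is connected as an undirected graph. $I$ is non-negative of corank $\operatorname{crk}_I=r$ if $G_I$ is positive semi-definite of rank $n-r$; positive means $r=0$, principal means $r=1$. Dynkin type: if $I$ is connected non-negative of corank $r$, then $\operatorname{Ker} q_I$ has a $\mathbb{Z}$-basis $h^{(k_1)},\dots,h^{(k_r)}$ with $h^{(k_i)}_{k_j}=\delta_{ij}$ for suitable elements $k_1<\dots<k_r$, and $I\setminus\{k_1,\dots,k_r\}$ is connected positive (for $r=0$ take $I$ itself); $\mathrm{Dyn}_I$ is the unique simply-laced Dynkin diagram $\Delta\in\{\mathbb{A}_m,\mathbb{D}_m,\mathbb{E}_6,\mathbb{E}_7,\mathbb{E}_8\}$ such that $G_{I\setminus\{k_1,\dots,k_r\}}$ is $\mathbb{Z}$-congruent to $G_\Delta$, the symmetric matrix with $1$ on the diagonal, $-\tfrac12$ in positions $(u,v)$ for edges $u-v$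 of $\Delta$, and $0$ elsewhere ($\mathbb{A}_m$ is the path with $m$ vertices). Two square integer matrices $X,Y$ are $\mathbb{Z}$-congruent if $B^{tr}XB=Y$ for some $B\in\mathrm{Gl}(n,\mathbb{Z})$. Posets $I,J$ are strongly Gram $\mathbb{Z}$-congruent ($I\approx_\mathbb{Z}J$) if $C_I$ and $C_J$ are $\mathbb{Z}$-congruent. Coxeter matrix $\mathrm{Cox}_I=-C_I(C_I^{tr})^{-1}$, Coxeter polynomial $\mathrm{cox}_I(t)=\det(tE-\mathrm{Cox}_I)$. The Coxeter number $\mathbf{c}_I$ is the least $c\ge1$ with $\mathrm{Cox}_I^c=E$ ($\infty$ if none); the reduced Coxeter number $\check{\mathbf{c}}_I$ is the least $c\ge1$ with $e_i(\mathrm{Cox}_I^{c}-E)\in\operatorname{Ker}q_I$ for all $i$. The poset ${}_0\mathbb{A}_{n-1}^*$ is the $n$-element chain $1\prec 2\prec\cdots\prec n$. For $n\ge4$ and $\tfrac n2\le p\le n-2$, ${}_p\widetilde{\mathbb{A}}_n$ is the poset on $\{1,\dots,n\}$ whose Hasse digraph consists of the chains $1\to3\to4\to\cdots\to p\to n$ and $2\to p+1\to p+2\to\cdots\to n-2\to n$ together with arrows $1\to n-1$ and $2\to n-1$. Cycle index: if $I$ is connected principal of Dynkin type $\mathbb{A}_{n-1}$, then the underlying graph of $\mathcal{H}(I)$ is a cycle through all $n$ elements; traversing it in one cyclic direction, let $r$ be the number of arrows oriented along the traversal and $l$ the number oriented against it; $c(I):=\max(r,l)$. *)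

theory Defs
  imports
    "HOL-Library.Extended_Nat"
    "Jordan_Normal_Form.Char_Poly"
    "Jordan_Normal_Form.DL_Rank"
begin

(* A finite poset is given by a finite set S of natural numbers and an order relation r on S.
   The rows and columns of the matrices attached to it are numbered by the elements of S in
   increasing order; for S = {1..n}, the element k has the (0-based) matrix index k - 1.
   Every definition taking S and r depends only on r restricted to S. *)

definition incidence_mat :: "nat set \<Rightarrow> nat rel \<Rightarrow> int mat" where
  "incidence_mat S r = mat (card S) (card S)
     (\<lambda>(i, j). if (sorted_list_of_set S ! i, sorted_list_of_set S ! j) \<in> r then 1 else 0)"

definition gram_mat :: "nat set \<Rightarrow> nat rel \<Rightarrow> real mat" where
  "gram_mat S r =
     (1/2) \<cdot>\<^sub>m map_mat of_int (incidence_mat S r + transpose_mat (incidence_mat S r))"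

definition quad_form :: "nat set \<Rightarrow> nat rel \<Rightarrow> int vec \<Rightarrow> int" where
  "quad_form S r v = v \<bullet> (incidence_mat S r *\<^sub>v v)"

definition ker_form :: "nat set \<Rightarrow> nat rel \<Rightarrow> int vec set" where
  "ker_form S r = {v \<in> carrier_vec (card S). quad_form S r v = 0}"

definition hasse :: "nat set \<Rightarrow> nat rel \<Rightarrow> nat rel" where
  "hasse S r = {(i, j). i \<in> S \<and> j \<in> S \<and> (i, j) \<in> r \<and> i \<noteq> j \<and>
     \<not> (\<exists>k\<in>S. k \<noteq> i \<and> k \<noteq> j \<and> (i, k) \<in> r \<and> (k, j) \<in> r)}"

definition connected_poset :: "nat set \<Rightarrow> nat rel \<Rightarrow> bool" where
  "connected_poset S r \<longleftrightarrow>
     S \<noteq> {} \<and> (\<forall>i\<in>S. \<forall>j\<in>S. (i, j) \<in> (hasse S r \<union> (hasse S r)\<inverse>)\<^sup>*)"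

definition positive_semidefinite :: "real mat \<Rightarrow> bool" where
  "positive_semidefinite A \<longleftrightarrow> square_mat A \<and> transpose_mat A = A \<and>
     (\<forall>x \<in> carrier_vec (dim_row A). 0 \<le> x \<bullet> (A *\<^sub>v x))"

definition nonnegative_poset :: "nat set \<Rightarrow> nat rel \<Rightarrow> bool" where
  "nonnegative_poset S r \<longleftrightarrow> positive_semidefinite (gram_mat S r)"

definition corank :: "nat set \<Rightarrow> nat rel \<Rightarrow> nat" where
  "corank S r = card S - vec_space.rank (card S) (gram_mat S r)"

definition positive_poset :: "nat set \<Rightarrow> nat rel \<Rightarrow> bool" where
  "positive_poset S r \<longleftrightarrow> nonnegative_poset S r \<and> corank S r = 0"

definition principal_poset :: "nat set \<Rightarrow> nat rel \<Rightarrow> bool" where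
  "principal_poset S r \<longleftrightarrow> nonnegative_poset S r \<and> corank S r = 1"

(* The congruence matrix is integral; the congruent matrices themselves may have entries in a
   larger ring, as is the case for the half-integral Gram matrices. *)
definition Z_congruent :: "'a::comm_ring_1 mat \<Rightarrow> 'a mat \<Rightarrow> bool" where
  "Z_congruent X Y \<longleftrightarrow> square_mat X \<and> square_mat Y \<and> dim_row X = dim_row Y \<and>
     (\<exists>B :: int mat. B \<in> carrier_mat (dim_row X) (dim_row X) \<and> invertible_mat B \<and>
        transpose_mat (map_mat of_int B) * X * map_mat of_int B = Y)"

definition strongly_gram_congruent :: "nat set \<Rightarrow> nat rel \<Rightarrow> nat set \<Rightarrow> nat rel \<Rightarrow> bool" where
  "strongly_gram_congruent S r T s \<longleftrightarrow> Z_congruent (incidence_mat S r) (incidence_mat T s)"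

datatype dynkin = Dyn_A nat | Dyn_D nat | Dyn_E nat

fun dynkin_size :: "dynkin \<Rightarrow> nat" where
  "dynkin_size (Dyn_A m) = m"
| "dynkin_size (Dyn_D m) = m"
| "dynkin_size (Dyn_E m) = m"

fun is_dynkin :: "dynkin \<Rightarrow> bool" where
  "is_dynkin (Dyn_A m) \<longleftrightarrow> 1 \<le> m"
| "is_dynkin (Dyn_D m) \<longleftrightarrow> 4 \<le> m"
| "is_dynkin (Dyn_E m) \<longleftrightarrow> m \<in> {6, 7, 8}"

(* Vertices are 0, ..., m - 1. The diagrams D_m and E_m arise from the path on 0, ..., m - 2 by
   joining the last vertex m - 1 to the last but one, respectively to the third, vertex of it. *)
fun dynkin_edges :: "dynkin \<Rightarrow> (nat \<times> nat) set" where
  "dynkin_edges (Dyn_A m) = {(i, Suc i) | i. Suc i < m}"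
| "dynkin_edges (Dyn_D m) = {(i, Suc i) | i. Suc i < m - 1} \<union> {(m - 3, m - 1)}"
| "dynkin_edges (Dyn_E m) = {(i, Suc i) | i. Suc i < m - 1} \<union> {(2, m - 1)}"

definition dynkin_gram :: "dynkin \<Rightarrow> real mat" where
  "dynkin_gram \<Delta> = mat (dynkin_size \<Delta>) (dynkin_size \<Delta>)
     (\<lambda>(i, j). if i = j then 1
       else if (i, j) \<in> dynkin_edges \<Delta> \<or> (j, i) \<in> dynkin_edges \<Delta> then - 1/2 else 0)"

definition Z_comb :: "nat \<Rightarrow> nat set \<Rightarrow> (nat \<Rightarrow> int vec) \<Rightarrow> (nat \<Rightarrow> int) \<Rightarrow> int vec" where
  "Z_comb n K h c = vec n (\<lambda>i. \<Sum>k\<in>K. c k * h k $ i)"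

definition Z_basis :: "nat \<Rightarrow> int vec set \<Rightarrow> nat set \<Rightarrow> (nat \<Rightarrow> int vec) \<Rightarrow> bool" where
  "Z_basis n V K h \<longleftrightarrow> finite K \<and> (\<forall>k\<in>K. h k \<in> carrier_vec n) \<and>
     V = range (Z_comb n K h) \<and>
     (\<forall>c. Z_comb n K h c = 0\<^sub>v n \<longrightarrow> (\<forall>k\<in>K. c k = 0))"

(* Meaningful for a connected non-negative order r on {1..n}. K is the set of the removed elements,
   as many as the corank, and h k is the basis vector of the kernel attached to k \<in> K. The type does
   not depend on the choice of K and h. *)
definition has_dynkin_type :: "nat \<Rightarrow> nat rel \<Rightarrow> dynkin \<Rightarrow> bool" where
  "has_dynkin_type n r \<Delta> \<longleftrightarrow> is_dynkin \<Delta> \<and>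
     (\<exists>K h. K \<subseteq> {1..n} \<and> card K = corank {1..n} r \<and>
        Z_basis n (ker_form {1..n} r) K h \<and>
        (\<forall>i\<in>K. \<forall>j\<in>K. h i $ (j - 1) = (if i = j then 1 else 0)) \<and>
        connected_poset ({1..n} - K) r \<and> positive_poset ({1..n} - K) r \<and>
        Z_congruent (gram_mat ({1..n} - K) r) (dynkin_gram \<Delta>))"

definition mat_inv :: "'a::comm_ring_1 mat \<Rightarrow> 'a mat" where
  "mat_inv A = (THE B. B \<in> carrier_mat (dim_row A) (dim_row A) \<and>
     inverts_mat A B \<and> inverts_mat B A)"

definition coxeter_mat :: "nat set \<Rightarrow> nat rel \<Rightarrow> int mat" where
  "coxeter_mat S r = - (incidence_mat S r * mat_inv (transpose_mat (incidence_mat S r)))"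

definition coxeter_poly :: "nat set \<Rightarrow> nat rel \<Rightarrow> int poly" where
  "coxeter_poly S r = char_poly (coxeter_mat S r)"

(* Infima in enat: the least element if there is one, \<infinity> otherwise. *)
definition coxeter_number :: "nat set \<Rightarrow> nat rel \<Rightarrow> enat" where
  "coxeter_number S r = Inf {enat c | c. 1 \<le> c \<and> coxeter_mat S r ^\<^sub>m c = 1\<^sub>m (card S)}"

(* The row vector e_i * M is the i-th row of M. *)
definition reduced_coxeter_number :: "nat set \<Rightarrow> nat rel \<Rightarrow> enat" where
  "reduced_coxeter_number S r = Inf {enat c | c. 1 \<le> c \<and>
     (\<forall>i < card S. row (coxeter_mat S r ^\<^sub>m c - 1\<^sub>m (card S)) i \<in> ker_form S r)}"

definition chain_poset :: "nat \<Rightarrow> nat rel" where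
  "chain_poset n = {(i, j). 1 \<le> i \<and> i \<le> j \<and> j \<le> n}"

definition path_arrows :: "nat list \<Rightarrow> nat rel" where
  "path_arrows xs = set (zip xs (tl xs))"

(* The lists 3, ..., p and p + 1, ..., n - 2 are empty for p = 2 and p = n - 2, respectively. *)
definition two_peak_arrows :: "nat \<Rightarrow> nat \<Rightarrow> nat rel" where
  "two_peak_arrows p n =
     path_arrows (1 # [3..<p + 1] @ [n]) \<union> path_arrows (2 # [p + 1..<n - 1] @ [n])
     \<union> {(1, n - 1), (2, n - 1)}"

definition two_peak_poset :: "nat \<Rightarrow> nat \<Rightarrow> nat rel" where
  "two_peak_poset p n = (two_peak_arrows p n)\<^sup>* \<inter> ({1..n} \<times> {1..n})"

definition cyclic_steps :: "nat list \<Rightarrow> nat rel" where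
  "cyclic_steps xs = {(xs ! i, xs ! (Suc i mod length xs)) | i. i < length xs}"

(* The underlying graph of the Hasse digraph is a cycle, and xs lists its vertices in the order of
   a traversal. *)
definition hasse_cycle :: "nat set \<Rightarrow> nat rel \<Rightarrow> nat list \<Rightarrow> bool" where
  "hasse_cycle S r xs \<longleftrightarrow> 3 \<le> length xs \<and> distinct xs \<and> set xs = S \<and>
     hasse S r \<union> (hasse S r)\<inverse> = cyclic_steps xs \<union> (cyclic_steps xs)\<inverse>"

(* Changing the starting point of a traversal does not affect the two numbers of arrows, and
   changing its direction interchanges them; hence the choice of xs is immaterial. *)
definition cycle_index :: "nat set \<Rightarrow> nat rel \<Rightarrow> nat" where
  "cycle_index S r = (let xs = (SOME xs. hasse_cycle S r xs) in
     max (card (cyclic_steps xs \<inter> hasse S r)) (card (cyclic_steps xs \<inter> (hasse S r)\<inverse>)))"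

end

theory Submission
  imports Defs
begin

text \<open>
  Dynkin type A provides vectors of the form \<open>e\<^sub>a - e\<^sub>b\<close>, one for each element of the
  poset, whose inner products are the entries of twice the Gram matrix. As these entries are
  non-negative, no vertex is a head of one vector and a tail of another, and two elements are
  comparable iff they share an endpoint. Transitivity of the order then forces all intervals to be
  chains and all vertices of the Hasse diagram to have degree at most 2: the diagram is a path or a
  cycle, and the inverse of the incidence matrix is the identity minus the adjacency matrix of the
  Hasse quiver. Reversing all arrows at a sink is a congruence of such matrices, and these moves
  bring a path to the linear orientation and a cycle to the orientation with a single source and a
  single sink, keeping the numbers of arrows in the two directions. For the two normal forms
  twice the Gram matrix factors as \<open>M M\<^sup>T\<close> such that the Coxeter matrix \<open>X\<close> satisfies \<open>X M = M \<Lambda>\<close> for a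
  permutation matrix \<open>\<Lambda>\<close> with one cycle of length \<open>n + 1\<close>, respectively with two cycles of lengths
  \<open>p\<close> and \<open>n - p\<close>; all Coxeter invariants are read off \<open>\<Lambda>\<close>. The corank is the rank of the kernel,
  which the normal forms show to be 0 for a path and 1 for a cycle.
\<close>

section \<open>Posets labelled by roots of type A\<close>

text \<open>The type only describes the poset left after deleting \<open>K\<close>. Semidefiniteness
  supplies the roots of the deleted elements: an integral null vector lies in the radical, so
  subtracting the kernel vector attached to \<open>k\<close> from the unit vector of
  \<open>k\<close> keeps all inner products and moves the support off \<open>K\<close>. The
  reductions act on inverses of incidence matrices because these are sparse: changing the arrows at
  one vertex is a single reflection, whereas the change of the order relation is global. The price
  is that the words passed through need not come from posets. In the cyclic normal form two paths
  lead from the source to the sink, so the inverse of its matrix has an entry 2 and is no incidence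
  matrix; hence Coxeter matrices and factorizations are set up for arbitrary integral forms. The
  canonical poset avoids the double path by having two minimal elements and two peaks. The positive
  and the principal case part at one point: the factor \<open>M\<close> of the chain has a right
  inverse and can be cancelled, that of the cycle is singular. This separates the Coxeter number
  from the reduced one.\<close>

locale root_labelled_poset =
  fixes S :: "nat set" and r :: "nat rel" and a b :: "nat \<Rightarrow> nat"
  assumes finite: "finite S"
    and po: "partial_order_on S r"
    and comparable_iff: "\<And>i j. i \<in> S \<Longrightarrow> j \<in> S \<Longrightarrow> i \<noteq> j \<Longrightarrow>
      (i, j) \<in> r \<or> (j, i) \<in> r \<longleftrightarrow> a i = a j \<or> b i = b j"
    and labels_inj: "\<And>i j. i \<in> S \<Longrightarrow> j \<in> S \<Longrightarrow> i \<noteq> j \<Longrightarrow> a i = a j \<Longrightarrow> b i = b j \<Longrightarrow> False"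
begin

lemma refl: "i \<in> S \<Longrightarrow> (i, i) \<in> r"
  using po by (auto simp: partial_order_on_def preorder_on_def refl_on_def)

lemma trans: "(i, j) \<in> r \<Longrightarrow> (j, k) \<in> r \<Longrightarrow> (i, k) \<in> r"
  using po by (auto simp: partial_order_on_def preorder_on_def dest: transD)

lemma antisym: "(i, j) \<in> r \<Longrightarrow> (j, i) \<in> r \<Longrightarrow> i = j"
  using po by (auto simp: partial_order_on_def dest: antisymD)

text \<open>Read \<open>i\<close> as an edge joining \<open>a i\<close> to \<open>b i\<close> in a
  bipartite graph. By \<open>labels_inj\<close> there are no multiple edges, and a bipartite graph
  has no triangles, so pairwise adjacent edges form a star.\<close>

lemma chain3_same_label:
  assumes S: "i \<in> S" "j \<in> S" "k \<in> S" and ij: "(i, j) \<in> r" "i \<noteq> j" and jk: "(j, k) \<in> r" "j \<noteq> k"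
  shows "(a i = a j \<and> a j = a k) \<or> (b i = b j \<and> b j = b k)"
proof -
  have ik: "i \<noteq> k" "(i, k) \<in> r" using ij jk antisym trans by blast+
  have "a i = a j \<or> b i = b j" "a j = a k \<or> b j = b k" "a i = a k \<or> b i = b k"
    using comparable_iff S ij jk ik by blast+
  then show ?thesis using labels_inj S ij jk by metis
qed

text \<open>Both 3-chains from \<open>i\<close> to \<open>j\<close> lie in a star, and
  \<open>i\<close> and \<open>j\<close> agree in only one of the two labels, so it is the same star.
  This is what leaves \<open>i\<close> a single upper cover below \<open>j\<close>.\<close>

lemma interval_chain:
  assumes S: "i \<in> S" "j \<in> S" "k \<in> S" "l \<in> S"
    and r: "(i, k) \<in> r" "(k, j) \<in> r" "(i, l) \<in> r" "(l, j) \<in> r"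
  shows "(k, l) \<in> r \<or> (l, k) \<in> r"
proof (cases "i = k \<or> k = j \<or> i = l \<or> l = j \<or> k = l")
  case True
  then show ?thesis using r refl S by blast
next
  case False
  have "i \<noteq> j" using antisym r False by blast
  have "(a i = a k \<and> a k = a j) \<or> (b i = b k \<and> b k = b j)"
    "(a i = a l \<and> a l = a j) \<or> (b i = b l \<and> b l = b j)"
    using chain3_same_label[of i k j] chain3_same_label[of i l j] S r False by auto
  then have "a k = a l \<or> b k = b l" using labels_inj[of i j] \<open>i \<noteq> j\<close> S by metis
  then show ?thesis using comparable_iff[of k l] S False by blast
qed

lemma hasse_D:
  assumes "(i, j) \<in> hasse S r"
  shows "i \<in> S" "j \<in> S" "(i, j) \<in> r" "i \<noteq> j"
    "\<And>k. k \<in> S \<Longrightarrow> (i, k) \<in> r \<Longrightarrow> (k, j) \<in> r \<Longrightarrow> k = i \<or> k = j"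
  using assms by (auto simp: hasse_def)

lemma hasse_asym: "(i, j) \<in> hasse S r \<Longrightarrow> (j, i) \<notin> hasse S r"
  using antisym hasse_D by blast

lemma ex_upper_cover:
  assumes "i \<in> S" "j \<in> S" "(i, j) \<in> r" "i \<noteq> j"
  shows "\<exists>k. (i, k) \<in> hasse S r \<and> (k, j) \<in> r"
  using assms
proof (induction "card {k \<in> S. (i, k) \<in> r \<and> (k, j) \<in> r}" arbitrary: j rule: less_induct)
  case less
  show ?case
  proof (cases "(i, j) \<in> hasse S r")
    case True
    then show ?thesis using refl less.prems by blast
  next
    case False
    then obtain l where l: "l \<in> S" "l \<noteq> i" "l \<noteq> j" "(i, l) \<in> r" "(l, j) \<in> r"
      using less.prems by (auto simp: hasse_def)
    have "j \<notin> {k \<in> S. (i, k) \<in> r \<and> (k, l) \<in> r}" using antisym l by blast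
    then have "{k \<in> S. (i, k) \<in> r \<and> (k, l) \<in> r} \<subset> {k \<in> S. (i, k) \<in> r \<and> (k, j) \<in> r}"
      using l less.prems refl[of j] trans by blast
    then have "card {k \<in> S. (i, k) \<in> r \<and> (k, l) \<in> r} < card {k \<in> S. (i, k) \<in> r \<and> (k, j) \<in> r}"
      using finite by (intro psubset_card_mono) auto
    from less.hyps[OF this] l less.prems show ?thesis using trans by blast
  qed
qed

lemma upper_cover_unique:
  assumes "j \<in> S" "(i, k) \<in> hasse S r" "(k, j) \<in> r" "(i, l) \<in> hasse S r" "(l, j) \<in> r"
  shows "k = l"
  using interval_chain[of i j k l] assms hasse_D[of i k] hasse_D[of i l] by blast

text \<open>With a common label \<open>x\<close> and \<open>y\<close> would be comparable, and one
  of them would lie strictly between \<open>j\<close> and the other.\<close>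

lemma hasse_up_label: 
  assumes "(j, x) \<in> hasse S r" "(j, y) \<in> hasse S r" "x \<noteq> y"
  shows "a x \<noteq> a y \<and> b x \<noteq> b y"
  using comparable_iff[of x y] assms hasse_D[of j x] hasse_D[of j y] by blast

lemma hasse_down_label: 
  assumes "(x, j) \<in> hasse S r" "(y, j) \<in> hasse S r" "x \<noteq> y"
  shows "a x \<noteq> a y \<and> b x \<noteq> b y"
  using comparable_iff[of x y] assms hasse_D[of x j] hasse_D[of y j] by blast

lemma hasse_label:
  assumes "(i, j) \<in> hasse S r" shows "a i = a j \<or> b i = b j"
  using comparable_iff[of i j] hasse_D[OF assms] by blast

lemma hasse_chain3:
  assumes "(x, j) \<in> hasse S r" "(j, y) \<in> hasse S r"
  shows "(a x = a j \<and> a j = a y) \<or> (b x = b j \<and> b j = b y)"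
  using chain3_same_label[of x j y] hasse_D[OF assms(1)] hasse_D[OF assms(2)] by blast

text \<open>\<open>z\<close> and \<open>j\<close> agree in only one label, so the star containing
  \<open>z\<close>, \<open>j\<close>, \<open>x\<close> is also the one containing \<open>z\<close>,
  \<open>j\<close>, \<open>y\<close>; then \<open>x\<close> and \<open>y\<close> share a label,
  which distinct upper covers cannot do.\<close>

lemma hasse_no_up_up_down:
  assumes "(j, x) \<in> hasse S r" "(j, y) \<in> hasse S r" "(z, j) \<in> hasse S r" shows "x = y"
  using hasse_chain3[OF assms(3,1)] hasse_chain3[OF assms(3,2)] hasse_up_label[OF assms(1,2)]
    labels_inj[of z j] hasse_D[OF assms(3)] by metis

lemma hasse_no_down_down_up:
  assumes "(x, j) \<in> hasse S r" "(y, j) \<in> hasse S r" "(j, z) \<in> hasse S r" shows "x = y"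
  using hasse_chain3[OF assms(1,3)] hasse_chain3[OF assms(2,3)] hasse_down_label[OF assms(1,2)]
    labels_inj[of j z] hasse_D[OF assms(3)] by metis

text \<open>Pigeonhole if all three lie on one side of \<open>j\<close>: each shares one of only two
  labels with \<open>j\<close>, so two of them share a label with each other. With neighbours on
  both sides there is just one above and one below.\<close>

lemma hasse_degree_le_2:
  assumes "(j, x) \<in> hasse S r \<union> (hasse S r)\<inverse>" "(j, y) \<in> hasse S r \<union> (hasse S r)\<inverse>"
    "(j, z) \<in> hasse S r \<union> (hasse S r)\<inverse>"
  shows "x = y \<or> y = z \<or> x = z"
proof (rule ccontr)
  assume neg: "\<not> ?thesis"
  have up: False if "(j, x) \<in> hasse S r" "(j, y) \<in> hasse S r" "(j, z) \<in> hasse S r"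
    using hasse_label that hasse_up_label neg by metis
  have down: False if "(x, j) \<in> hasse S r" "(y, j) \<in> hasse S r" "(z, j) \<in> hasse S r"
    using hasse_label that hasse_down_label neg by metis
  show False
    using assms neg up down hasse_no_up_up_down hasse_no_down_down_up by blast
qed

end

section \<open>Connected graphs of degree at most two\<close>

text \<open>A longest path exhausts the graph: its ends have no neighbours off it, and each interior
  vertex has both of its neighbours on it. \<open>L\<close> counts the steps, so that one formula
  for \<open>P\<close> covers the path (\<open>L = length xs - 1\<close>) and the cycle
  (\<open>L = length xs\<close>).\<close>

lemma connected_degree_le_2_path_or_cycle:
  fixes G :: "nat rel"
  assumes fin: "finite S" and ne: "S \<noteq> {}" and GS: "G \<subseteq> S \<times> S"
    and symG: "\<And>u v. (u, v) \<in> G \<Longrightarrow> (v, u) \<in> G" and irr: "\<And>u. (u, u) \<notin> G"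
    and conn: "\<And>u v. u \<in> S \<Longrightarrow> v \<in> S \<Longrightarrow> (u, v) \<in> G\<^sup>*"
    and deg: "\<And>u x y z. (u, x) \<in> G \<Longrightarrow> (u, y) \<in> G \<Longrightarrow> (u, z) \<in> G \<Longrightarrow> x = y \<or> y = z \<or> x = z"
  shows "\<exists>xs L. distinct xs \<and> set xs = S \<and>
     (Suc L = length xs \<or> L = length xs \<and> 3 \<le> length xs) \<and>
     (let P = {(xs ! i, xs ! (Suc i mod length xs)) | i. i < L} in G = P \<union> P\<inverse>)"
proof -
  define path where "path xs \<longleftrightarrow> xs \<noteq> [] \<and> distinct xs \<and> set xs \<subseteq> S \<and>
    (\<forall>i. Suc i < length xs \<longrightarrow> (xs ! i, xs ! Suc i) \<in> G)" for xs
  have len: "length xs \<le> card S" if "path xs" for xs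
    using that fin unfolding path_def by (metis card_mono distinct_card)
  obtain s where "s \<in> S" using ne by blast
  then have "path [s]" by (simp add: path_def)
  then obtain xs where xs: "path xs" and longest: "\<And>ys. path ys \<Longrightarrow> length ys \<le> length xs"
    using ex_has_greatest_nat[of path "[s]" length "card S + 1"] len by (metis less_Suc_eq_le Suc_eq_plus1)
  have ne': "xs \<noteq> []" and dist: "distinct xs" and sub: "set xs \<subseteq> S"
    and step: "\<And>i. Suc i < length xs \<Longrightarrow> (xs ! i, xs ! Suc i) \<in> G"
    using xs by (auto simp: path_def)
  have closed: "v \<in> set xs" if u: "u \<in> set xs" and uv: "(u, v) \<in> G" for u v
  proof (rule ccontr)
    assume v: "v \<notin> set xs"
    have vS: "v \<in> S" using uv GS by blast
    obtain i where i: "i < length xs" "u = xs ! i" using u by (metis in_set_conv_nth)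
    consider "i = 0" | "Suc i = length xs" | "0 < i" "Suc i < length xs" using i by linarith
    then show False
    proof cases
      case 1
      have "path (v # xs)" unfolding path_def
        using ne' dist sub v vS step symG[OF uv] 1 i
        by (auto simp: nth_Cons split: nat.splits)
      then show False using longest by fastforce
    next
      case 2
      have "(xs ! j, (xs @ [v]) ! Suc j) \<in> G" if "j < length xs" for j
      proof (cases "Suc j = length xs")
        case True
        then have "j = i" using 2 by simp
        then show ?thesis using uv i 2 by (simp add: nth_append)
      next
        case False
        then show ?thesis using that step[of j] by (simp add: nth_append)
      qed
      then have "path (xs @ [v])" unfolding path_def
        using ne' dist sub v vS by (auto simp: nth_append)
      then show False using longest by fastforce
    next
      case 3
      then have "(u, xs ! (i - 1)) \<in> G" "(u, xs ! Suc i) \<in> G"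
        using step[of "i - 1"] step[of i] symG i by auto
      moreover have "xs ! (i - 1) \<noteq> xs ! Suc i" using dist 3 i by (simp add: nth_eq_iff_index_eq)
      ultimately show False using deg[OF uv] v 3 i by (metis nth_mem less_imp_diff_less)
    qed
  qed
  have "v \<in> set xs" if "(u, v) \<in> G\<^sup>*" "u \<in> set xs" for u v
    using that by (induction rule: rtrancl_induct) (use closed in auto)
  then have set: "set xs = S" using sub conn ne' by (metis hd_in_set subset_antisym subset_iff)
  let ?n = "length xs"
  have edge: "j = Suc i \<or> (i = 0 \<and> Suc j = ?n \<and> 3 \<le> ?n)"
    if ij: "i < j" "j < ?n" and G: "(xs ! i, xs ! j) \<in> G" for i j
  proof (rule ccontr)
    assume "\<not> ?thesis"
    then have neq: "j \<noteq> Suc i" "i > 0 \<or> Suc j < ?n" using ij by auto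
    then consider "i > 0" | "Suc j < ?n" by blast
    then show False
    proof cases
      case 1
      then have "(xs ! i, xs ! (i - 1)) \<in> G" "(xs ! i, xs ! Suc i) \<in> G"
        using step[of "i - 1"] step[of i] symG ij by auto
      from deg[OF this G] show False using dist 1 ij neq by (auto simp: nth_eq_iff_index_eq)
    next
      case 2
      then have "(xs ! j, xs ! (j - 1)) \<in> G" "(xs ! j, xs ! Suc j) \<in> G"
        using step[of "j - 1"] step[of j] symG ij by auto
      from deg[OF this symG[OF G]] show False using dist 2 ij neq by (auto simp: nth_eq_iff_index_eq)
    qed
  qed
  \<comment> \<open>\<open>c\<close> says that an extra edge joins the two ends. On two vertices
    that edge would be the only step of the path again, hence the bound 3.\<close>
  define c where "c \<longleftrightarrow> 3 \<le> ?n \<and> (xs ! 0, xs ! (?n - 1)) \<in> G"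
  define L where "L = (if c then ?n else ?n - 1)"
  let ?P = "{(xs ! i, xs ! (Suc i mod ?n)) | i. i < L}"
  have P: "p \<in> G" if p: "p \<in> ?P" for p
  proof -
    obtain i where i: "i < L" "p = (xs ! i, xs ! (Suc i mod ?n))" using p by blast
    show ?thesis
    proof (cases "Suc i < ?n")
      case True then show ?thesis using step i by simp
    next
      case False
      then have "c" "i = ?n - 1" "Suc i = ?n" using i by (auto simp: L_def split: if_splits)
      then show ?thesis using i symG by (auto simp: c_def)
    qed
  qed
  have Q: "(xs ! i, xs ! j) \<in> ?P \<union> ?P\<inverse>" if ij: "i < j" "j < ?n" and G: "(xs ! i, xs ! j) \<in> G" for i j
    using edge[OF that]
  proof
    assume "j = Suc i"
    then have "i < L" "Suc i mod ?n = j" using ij by (auto simp: L_def)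
    then show ?thesis by blast
  next
    assume *: "i = 0 \<and> Suc j = ?n \<and> 3 \<le> ?n"
    then have "j = ?n - 1" by linarith
    then have "c" using G * by (simp add: c_def)
    then have "j < L" "Suc j mod ?n = i" using ij * by (auto simp: L_def)
    then have "(xs ! j, xs ! i) \<in> ?P" by blast
    then show ?thesis by blast
  qed
  have "G = ?P \<union> ?P\<inverse>"
  proof (intro equalityI subsetI)
    fix p assume "p \<in> ?P \<union> ?P\<inverse>"
    moreover have "x \<in> G" if "x \<in> A \<union> A\<inverse>" "A \<subseteq> G" for A x
      using that symG by (cases x) auto
    ultimately show "p \<in> G" using P by (metis (no_types, lifting) subsetI)
  next
    fix p assume p: "p \<in> G"
    then obtain i j where ij: "i < ?n" "j < ?n" "p = (xs ! i, xs ! j)"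
      using GS unfolding set[symmetric] by (force simp: in_set_conv_nth)
    consider "i < j" | "j < i" | "i = j" by linarith
    then show "p \<in> ?P \<union> ?P\<inverse>"
    proof cases
      case 1 then show ?thesis using Q[of i j] p ij by simp
    next
      case 2 then have "(xs ! j, xs ! i) \<in> ?P \<union> ?P\<inverse>" using Q[of j i] p ij symG by simp
      then show ?thesis unfolding ij(3) by blast
    next
      case 3 then show ?thesis using irr p ij by simp
    qed
  qed
  moreover have "Suc L = ?n \<or> L = ?n \<and> 3 \<le> ?n" using ne' by (auto simp: L_def c_def)
  ultimately show ?thesis unfolding Let_def using dist set by (intro exI[of _ xs] exI[of _ L]) simp
qed

section \<open>Congruence of Euler matrices\<close>

definition congruent_mat :: "nat \<Rightarrow> int mat \<Rightarrow> int mat \<Rightarrow> bool" where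
  "congruent_mat n A A' \<longleftrightarrow> (\<exists>B B'. B \<in> carrier_mat n n \<and> B' \<in> carrier_mat n n \<and>
     B * B' = 1\<^sub>m n \<and> B' * B = 1\<^sub>m n \<and> A' = B\<^sup>T * A * B)"

text \<open>Over the rationals a one-sided inverse is two-sided, and the embedding of the integers
  is injective on matrices.\<close>

lemma int_mat_left_inverse_imp_right:
  fixes A B :: "int mat"
  assumes A: "A \<in> carrier_mat n n" and B: "B \<in> carrier_mat n n" and AB: "A * B = 1\<^sub>m n"
  shows "B * A = 1\<^sub>m n"
proof -
  let ?f = "map_mat rat_of_int"
  have "?f A * ?f B = ?f (A * B)" by (rule of_int_hom.mat_hom_mult[OF A B, symmetric])
  also have "\<dots> = 1\<^sub>m n" unfolding AB by (rule of_int_hom.mat_hom_one)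
  finally have "?f B * ?f A = 1\<^sub>m n" using A B by (intro mat_mult_left_right_inverse[of "?f A" n "?f B"]) auto
  then have "?f (B * A) = 1\<^sub>m n" using of_int_hom.mat_hom_mult[OF B A, where 'a = rat] by simp
  then have "?f (B * A) = ?f (1\<^sub>m n)" unfolding of_int_hom.mat_hom_one .
  then show ?thesis by (rule of_int_hom.mat_hom_inj)
qed

lemma transpose_inverse:
  fixes A B :: "int mat"
  assumes A: "A \<in> carrier_mat n n" and B: "B \<in> carrier_mat n n" and AB: "A * B = 1\<^sub>m n"
  shows "B\<^sup>T * A\<^sup>T = 1\<^sub>m n"
  using transpose_mult[OF A B] AB by simp

lemma congruent_mat_refl: "A \<in> carrier_mat n n \<Longrightarrow> congruent_mat n A A"
  unfolding congruent_mat_def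
  by (rule exI[of _ "1\<^sub>m n"], rule exI[of _ "1\<^sub>m n"]) auto

lemma congruent_mat_sym:
  assumes A: "A \<in> carrier_mat n n" and "congruent_mat n A A'"
  shows "congruent_mat n A' A"
proof -
  obtain B B' where B: "B \<in> carrier_mat n n" and B': "B' \<in> carrier_mat n n"
    and i: "B * B' = 1\<^sub>m n" "B' * B = 1\<^sub>m n" and A': "A' = B\<^sup>T * A * B"
    using assms unfolding congruent_mat_def by blast
  have "B'\<^sup>T * A' * B' = B'\<^sup>T * (B\<^sup>T * A * B * B')"
    using A B B' unfolding A' by (subst assoc_mult_mat[of _ n n _ n _ n]) auto
  also have "B\<^sup>T * A * B * B' = B\<^sup>T * A * (B * B')"
    using A B B' by (subst assoc_mult_mat[of _ n n _ n _ n]) auto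
  also have "B'\<^sup>T * (B\<^sup>T * A * (B * B')) = B'\<^sup>T * B\<^sup>T * A"
    using A B B' unfolding i by (subst assoc_mult_mat[of _ n n _ n _ n]) auto
  also have "\<dots> = A" using transpose_inverse[OF B B' i(1)] A by simp
  finally show ?thesis unfolding congruent_mat_def using B B' i by metis
qed

lemma congruent_mat_trans:
  assumes A: "A \<in> carrier_mat n n" and "congruent_mat n A A'" "congruent_mat n A' A''"
  shows "congruent_mat n A A''"
proof -
  obtain B B' where B: "B \<in> carrier_mat n n" and B': "B' \<in> carrier_mat n n"
    and i: "B * B' = 1\<^sub>m n" "B' * B = 1\<^sub>m n" and A': "A' = B\<^sup>T * A * B"
    using assms unfolding congruent_mat_def by blast
  obtain D D' where D: "D \<in> carrier_mat n n" and D': "D' \<in> carrier_mat n n"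
    and j: "D * D' = 1\<^sub>m n" "D' * D = 1\<^sub>m n" and A'': "A'' = D\<^sup>T * A' * D"
    using assms unfolding congruent_mat_def by blast
  note as = assoc_mult_mat[of _ n n _ n _ n]
  have "(B * D) * (D' * B') = B * ((D * D') * B')" using B B' D D' by (simp add: as)
  then have 1: "(B * D) * (D' * B') = 1\<^sub>m n" using i j B B' by simp
  have "(D' * B') * (B * D) = D' * ((B' * B) * D)" using B B' D D' by (simp add: as)
  then have 2: "(D' * B') * (B * D) = 1\<^sub>m n" using i j D D' by simp
  have 3: "A'' = (B * D)\<^sup>T * A * (B * D)" unfolding A'' A' transpose_mult[OF B D]
    using A B D by (simp add: as)
  show ?thesis unfolding congruent_mat_def
    by (rule exI[of _ "B * D"], rule exI[of _ "D' * B'"]) (use B D B' D' 1 2 3 in auto)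
qed

text \<open>If \<open>E' = B\<^sup>T * E * B\<close> then \<open>C' = B' * C * B'\<^sup>T\<close>,
  again a congruence. This leads from quivers back to incidence matrices.\<close>

lemma congruent_mat_inverse:
  assumes E: "E \<in> carrier_mat n n" and C: "C \<in> carrier_mat n n" "E * C = 1\<^sub>m n"
    and E': "E' \<in> carrier_mat n n" and C': "C' \<in> carrier_mat n n" "E' * C' = 1\<^sub>m n"
    and con: "congruent_mat n E E'"
  shows "congruent_mat n C C'"
proof -
  note as = assoc_mult_mat[of _ n n _ n _ n]
  obtain B B' where B: "B \<in> carrier_mat n n" and B': "B' \<in> carrier_mat n n"
    and i: "B * B' = 1\<^sub>m n" "B' * B = 1\<^sub>m n" and eq: "E' = B\<^sup>T * E * B"
    using con unfolding congruent_mat_def by blast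
  have t1: "B\<^sup>T * B'\<^sup>T = 1\<^sub>m n" using transpose_inverse[OF B' B i(2)] .
  have t2: "B'\<^sup>T * B\<^sup>T = 1\<^sub>m n" using transpose_inverse[OF B B' i(1)] .
  have "E' * (B' * C * B'\<^sup>T) = B\<^sup>T * (E * ((B * B') * (C * B'\<^sup>T)))"
    using B B' E C unfolding eq by (simp add: as)
  also have "\<dots> = B\<^sup>T * (E * (C * B'\<^sup>T))" using B' E C by (simp add: i)
  also have "\<dots> = B\<^sup>T * ((E * C) * B'\<^sup>T)" using B' E C(1) by (simp add: as)
  also have "\<dots> = 1\<^sub>m n" using C B' t1 by simp
  finally have e: "E' * (B' * C * B'\<^sup>T) = 1\<^sub>m n" .
  have "C' * E' = 1\<^sub>m n" using int_mat_left_inverse_imp_right[OF E' C'] .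
  then have "C' = C' * (E' * (B' * C * B'\<^sup>T))" using e C' by simp
  also have "\<dots> = (C' * E') * (B' * C * B'\<^sup>T)" using C C' E' B' by (simp add: as)
  also have "\<dots> = B' * C * B'\<^sup>T" using \<open>C' * E' = 1\<^sub>m n\<close> C B' by simp
  finally have "C' = (B'\<^sup>T)\<^sup>T * C * B'\<^sup>T" by simp
  moreover have "B'\<^sup>T \<in> carrier_mat n n" "B\<^sup>T \<in> carrier_mat n n" using B B' by auto
  ultimately show ?thesis unfolding congruent_mat_def using t1 t2 by blast
qed

text \<open>The matrix of the Euler form of the quiver \<open>R\<close>; for acyclic
  \<open>R\<close> its inverse counts directed paths.\<close>

definition euler_mat :: "nat \<Rightarrow> nat rel \<Rightarrow> int mat" where
  "euler_mat n R = mat n n (\<lambda>(i, j). of_bool (i = j) - of_bool ((i, j) \<in> R))"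

lemma euler_mat_carrier [simp]: "euler_mat n R \<in> carrier_mat n n"
  by (simp add: euler_mat_def)

lemma euler_mat_dim [simp]: "dim_row (euler_mat n R) = n" "dim_col (euler_mat n R) = n"
  by (simp_all add: euler_mat_def)

lemma euler_mat_index [simp]: "i < n \<Longrightarrow> j < n \<Longrightarrow>
    euler_mat n R $$ (i, j) = of_bool (i = j) - of_bool ((i, j) \<in> R)"
  by (simp add: euler_mat_def)

lemma euler_mat_cong: 
  "(\<And>i j. i < n \<Longrightarrow> j < n \<Longrightarrow> (i, j) \<in> R \<longleftrightarrow> (i, j) \<in> R') \<Longrightarrow> euler_mat n R = euler_mat n R'"
  by (intro eq_matI) auto

lemma index_mult_sum:
  "A \<in> carrier_mat m k \<Longrightarrow> B \<in> carrier_mat k n \<Longrightarrow> i < m \<Longrightarrow> j < n \<Longrightarrow>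
    (A * B) $$ (i, j) = (\<Sum>l<k. A $$ (i, l) * B $$ (l, j))"
  by (simp add: scalar_prod_def lessThan_atLeast0)

lemma index_triple_product:
  fixes A B :: "int mat"
  assumes A: "A \<in> carrier_mat n n" and B: "B \<in> carrier_mat n n" and i: "i < n" and j: "j < n"
  shows "(B\<^sup>T * A * B) $$ (i, j) = (\<Sum>k<n. \<Sum>l<n. B $$ (k, i) * A $$ (k, l) * B $$ (l, j))"
proof -
  have "(B\<^sup>T * A * B) $$ (i, j) = (\<Sum>l<n. (\<Sum>k<n. B $$ (k, i) * A $$ (k, l)) * B $$ (l, j))"
    using A B i j by (simp add: index_mult_sum[of _ n n _ n] del: index_mult_mat(1) assoc_mult_mat)
  also have "\<dots> = (\<Sum>l<n. \<Sum>k<n. B $$ (k, i) * A $$ (k, l) * B $$ (l, j))"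
    by (simp add: sum_distrib_right)
  also have "\<dots> = (\<Sum>k<n. \<Sum>l<n. B $$ (k, i) * A $$ (k, l) * B $$ (l, j))" by (rule sum.swap)
  finally show ?thesis .
qed

lemma euler_mat_relabel:
  assumes f: "bij_betw f {..<n} {..<n}"
  shows "congruent_mat n (euler_mat n R) (euler_mat n {(i, j). (f i, f j) \<in> R})"
proof -
  define P :: "int mat" where "P = mat n n (\<lambda>(i, j). of_bool (i = f j))"
  have P: "P \<in> carrier_mat n n" by (simp add: P_def)
  have fin: "f i < n" if "i < n" for i using f that by (auto dest: bij_betwE)
  have inj: "f i = f j \<longleftrightarrow> i = j" if "i < n" "j < n" for i j
    using f that by (auto simp: bij_betw_def inj_on_def)
  have "P\<^sup>T * P = 1\<^sub>m n"
  proof (intro eq_matI)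
    fix i j assume ij: "i < dim_row (1\<^sub>m n)" "j < dim_col (1\<^sub>m n)"
    then have "(P\<^sup>T * P) $$ (i, j) = (\<Sum>l<n. P $$ (l, i) * P $$ (l, j))"
      using P by (simp add: index_mult_sum[of _ n n _ n] del: index_mult_mat(1))
    also have "\<dots> = (\<Sum>l<n. if l = f i then of_bool (f i = f j) else 0)"
      using ij by (intro sum.cong) (auto simp: P_def)
    also have "\<dots> = of_bool (i = j)" using ij fin inj by simp
    finally show "(P\<^sup>T * P) $$ (i, j) = 1\<^sub>m n $$ (i, j)" using ij by simp
  qed (use P in auto)
  moreover have "P * P\<^sup>T = 1\<^sub>m n"
    using P by (intro int_mat_left_inverse_imp_right[OF _ _ calculation]) auto
  moreover have "euler_mat n {(i, j). (f i, f j) \<in> R} = P\<^sup>T * euler_mat n R * P"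
  proof (intro eq_matI)
    fix i j assume "i < dim_row (P\<^sup>T * euler_mat n R * P)" "j < dim_col (P\<^sup>T * euler_mat n R * P)"
    then have ij: "i < n" "j < n" using P by auto
    have "(P\<^sup>T * euler_mat n R * P) $$ (i, j) =
        (\<Sum>k<n. if k = f i then \<Sum>l<n. if l = f j then euler_mat n R $$ (f i, f j) else 0 else 0)"
      unfolding index_triple_product[OF euler_mat_carrier P ij]
      using ij by (intro sum.cong refl) (auto simp: P_def intro!: sum.cong)
    also have "\<dots> = euler_mat n R $$ (f i, f j)" using fin ij by simp
    finally show "euler_mat n {(i, j). (f i, f j) \<in> R} $$ (i, j) = (P\<^sup>T * euler_mat n R * P) $$ (i, j)"
      using ij fin inj by simp
  qed (use P in auto)
  ultimately show ?thesis unfolding congruent_mat_def using P by (metis transpose_carrier_mat)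
qed

text \<open>
  The congruence is the reflection at the sink: it adds \<open>u i\<close> times the basis vector of \<open>k\<close> to the
  basis vector of \<open>i\<close>.
\<close>

lemma euler_mat_flip_sink:
  assumes k: "k < n" and sink: "\<And>j. (k, j) \<notin> R"
  shows "congruent_mat n (euler_mat n R)
    (euler_mat n ({(i, j). (i, j) \<in> R \<and> j \<noteq> k} \<union> {(k, i) | i. (i, k) \<in> R}))"
    (is "congruent_mat n ?E (euler_mat n ?R')")
proof -
  \<comment> \<open>\<open>- u i\<close> is the pairing of the unit vectors of \<open>i\<close> and
    \<open>k\<close> under \<open>?E + ?E\<^sup>T\<close>: 2 for \<open>i = k\<close>, and -1 for an
    arrow from \<open>i\<close> to \<open>k\<close>. The value -2 of \<open>u k\<close> sends the
    unit vector of \<open>k\<close> to its negative and makes \<open>B\<close> an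
    involution.\<close>
  define u :: "nat \<Rightarrow> int" where "u i = of_bool ((i, k) \<in> R) - 2 * of_bool (i = k)" for i
  define B :: "int mat" where "B = mat n n (\<lambda>(l, i). of_bool (l = i) + of_bool (l = k) * u i)"
  have B: "B \<in> carrier_mat n n" by (simp add: B_def)
  have uk: "u k = - 2" using sink by (simp add: u_def)
  have Bs: "(\<Sum>l<n. g l * B $$ (l, j)) = g j + g k * u j" if "j < n" for g :: "nat \<Rightarrow> int" and j
  proof -
    have "(\<Sum>l<n. g l * B $$ (l, j)) =
      (\<Sum>l<n. (if l = j then g j else 0) + (if l = k then g k * u j else 0))"
      using that by (intro sum.cong) (auto simp: B_def algebra_simps)
    then show ?thesis using that k by (simp add: sum.distrib)
  qed
  have "B * B = 1\<^sub>m n"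
  proof (intro eq_matI)
    fix i j assume ij: "i < dim_row (1\<^sub>m n)" "j < dim_col (1\<^sub>m n)"
    then show "(B * B) $$ (i, j) = 1\<^sub>m n $$ (i, j)"
      using Bs[of j "\<lambda>l. B $$ (i, l)"] B k by (auto simp: index_mult_sum[of _ n n _ n] B_def uk simp del: index_mult_mat(1))
  qed (use B in auto)
  moreover have "euler_mat n ?R' = B\<^sup>T * ?E * B"
  proof (intro eq_matI)
    fix i j assume "i < dim_row (B\<^sup>T * ?E * B)" "j < dim_col (B\<^sup>T * ?E * B)"
    then have ij: "i < n" "j < n" using B by auto
    let ?e = "\<lambda>i j. of_bool (i = j) - of_bool ((i, j) \<in> R) :: int"
    have "(B\<^sup>T * ?E * B) $$ (i, j) = (\<Sum>k<n. \<Sum>l<n. B $$ (k, i) * ?e k l * B $$ (l, j))"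
      unfolding index_triple_product[OF euler_mat_carrier B ij] by (intro sum.cong refl) simp
    also have "\<dots> = (\<Sum>m<n. B $$ (m, i) * (?e m j + ?e m k * u j))"
      by (intro sum.cong refl, subst Bs[OF ij(2)]) (simp only: distrib_left mult.assoc)
    also have "\<dots> = (\<Sum>m<n. (?e m j + ?e m k * u j) * B $$ (m, i))" 
      by (simp add: mult.commute)
    also have "\<dots> = (?e i j + ?e i k * u j) + (?e k j + ?e k k * u j) * u i"
      by (rule Bs[OF ij(1)])
    also have "\<dots> = of_bool (i = j) - of_bool ((i, j) \<in> ?R')"
      using sink unfolding u_def by auto
    finally show "euler_mat n ?R' $$ (i, j) = (B\<^sup>T * ?E * B) $$ (i, j)"
      using ij by simp
  qed (use B in auto)
  ultimately show ?thesis unfolding congruent_mat_def using B by blast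
qed

section \<open>Quivers given by words\<close>

text \<open>
  Letter \<open>i\<close> orients the edge between the vertices \<open>i\<close> and \<open>Suc i mod m\<close>, \<open>True\<close> meaning away from \<open>i\<close>.
  Words of length \<open>m\<close> give cycles, words of length \<open>m - 1\<close> give paths on the vertices \<open>0, \<dots>, m - 1\<close>.
\<close>

definition word_quiver :: "nat \<Rightarrow> bool list \<Rightarrow> nat rel" where
  "word_quiver m w = {(x, y). (x < length w \<and> y = Suc x mod m \<and> w ! x) \<or>
     (y < length w \<and> x = Suc y mod m \<and> \<not> w ! y)}"

abbreviation word_mat :: "nat \<Rightarrow> bool list \<Rightarrow> int mat" where
  "word_mat m w \<equiv> euler_mat m (word_quiver m w)"

lemma Suc_mod_eq_Suc: "x < m \<Longrightarrow> Suc x mod m = Suc k \<longleftrightarrow> x = k \<and> Suc k < m"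
  by (cases "Suc x = m") auto

text \<open>\<open>True\<close> followed by \<open>False\<close> sends both edges at the vertex
  between these letters into it. Reversing the arrows at this sink interchanges the two
  letters.\<close>

lemma word_mat_swap_sink:
  assumes len: "length (us @ True # False # vs) \<le> m"
  shows "congruent_mat m (word_mat m (us @ True # False # vs)) (word_mat m (us @ False # True # vs))"
proof -
  define w w' where "w = us @ True # False # vs" and "w' = us @ False # True # vs"
  define l where "l = length us"
  have km: "Suc l < m" using len by (simp add: l_def)
  have lw: "length w' = length w" "length w \<le> m" "Suc l < length w" using len by (auto simp: w_def w'_def l_def)
  have w: "w ! l" "\<not> w ! Suc l" by (auto simp: w_def l_def nth_append)
  have w': "w' ! x = (if x = l then False else if x = Suc l then True else w ! x)" for x
    by (auto simp: w_def w'_def l_def nth_append nth_Cons split: nat.splits)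
  have eqk: "Suc x mod m = Suc l \<longleftrightarrow> x = l" "Suc l = Suc x mod m \<longleftrightarrow> x = l" if "x < length w" for x
    using Suc_mod_eq_Suc[of x m l] km lw that by auto
  have sink: "(Suc l, y) \<notin> word_quiver m w" for y
    using w eqk by (auto simp: word_quiver_def)
  have "word_quiver m w' = {(i, j). (i, j) \<in> word_quiver m w \<and> j \<noteq> Suc l} \<union>
      {(Suc l, i) | i. (i, Suc l) \<in> word_quiver m w}" (is "_ = ?R")
  proof -
    have "(x, y) \<in> word_quiver m w' \<longleftrightarrow> (x, y) \<in> ?R" for x y
      using w eqk[of x] eqk[of y] eqk[of l] lw unfolding word_quiver_def w'
      by (auto simp: mod_less[OF km])
    then show ?thesis by auto
  qed
  then show ?thesis using euler_mat_flip_sink[OF km sink] by (simp add: w_def w'_def)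
qed

lemma word_mat_swap:
  assumes "length (us @ a # b # vs) \<le> m"
  shows "congruent_mat m (word_mat m (us @ a # b # vs)) (word_mat m (us @ b # a # vs))"
  using assms word_mat_swap_sink[of us vs m]
    congruent_mat_sym[OF _ word_mat_swap_sink[of us vs m]] congruent_mat_refl[OF euler_mat_carrier]
  by (cases a; cases b) auto

lemma word_mat_move:
  assumes "length (us @ xs @ y # vs) \<le> m"
  shows "congruent_mat m (word_mat m (us @ xs @ y # vs)) (word_mat m (us @ y # xs @ vs))"
  using assms
proof (induction xs arbitrary: us)
  case Nil
  then show ?case by (simp add: congruent_mat_refl)
next
  case (Cons x xs)
  have "congruent_mat m (word_mat m ((us @ [x]) @ xs @ y # vs)) (word_mat m ((us @ [x]) @ y # xs @ vs))"
    using Cons.prems by (intro Cons.IH) simp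
  moreover have "congruent_mat m (word_mat m (us @ x # y # xs @ vs)) (word_mat m (us @ y # x # xs @ vs))"
    using Cons.prems by (intro word_mat_swap) simp
  ultimately show ?case using congruent_mat_trans[OF euler_mat_carrier] by fastforce
qed

text \<open>Adjacent transpositions generate all permutations, so only the number of letters of each
  kind matters. The prefix \<open>us\<close> serves the induction: each letter moved to the front is
  absorbed into it.\<close>

lemma word_mat_mset:
  assumes "mset xs = mset ys" "length (us @ xs) \<le> m"
  shows "congruent_mat m (word_mat m (us @ xs)) (word_mat m (us @ ys))"
  using assms
proof (induction ys arbitrary: us xs)
  case Nil
  then show ?case by (simp add: congruent_mat_refl)
next
  case (Cons y ys)
  then have "y \<in> set xs" by (metis list.set_intros(1) set_mset_mset)
  then obtain as bs where xs: "xs = as @ y # bs" by (metis split_list)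
  have "congruent_mat m (word_mat m (us @ as @ y # bs)) (word_mat m (us @ y # as @ bs))"
    using Cons.prems xs by (intro word_mat_move) simp
  moreover have "congruent_mat m (word_mat m ((us @ [y]) @ as @ bs)) (word_mat m ((us @ [y]) @ ys))"
    using Cons.prems xs by (intro Cons.IH) auto
  ultimately show ?case using congruent_mat_trans[OF euler_mat_carrier] xs by fastforce
qed

text \<open>\<open>m\<close> exceeds the length of the word by one, so the quiver is a path and its
  last vertex carries a single edge. When that edge points to it, the vertex is a sink whose
  reversal changes one letter only, a move that cycles do not offer.\<close>

lemma word_mat_flip_last:
  assumes m: "m = length us + 2"
  shows "congruent_mat m (word_mat m (us @ [True])) (word_mat m (us @ [False]))"
proof -
  define w w' where "w = us @ [True]" and "w' = us @ [False]"
  define l where "l = length us"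
  have km: "Suc l < m" using m by (simp add: l_def)
  have lw: "length w' = Suc l" "length w = Suc l" by (auto simp: w_def w'_def l_def)
  have w: "w ! l" by (auto simp: w_def l_def nth_append)
  have w': "w' ! x = (if x = l then False else w ! x)" if "x < Suc l" for x
    using that by (auto simp: w_def w'_def l_def nth_append nth_Cons split: nat.splits)
  have md: "Suc x mod m = Suc x" if "x < Suc l" for x using that m by (simp add: l_def)
  have sink: "(Suc l, y) \<notin> word_quiver m w" for y
    using w md by (auto simp: word_quiver_def lw)
  have "word_quiver m w' = {(i, j). (i, j) \<in> word_quiver m w \<and> j \<noteq> Suc l} \<union>
      {(Suc l, i) | i. (i, Suc l) \<in> word_quiver m w}" (is "_ = ?R")
  proof -
    have "(x, y) \<in> word_quiver m w' \<longleftrightarrow> (x, y) \<in> ?R" for x y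
      using w w' unfolding word_quiver_def lw by (auto simp: md less_Suc_eq)
    then show ?thesis by auto
  qed
  then show ?thesis using euler_mat_flip_sink[OF km sink] by (simp add: w_def w'_def)
qed

text \<open>Each \<open>False\<close> is moved to the end and flipped there; a path thus forgets
  even the number of arrows in each direction.\<close>

lemma word_mat_path:
  assumes "m = Suc (length w)"
  shows "congruent_mat m (word_mat m w) (word_mat m (replicate (length w) True))"
  using assms
proof (induction "length (filter Not w)" arbitrary: w)
  case 0
  then have "w = replicate (length w) True"
    by (metis filter_empty_conv length_0_conv replicate_eqI)
  then show ?case using congruent_mat_refl[OF euler_mat_carrier] by metis
next
  case (Suc c)
  then have "False \<in> set w" by (metis (full_types) filter_False list.size(3) nat.distinct(1))
  then obtain us vs where w: "w = us @ False # vs" by (metis split_list)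
  let ?w = "us @ vs @ [True]"
  have 1: "congruent_mat m (word_mat m ([] @ w)) (word_mat m ([] @ (us @ vs @ [False])))"
    using Suc.prems by (intro word_mat_mset) (auto simp: w)
  have 2: "congruent_mat m (word_mat m (us @ vs @ [False])) (word_mat m ?w)"
    using congruent_mat_sym[OF euler_mat_carrier word_mat_flip_last[of m "us @ vs"]] Suc.prems
    by (simp add: w)
  have "congruent_mat m (word_mat m ?w) (word_mat m (replicate (length ?w) True))"
    using Suc.hyps(2) Suc.prems by (intro Suc.hyps(1)) (auto simp: w)
  from congruent_mat_trans[OF euler_mat_carrier 1[unfolded append_Nil] congruent_mat_trans[OF euler_mat_carrier 2 this]]
  show ?case by (simp add: w)
qed

text \<open>Reads the cycle backwards from vertex 0, by \<open>i\<close> to \<open>-i\<close> modulo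
  \<open>n\<close>: the edges come in reverse order, each seen from its other end.\<close>

lemma word_mat_reverse:
  assumes n: "n = length w"
  shows "congruent_mat n (word_mat n w) (word_mat n (rev (map Not w)))"
proof -
  define f where "f i = (n - i) mod n" for i
  have f: "f i = (if i = 0 then 0 else n - i)" if "i < n" for i using that by (auto simp: f_def)
  have "bij_betw f {..<n} {..<n}"
    by (rule bij_betwI[of f _ _ f]) (auto simp: f split: if_splits)
  from euler_mat_relabel[OF this]
  have "congruent_mat n (word_mat n w) (euler_mat n {(i, j). (f i, f j) \<in> word_quiver n w})" .
  moreover have "(f i, f j) \<in> word_quiver n w \<longleftrightarrow> (i, j) \<in> word_quiver n (rev (map Not w))"
    if ij: "i < n" "j < n" for i j
  proof -
    have sm: "Suc x mod n = (if Suc x = n then 0 else Suc x)" if "x < n" for x using that by auto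
    have key: "f j = Suc (f i) mod n \<longleftrightarrow> i = Suc j mod n" if "i < n" "j < n" for i j
    proof -
      have "f i < n" using that by (auto simp: f)
      then show ?thesis using that by (auto simp: sm f)
    qed
    have key2: "f i = n - Suc j" if "i < n" "j < n" "i = Suc j mod n" for i j
      using that by (auto simp: sm f split: if_splits)
    have nth: "rev (map Not w) ! k \<longleftrightarrow> \<not> w ! (n - Suc k)" if "k < n" for k
      using that n by (simp add: rev_nth)
    have "f i < n" "f j < n" using ij by (auto simp: f)
    then have "(f i, f j) \<in> word_quiver n w \<longleftrightarrow>
        f j = Suc (f i) mod n \<and> w ! f i \<or> f i = Suc (f j) mod n \<and> \<not> w ! f j"
      by (simp add: word_quiver_def n[symmetric])
    also have "\<dots> \<longleftrightarrow> i = Suc j mod n \<and> w ! (n - Suc j) \<or> j = Suc i mod n \<and> \<not> w ! (n - Suc i)"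
      unfolding key[OF ij] key[OF ij(2,1)] using key2[OF ij] key2[OF ij(2,1)] by metis
    also have "\<dots> \<longleftrightarrow> (i, j) \<in> word_quiver n (rev (map Not w))"
      using ij nth[OF ij(1)] nth[OF ij(2)] by (auto simp: word_quiver_def n[symmetric])
    finally show ?thesis .
  qed
  ultimately show ?thesis
    using euler_mat_cong[of n "{(i, j). (f i, f j) \<in> word_quiver n w}"] by auto
qed

text \<open>
  Passes from the elements \<open>1, \<dots>, n\<close> of a poset to the matrix indices \<open>0, \<dots>, n - 1\<close>.
\<close>

definition shift_rel :: "nat rel \<Rightarrow> nat rel" where
  "shift_rel R = {(i, j). (Suc i, Suc j) \<in> R}"

lemma euler_mat_listing:
  assumes xs: "distinct xs" "set xs = {1..n}" "length xs = n" and L: "L \<le> n"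
    and asym: "\<And>x y. (x, y) \<in> R \<Longrightarrow> (y, x) \<notin> R"
    and steps: "R \<union> R\<inverse> = P \<union> P\<inverse>" "P = {(xs ! i, xs ! (Suc i mod n)) | i. i < L}"
    and w: "w = map (\<lambda>i. (xs ! i, xs ! (Suc i mod n)) \<in> R) [0..<L]"
  shows "congruent_mat n (euler_mat n (shift_rel R)) (word_mat n w)"
proof -
  define f where "f i = xs ! i - 1" for i
  have mem: "xs ! i \<in> {1..n}" if "i < n" for i using xs that nth_mem by blast
  then have Suc_f: "Suc (f i) = xs ! i" if "i < n" for i using that by (force simp: f_def)
  have inj: "xs ! i = xs ! j \<longleftrightarrow> i = j" if "i < n" "j < n" for i j
    using xs that by (simp add: nth_eq_iff_index_eq)
  have "inj_on f {..<n}"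
    using inj Suc_f by (metis inj_onI lessThan_iff)
  moreover have "f ` {..<n} \<subseteq> {..<n}" using mem by (force simp: f_def)
  ultimately have "bij_betw f {..<n} {..<n}"
    by (simp add: bij_betw_def endo_inj_surj)
  from euler_mat_relabel[OF this]
  have "congruent_mat n (euler_mat n (shift_rel R)) (euler_mat n {(i, j). (f i, f j) \<in> shift_rel R})" .
  moreover have "(f i, f j) \<in> shift_rel R \<longleftrightarrow> (i, j) \<in> word_quiver n w"
    if ij: "i < n" "j < n" for i j
  proof -
    have n: "0 < n" using ij by simp
    have P: "(xs ! i, xs ! j) \<in> P \<longleftrightarrow> i < L \<and> j = Suc i mod n" if "i < n" "j < n" for i j
    proof -
      have "Suc k mod n < n" for k using n by simp
      then show ?thesis unfolding steps(2) using inj that L by fastforce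
    qed
    have "(xs ! i, xs ! j) \<in> R \<union> R\<inverse> \<longleftrightarrow> (xs ! i, xs ! j) \<in> P \<or> (xs ! j, xs ! i) \<in> P"
      using steps by blast
    then have "(xs ! i, xs ! j) \<in> R \<or> (xs ! j, xs ! i) \<in> R \<longleftrightarrow>
       i < L \<and> j = Suc i mod n \<or> j < L \<and> i = Suc j mod n"
      using P[OF ij] P[OF ij(2,1)] by auto
    then have "(xs ! i, xs ! j) \<in> R \<longleftrightarrow> 
      (i < L \<and> j = Suc i mod n \<and> (xs ! i, xs ! j) \<in> R) \<or> (j < L \<and> i = Suc j mod n \<and> (xs ! j, xs ! i) \<notin> R)"
      using asym by blast
    then show ?thesis using ij by (auto simp: shift_rel_def Suc_f word_quiver_def w)
  qed
  ultimately show ?thesis using euler_mat_cong[of n "{(i, j). (f i, f j) \<in> shift_rel R}"] by auto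
qed

lemma mset_bool_list: "mset w = replicate_mset (length (filter id w)) True + replicate_mset (length (filter Not w)) False"
  by (induction w) auto

text \<open>For \<open>p\<close> and \<open>q\<close> at least 2 this orients the cycle on
  \<open>p + q\<close> vertices with the single source 0 and the single sink \<open>p\<close>,
  joined by paths of \<open>p\<close> and \<open>q\<close> arrows; the inverse of its matrix
  therefore has the entry 2 at \<open>(0, p)\<close>.\<close>

definition cycle_word :: "nat \<Rightarrow> nat \<Rightarrow> bool list" where
  "cycle_word p q = replicate p True @ replicate q False"

lemma word_mat_cycle_word_commute:
  "congruent_mat (p + q) (word_mat (p + q) (cycle_word p q)) (word_mat (p + q) (cycle_word q p))"
  using word_mat_reverse[of "p + q" "cycle_word p q"] by (simp add: cycle_word_def)

lemma euler_mat_cycle: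
  assumes xs: "distinct xs" "set xs = {1..n}" "length xs = n"
    and asym: "\<And>x y. (x, y) \<in> R \<Longrightarrow> (y, x) \<notin> R"
    and steps: "R \<union> R\<inverse> = cyclic_steps xs \<union> (cyclic_steps xs)\<inverse>"
    and p: "p = card (cyclic_steps xs \<inter> R)" and q: "q = card (cyclic_steps xs \<inter> R\<inverse>)"
  shows "congruent_mat n (euler_mat n (shift_rel R)) (word_mat n (cycle_word p q))" "p + q = n"
proof -
  define w where "w = map (\<lambda>i. (xs ! i, xs ! (Suc i mod n)) \<in> R) [0..<n]"
  define g where "g i = (xs ! i, xs ! (Suc i mod n))" for i
  have cs: "cyclic_steps xs = g ` {..<n}" by (auto simp: cyclic_steps_def xs g_def)
  have inj: "inj_on g {..<n}" using xs by (auto simp: inj_on_def g_def nth_eq_iff_index_eq)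
  have cs_Int: "cyclic_steps xs \<inter> Q = g ` {i. i < n \<and> g i \<in> Q}" for Q unfolding cs by auto
  then have p': "p = card {i. i < n \<and> g i \<in> R}" unfolding p cs_Int
    using inj by (simp add: card_image inj_on_def)
  have "cyclic_steps xs \<inter> R\<inverse> = g ` {i. i < n \<and> g i \<notin> R}"
  proof -
    have "g i \<in> R\<inverse> \<longleftrightarrow> g i \<notin> R" if "i < n" for i
      using steps cs that asym by (metis Un_iff converse_iff image_eqI lessThan_iff surj_pair)
    then show ?thesis unfolding cs_Int by (metis (lifting))
  qed
  then have q': "q = card {i. i < n \<and> g i \<notin> R}" unfolding q
    using inj by (simp add: card_image inj_on_def)
  have fp: "length (filter id w) = p" and fq: "length (filter Not w) = q"
    unfolding length_filter_conv_card p' q'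
    by (auto simp: w_def g_def intro!: arg_cong[of _ _ card])
  have "length w = n" by (simp add: w_def)
  then show "p + q = n" using fp fq sum_length_filter_compl[of id w] by (simp add: comp_def)
  have "mset w = mset (cycle_word p q)"
    by (simp add: mset_bool_list[of w] fp fq cycle_word_def)
  then have "congruent_mat n (word_mat n ([] @ w)) (word_mat n ([] @ cycle_word p q))"
    using \<open>length w = n\<close> by (intro word_mat_mset) auto
  moreover have "congruent_mat n (euler_mat n (shift_rel R)) (word_mat n w)"
    by (rule euler_mat_listing[OF xs _ asym steps _ w_def]) (auto simp: cyclic_steps_def xs)
  ultimately show "congruent_mat n (euler_mat n (shift_rel R)) (word_mat n (cycle_word p q))"
    using congruent_mat_trans[OF euler_mat_carrier] by fastforce
qed

section \<open>Coxeter matrices and factorizations of the Gram matrix\<close>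

lemma mat_inv_eq:
  fixes A B :: "int mat"
  assumes A: "A \<in> carrier_mat n n" and B: "B \<in> carrier_mat n n" and AB: "A * B = 1\<^sub>m n"
  shows "mat_inv A = B"
  unfolding mat_inv_def
proof (rule the_equality)
  show "B \<in> carrier_mat (dim_row A) (dim_row A) \<and> inverts_mat A B \<and> inverts_mat B A"
    using A B AB int_mat_left_inverse_imp_right[OF A B AB] by (simp add: inverts_mat_def)
next
  fix D assume "D \<in> carrier_mat (dim_row A) (dim_row A) \<and> inverts_mat A D \<and> inverts_mat D A"
  then have D: "D \<in> carrier_mat n n" "D * A = 1\<^sub>m n" using A by (auto simp: inverts_mat_def)
  have "D = D * (A * B)" using D AB by simp
  also have "\<dots> = (D * A) * B" using A B D(1) by (simp add: assoc_mult_mat[of _ n n _ n _ n])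
  also have "\<dots> = B" using B D by simp
  finally show "D = B" .
qed

text \<open>Sylvester's determinant identity. Multiplication by \<open>?Y\<close> clears the block
  \<open>B\<close> of \<open>?X\<close>, multiplication by \<open>?Z\<close> clears the block
  \<open>- A\<close>; the two block triangular products evaluate \<open>det ?X\<close> in two
  ways.\<close>

lemma det_scalar_add_mult_commute:
  fixes A B :: "'a::idom mat"
  assumes A: "A \<in> carrier_mat n k" and B: "B \<in> carrier_mat k n"
  shows "y ^ k * det (y \<cdot>\<^sub>m 1\<^sub>m n + A * B) = y ^ n * det (y \<cdot>\<^sub>m 1\<^sub>m k + B * A)"
proof -
  let ?X = "four_block_mat (y \<cdot>\<^sub>m 1\<^sub>m n) (- A) B (1\<^sub>m k)"
  let ?Y = "four_block_mat (1\<^sub>m n) (0\<^sub>m n k) (- B) (1\<^sub>m k)"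
  let ?Z = "four_block_mat (1\<^sub>m n) A (0\<^sub>m k n) (y \<cdot>\<^sub>m 1\<^sub>m k)"
  have X: "?X \<in> carrier_mat (n + k) (n + k)" using A B by auto
  have Y: "?Y \<in> carrier_mat (n + k) (n + k)" using A B by auto
  have Z: "?Z \<in> carrier_mat (n + k) (n + k)" using A B by auto
  have "?X * ?Y = four_block_mat (y \<cdot>\<^sub>m 1\<^sub>m n + A * B) (- A) (0\<^sub>m k n) (1\<^sub>m k)"
    using A B by (subst mult_four_block_mat[of _ n n _ k _ k])
      (auto intro!: cong_four_block_mat)
  then have "det ?X * det ?Y = det (y \<cdot>\<^sub>m 1\<^sub>m n + A * B)"
    using A B det_mult[OF X Y, symmetric]
    by (simp add: det_four_block_mat_lower_left_zero[of _ n _ k])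
  moreover have "det ?Y = 1" using B by (simp add: det_four_block_mat_upper_right_zero[of _ n _ k])
  moreover have "?X * ?Z = four_block_mat (y \<cdot>\<^sub>m 1\<^sub>m n) (0\<^sub>m n k) B (y \<cdot>\<^sub>m 1\<^sub>m k + B * A)"
    using A B by (subst mult_four_block_mat[of _ n n _ k _ k])
      (auto intro!: cong_four_block_mat)
  then have "det ?X * det ?Z = y ^ n * det (y \<cdot>\<^sub>m 1\<^sub>m k + B * A)"
    using A B det_mult[OF X Z, symmetric]
    by (simp add: det_four_block_mat_upper_right_zero[of _ n _ k] det_smult)
  moreover have "det ?Z = y ^ k" using A by (simp add: det_four_block_mat_lower_left_zero[of _ n _ k] det_smult)
  ultimately show ?thesis by (simp add: mult.commute)
qed

text \<open>Sylvester's identity over the polynomial ring at \<open>y = t - 1\<close>, since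
  \<open>t - (1 - A B)\<close> is \<open>(t - 1) + A B\<close>.\<close>

lemma char_poly_one_minus_mult_commute:
  fixes A B :: "int mat"
  assumes A: "A \<in> carrier_mat n k" and B: "B \<in> carrier_mat k n"
  shows "[:-1, 1:] ^ k * char_poly (1\<^sub>m n - A * B) = [:-1, 1:] ^ n * char_poly (1\<^sub>m k - B * A)"
proof -
  let ?f = "map_mat (\<lambda>a. [:a:]) :: int mat \<Rightarrow> int poly mat"
  have "char_poly_matrix (1\<^sub>m n - A * B) = [:-1, 1:] \<cdot>\<^sub>m 1\<^sub>m n + ?f A * ?f B"
    if A: "A \<in> carrier_mat n k" and B: "B \<in> carrier_mat k n" for A B :: "int mat" and n k
  proof -
    have s: "(\<Sum>i\<in>I. [:g i:]) = [:\<Sum>i\<in>I. g i:]" for I and g :: "nat \<Rightarrow> int"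
      by (induction I rule: infinite_finite_induct) auto
    have "?f A * ?f B = ?f (A * B)"
      using A B by (intro eq_matI) (auto simp: scalar_prod_def s mult.commute)
    then show ?thesis using A B
      by (intro eq_matI) (auto simp: char_poly_matrix_def one_pCons)
  qed
  from this[OF A B] this[OF B A] show ?thesis unfolding char_poly_def
    using det_scalar_add_mult_commute[of "?f A" n k "?f B" "[:-1, 1:]"] A B by simp
qed

lemma int_scalar_prod_self_eq_0:
  fixes v :: "int vec" assumes "v \<in> carrier_vec n"
  shows "v \<bullet> v = 0 \<longleftrightarrow> v = 0\<^sub>v n"
proof
  assume "v \<bullet> v = 0"
  then have "(\<Sum>i\<in>{0..<n}. v $ i * v $ i) = 0" using assms by (simp add: scalar_prod_def)
  then have "\<forall>i\<in>{0..<n}. v $ i * v $ i = 0" by (subst (asm) sum_nonneg_eq_0_iff) auto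
  then show "v = 0\<^sub>v n" using assms by auto
qed (use assms in simp)

definition cox_mat :: "int mat \<Rightarrow> int mat" where
  "cox_mat C = - (C * mat_inv (C\<^sup>T))"

text \<open>The rows of \<open>M\<close> are the vectors realizing the basis, its columns are the
  ambient coordinates. The Coxeter matrix is \<open>1 - M * (E * M)\<^sup>T\<close>, and
  \<open>lap\<close> says that interchanging the two factors turns it into \<open>\<Lambda>\<close>;
  this links the two matrices both in their action and in their spectrum.\<close>

locale gram_factorization =
  fixes n k :: nat and C E M \<Lambda> :: "int mat"
  assumes C: "C \<in> carrier_mat n n" and E: "E \<in> carrier_mat n n" and EC: "E * C = 1\<^sub>m n"
    and M: "M \<in> carrier_mat n k" and \<Lambda>: "\<Lambda> \<in> carrier_mat k k"
    and gram: "C + C\<^sup>T = M * M\<^sup>T" and lap: "(E * M)\<^sup>T * M = 1\<^sub>m k - \<Lambda>"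
begin

text \<open>Multiply \<open>gram\<close> by \<open>E\<^sup>T\<close> from the right:
  \<open>C\<^sup>T * E\<^sup>T\<close> is the identity and \<open>C * E\<^sup>T\<close> is the
  negative of the Coxeter matrix.\<close>

lemma cox_mat_eq: "cox_mat C = 1\<^sub>m n - M * (E * M)\<^sup>T"
proof -
  have inv: "C\<^sup>T * E\<^sup>T = 1\<^sub>m n" using transpose_inverse[OF E C EC] .
  have mi: "mat_inv (C\<^sup>T) = E\<^sup>T" using C E by (intro mat_inv_eq[OF _ _ inv]) auto
  have "C * E\<^sup>T + C\<^sup>T * E\<^sup>T = (C + C\<^sup>T) * E\<^sup>T"
    using C E by (subst add_mult_distrib_mat[of _ n n _ _ n]) auto
  also have "\<dots> = M * (E * M)\<^sup>T"
    using M E unfolding gram transpose_mult[OF E M] by (simp add: assoc_mult_mat[of _ n k _ n _ n])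
  finally have "C * E\<^sup>T + 1\<^sub>m n = M * (E * M)\<^sup>T" unfolding inv .
  then have "1\<^sub>m n - M * (E * M)\<^sup>T = 1\<^sub>m n - (C * E\<^sup>T + 1\<^sub>m n)" by simp
  also have "\<dots> = - (C * E\<^sup>T)" using C E by (intro eq_matI) auto
  finally show ?thesis by (simp add: cox_mat_def mi)
qed

lemma cox_mat_carrier: "cox_mat C \<in> carrier_mat n n"
  unfolding cox_mat_eq using M E by (auto simp: minus_carrier_mat)

lemma cox_mat_mult: "cox_mat C * M = M * \<Lambda>"
proof -
  have N: "(E * M)\<^sup>T \<in> carrier_mat k n" using E M by auto
  have "cox_mat C * M = M - M * (E * M)\<^sup>T * M"
    unfolding cox_mat_eq using M N by (subst minus_mult_distrib_mat[of _ n n _ _ k]) auto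
  also have "M * (E * M)\<^sup>T * M = M * (1\<^sub>m k - \<Lambda>)"
    using M N lap by (simp add: assoc_mult_mat[of _ n k _ n _ k])
  also have "\<dots> = M - M * \<Lambda>" using M \<Lambda> by (subst mult_minus_distrib_mat[of _ n k _ k]) auto
  also have "M - (M - M * \<Lambda>) = M * \<Lambda>" using M \<Lambda> by (intro eq_matI) auto
  finally show ?thesis .
qed

lemma cox_mat_pow_mult: "cox_mat C ^\<^sub>m c * M = M * \<Lambda> ^\<^sub>m c"
proof (induction c)
  case 0
  then show ?case using M \<Lambda> cox_mat_carrier by simp
next
  case (Suc c)
  have p: "cox_mat C ^\<^sub>m c \<in> carrier_mat n n" "\<Lambda> ^\<^sub>m c \<in> carrier_mat k k"
    using cox_mat_carrier \<Lambda> by auto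
  have "cox_mat C ^\<^sub>m Suc c * M = cox_mat C ^\<^sub>m c * (cox_mat C * M)"
    using p M cox_mat_carrier by (simp add: assoc_mult_mat[of _ n n _ n _ k])
  also have "\<dots> = cox_mat C ^\<^sub>m c * M * \<Lambda>"
    using p M \<Lambda> by (simp add: cox_mat_mult assoc_mult_mat[of _ n n _ k _ k])
  also have "\<dots> = M * \<Lambda> ^\<^sub>m Suc c"
    using p M \<Lambda> by (simp add: Suc assoc_mult_mat[of _ n k _ k _ k])
  finally show ?case .
qed

lemma char_poly_cox_mat:
  "[:-1, 1:] ^ k * char_poly (cox_mat C) = [:-1, 1:] ^ n * char_poly \<Lambda>"
proof -
  have N: "(E * M)\<^sup>T \<in> carrier_mat k n" using E M by auto
  have "1\<^sub>m k - (E * M)\<^sup>T * M = \<Lambda>" unfolding lap using \<Lambda> by (intro eq_matI) auto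
  then show ?thesis
    using char_poly_one_minus_mult_commute[OF M N] by (simp add: cox_mat_eq)
qed

text \<open>Twice the form is the squared length of \<open>M\<^sup>T *\<^sub>v v\<close>, a sum of
  integer squares.\<close>

lemma kernel_iff:
  assumes v: "v \<in> carrier_vec n"
  shows "v \<bullet> (C *\<^sub>v v) = 0 \<longleftrightarrow> M\<^sup>T *\<^sub>v v = 0\<^sub>v k"
proof -
  have MT: "M\<^sup>T *\<^sub>v v \<in> carrier_vec k" using M v by auto
  have "v \<bullet> (C\<^sup>T *\<^sub>v v) = (C\<^sup>T *\<^sub>v v) \<bullet> v" using C v by (intro comm_scalar_prod[of _ n]) auto
  also have "\<dots> = v \<bullet> (C *\<^sub>v v)" using transpose_vec_mult_scalar[OF C v v] .
  finally have "2 * (v \<bullet> (C *\<^sub>v v)) = v \<bullet> (C *\<^sub>v v) + v \<bullet> (C\<^sup>T *\<^sub>v v)" by simp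
  also have "\<dots> = v \<bullet> (C *\<^sub>v v + C\<^sup>T *\<^sub>v v)"
    using C v by (intro scalar_prod_add_distrib[symmetric, of _ n]) auto
  also have "C *\<^sub>v v + C\<^sup>T *\<^sub>v v = (C + C\<^sup>T) *\<^sub>v v"
    using C v by (intro add_mult_distrib_mat_vec[symmetric, of _ n n]) auto
  also have "\<dots> = M *\<^sub>v (M\<^sup>T *\<^sub>v v)"
    unfolding gram using M v by (intro assoc_mult_mat_vec[of _ n k _ n]) auto
  also have "v \<bullet> \<dots> = (M *\<^sub>v (M\<^sup>T *\<^sub>v v)) \<bullet> v" using M v MT by (intro comm_scalar_prod[of _ n]) auto
  also have "\<dots> = (M\<^sup>T *\<^sub>v v) \<bullet> (M\<^sup>T *\<^sub>v v)"
    using transpose_vec_mult_scalar[of "M\<^sup>T" k n v "M\<^sup>T *\<^sub>v v"] M v MT by simp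
  finally have "2 * (v \<bullet> (C *\<^sub>v v)) = (M\<^sup>T *\<^sub>v v) \<bullet> (M\<^sup>T *\<^sub>v v)" .
  then show ?thesis using int_scalar_prod_self_eq_0[OF MT] by linarith
qed

lemma rows_kernel_iff:
  assumes X: "X \<in> carrier_mat n n"
  shows "(\<forall>i<n. M\<^sup>T *\<^sub>v row X i = 0\<^sub>v k) \<longleftrightarrow> X * M = 0\<^sub>m n k"
proof -
  have e: "(M\<^sup>T *\<^sub>v row X i) $ j = (X * M) $$ (i, j)" if "i < n" "j < k" for i j
    using that X M by (simp add: comm_scalar_prod[of _ n])
  have "(\<forall>i<n. M\<^sup>T *\<^sub>v row X i = 0\<^sub>v k) \<longleftrightarrow> (\<forall>i<n. \<forall>j<k. (M\<^sup>T *\<^sub>v row X i) $ j = 0)"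
    using X M by (auto simp del: index_mult_mat_vec intro!: eq_vecI)
  also have "\<dots> \<longleftrightarrow> (\<forall>i<n. \<forall>j<k. (X * M) $$ (i, j) = 0)" using e by simp
  also have "\<dots> \<longleftrightarrow> X * M = 0\<^sub>m n k"
    using X M by (auto simp del: index_mult_mat(1) intro!: eq_matI)
  finally show ?thesis .
qed

text \<open>By \<open>kernel_iff\<close> the rows of a matrix \<open>X\<close> lie in the kernel iff
  \<open>X * M = 0\<close>, and \<open>M\<close> carries powers of the Coxeter matrix over to powers
  of \<open>\<Lambda>\<close>. This decides the reduced Coxeter number.\<close>

lemma cox_mat_pow_rows_kernel_iff:
  "(\<forall>i<n. row (cox_mat C ^\<^sub>m c - 1\<^sub>m n) i \<bullet> (C *\<^sub>v row (cox_mat C ^\<^sub>m c - 1\<^sub>m n) i) = 0) \<longleftrightarrow>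
    M * \<Lambda> ^\<^sub>m c = M"
proof -
  let ?X = "cox_mat C ^\<^sub>m c - 1\<^sub>m n"
  have X: "?X \<in> carrier_mat n n" by (auto simp: minus_carrier_mat)
  have P: "cox_mat C ^\<^sub>m c \<in> carrier_mat n n" using cox_mat_carrier by auto
  have "(\<forall>i<n. row ?X i \<bullet> (C *\<^sub>v row ?X i) = 0) \<longleftrightarrow> ?X * M = 0\<^sub>m n k"
    unfolding rows_kernel_iff[OF X, symmetric] using X
    by (intro all_cong kernel_iff) auto
  also have "?X * M = M * \<Lambda> ^\<^sub>m c - M"
    unfolding cox_mat_pow_mult[symmetric]
    using P M by (subst minus_mult_distrib_mat[of _ n n _ _ k]) auto
  also have "\<dots> = 0\<^sub>m n k \<longleftrightarrow> M * \<Lambda> ^\<^sub>m c = M"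
  proof
    assume *: "M * \<Lambda> ^\<^sub>m c - M = 0\<^sub>m n k"
    have D: "M * \<Lambda> ^\<^sub>m c \<in> carrier_mat n k" using M \<Lambda> by auto
    have "M * \<Lambda> ^\<^sub>m c = (M * \<Lambda> ^\<^sub>m c - M) + M" 
      using D M by (intro eq_matI) (auto simp del: index_mult_mat(1))
    then show "M * \<Lambda> ^\<^sub>m c = M" unfolding * using M by simp
  qed (use M in auto)
  finally show ?thesis .
qed

text \<open>Under the change of basis \<open>M\<close> becomes \<open>B\<^sup>T * M\<close> and
  \<open>E * M\<close> becomes \<open>B' * (E * M)\<close>; in the product in \<open>lap\<close> the
  matrices \<open>B\<close> and \<open>B'\<close> cancel, so \<open>\<Lambda>\<close> stays the
  same.\<close>

lemma congruent:
  assumes B: "B \<in> carrier_mat n n" and B': "B' \<in> carrier_mat n n"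
    and i: "B * B' = 1\<^sub>m n" "B' * B = 1\<^sub>m n"
  shows "gram_factorization n k (B\<^sup>T * C * B) (B' * E * B'\<^sup>T) (B\<^sup>T * M) \<Lambda>"
proof
  note as = assoc_mult_mat[of _ n n _ n _ n]
  have t1: "B\<^sup>T * B'\<^sup>T = 1\<^sub>m n" using transpose_inverse[OF B' B i(2)] .
  have t2: "B'\<^sup>T * B\<^sup>T = 1\<^sub>m n" using transpose_inverse[OF B B' i(1)] .
  show "B\<^sup>T * C * B \<in> carrier_mat n n" "B' * E * B'\<^sup>T \<in> carrier_mat n n" 
    "B\<^sup>T * M \<in> carrier_mat n k" "\<Lambda> \<in> carrier_mat k k" using B B' C E M \<Lambda> by auto
  have "B' * E * B'\<^sup>T * (B\<^sup>T * C * B) = B' * (E * ((B'\<^sup>T * B\<^sup>T) * (C * B)))"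
    using B B' C E by (simp add: as)
  also have "\<dots> = B' * (E * (C * B))" using B C by (simp add: t2)
  also have "\<dots> = B' * ((E * C) * B)" using B C E by (simp add: as)
  also have "\<dots> = 1\<^sub>m n" using B i by (simp add: EC)
  finally show "B' * E * B'\<^sup>T * (B\<^sup>T * C * B) = 1\<^sub>m n" .
  have "(B\<^sup>T * C * B)\<^sup>T = B\<^sup>T * C\<^sup>T * B"
    using B C by (simp add: transpose_mult[of _ n n _ n] as)
  then have "B\<^sup>T * C * B + (B\<^sup>T * C * B)\<^sup>T = B\<^sup>T * (C + C\<^sup>T) * B"
    using B C by (simp add: mult_add_distrib_mat[of _ n n _ n] add_mult_distrib_mat[of _ n n _ _ n])
  also have "\<dots> = B\<^sup>T * M * (B\<^sup>T * M)\<^sup>T"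
    unfolding gram using B M
    by (simp add: transpose_mult[of _ n n _ k] assoc_mult_mat[of _ n n _ n _ n]
        assoc_mult_mat[of _ n n _ k _ n] assoc_mult_mat[of _ n k _ n _ n])
  finally show "B\<^sup>T * C * B + (B\<^sup>T * C * B)\<^sup>T = B\<^sup>T * M * (B\<^sup>T * M)\<^sup>T" .
  have "B' * E * B'\<^sup>T * (B\<^sup>T * M) = B' * (E * ((B'\<^sup>T * B\<^sup>T) * M))"
    using B B' E M by (simp add: assoc_mult_mat[of _ n n _ n _ k] as)
  then have N: "B' * E * B'\<^sup>T * (B\<^sup>T * M) = B' * (E * M)" using M by (simp add: t2)
  have EM: "E * M \<in> carrier_mat n k" using E M by auto
  have "(B' * (E * M))\<^sup>T * (B\<^sup>T * M) = (E * M)\<^sup>T * ((B'\<^sup>T * B\<^sup>T) * M)"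
    unfolding transpose_mult[OF B' EM] using B B' EM M
    by (simp add: assoc_mult_mat[of _ k n _ n _ k] assoc_mult_mat[of _ n n _ n _ k])
  then show "(B' * E * B'\<^sup>T * (B\<^sup>T * M))\<^sup>T * (B\<^sup>T * M) = 1\<^sub>m k - \<Lambda>"
    unfolding N using M by (simp add: t2 lap)
qed

lemma similar_cox_mat:
  assumes B: "B \<in> carrier_mat n n" and B': "B' \<in> carrier_mat n n"
    and i: "B * B' = 1\<^sub>m n" "B' * B = 1\<^sub>m n"
  shows "similar_mat_wit (cox_mat (B\<^sup>T * C * B)) (cox_mat C) (B\<^sup>T) (B'\<^sup>T)"
proof -
  interpret c: gram_factorization n k "B\<^sup>T * C * B" "B' * E * B'\<^sup>T" "B\<^sup>T * M" \<Lambda>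
    using congruent[OF assms] .
  note as = assoc_mult_mat[of _ n n _ n _ n]
  have t1: "B\<^sup>T * B'\<^sup>T = 1\<^sub>m n" using transpose_inverse[OF B' B i(2)] .
  have t2: "B'\<^sup>T * B\<^sup>T = 1\<^sub>m n" using transpose_inverse[OF B B' i(1)] .
  have EM: "E * M \<in> carrier_mat n k" using E M by auto
  have "B' * E * B'\<^sup>T * (B\<^sup>T * M) = B' * (E * ((B'\<^sup>T * B\<^sup>T) * M))"
    using B B' E M by (simp add: assoc_mult_mat[of _ n n _ n _ k] as)
  then have N: "B' * E * B'\<^sup>T * (B\<^sup>T * M) = B' * (E * M)" using M by (simp add: t2)
  have "B\<^sup>T * cox_mat C * B'\<^sup>T = B\<^sup>T * (1\<^sub>m n - M * (E * M)\<^sup>T) * B'\<^sup>T" by (simp add: cox_mat_eq)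
  also have "\<dots> = (B\<^sup>T - B\<^sup>T * (M * (E * M)\<^sup>T)) * B'\<^sup>T"
    using B M EM by (subst mult_minus_distrib_mat[of _ n n _ n]) auto
  also have "\<dots> = 1\<^sub>m n - B\<^sup>T * (M * (E * M)\<^sup>T) * B'\<^sup>T"
    using B B' M EM by (subst minus_mult_distrib_mat[of _ n n _ _ n]) (auto simp: t1)
  also have "B\<^sup>T * (M * (E * M)\<^sup>T) * B'\<^sup>T = B\<^sup>T * M * (B' * (E * M))\<^sup>T"
    unfolding transpose_mult[OF B' EM] using B B' M EM
    by (simp add: as assoc_mult_mat[of _ n k _ n _ n] assoc_mult_mat[of _ n n _ k _ n])
  finally have "cox_mat (B\<^sup>T * C * B) = B\<^sup>T * cox_mat C * B'\<^sup>T" unfolding c.cox_mat_eq N by simp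
  then show ?thesis
    using cox_mat_carrier c.cox_mat_carrier B B' t1 t2 by (intro similar_mat_witI[of _ _ n]) auto
qed

text \<open>A right inverse allows \<open>M\<close> to be cancelled in
  \<open>cox_mat_pow_mult\<close>. Without one, the condition on the right controls the Coxeter
  matrix only modulo the kernel of the form.\<close>

lemma cox_mat_pow_eq_one_iff:
  assumes MM: "M * M' = 1\<^sub>m n" and M': "M' \<in> carrier_mat k n"
  shows "cox_mat C ^\<^sub>m c = 1\<^sub>m n \<longleftrightarrow> M * \<Lambda> ^\<^sub>m c = M"
proof
  assume "cox_mat C ^\<^sub>m c = 1\<^sub>m n"
  then show "M * \<Lambda> ^\<^sub>m c = M" using cox_mat_pow_mult[of c] M by simp
next
  assume *: "M * \<Lambda> ^\<^sub>m c = M"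
  have P: "cox_mat C ^\<^sub>m c \<in> carrier_mat n n" using cox_mat_carrier by auto
  have "cox_mat C ^\<^sub>m c = cox_mat C ^\<^sub>m c * (M * M')" unfolding MM using right_mult_one_mat[OF P] by simp
  also have "\<dots> = cox_mat C ^\<^sub>m c * M * M'" using P M M' by (simp add: assoc_mult_mat[of _ n n _ k _ n])
  also have "\<dots> = 1\<^sub>m n" by (simp add: cox_mat_pow_mult * MM)
  finally show "cox_mat C ^\<^sub>m c = 1\<^sub>m n" .
qed

text \<open>A Jordan block for the eigenvalue 1: the Coxeter matrix fixes
  \<open>?u = M *\<^sub>v y\<close> and sends \<open>l\<close> to \<open>l - ?u\<close>, so its
  \<open>c\<close>-th power subtracts \<open>c\<close> times \<open>?u\<close> from
  \<open>l\<close>.\<close>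

lemma cox_mat_pow_ne_one:
  assumes l: "l \<in> carrier_vec n" and y: "y \<in> carrier_vec k" and ly: "(E * M)\<^sup>T *\<^sub>v l = y"
    and fixed: "\<Lambda> *\<^sub>v y = y" and My: "M *\<^sub>v y \<noteq> 0\<^sub>v n" and c: "1 \<le> c"
  shows "cox_mat C ^\<^sub>m c \<noteq> 1\<^sub>m n"
proof
  assume one: "cox_mat C ^\<^sub>m c = 1\<^sub>m n"
  let ?X = "cox_mat C" and ?u = "M *\<^sub>v y"
  have u: "?u \<in> carrier_vec n" using M y by auto
  have N: "(E * M)\<^sup>T \<in> carrier_mat k n" using E M by auto
  have Xl: "?X *\<^sub>v l = l - ?u"
    unfolding cox_mat_eq using M N l ly
    by (subst minus_mult_distrib_mat_vec[of _ n n]) (auto simp: assoc_mult_mat_vec[of _ n k _ n])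
  have "?X *\<^sub>v ?u = (?X * M) *\<^sub>v y" using cox_mat_carrier M y by (simp add: assoc_mult_mat_vec[of _ n n _ k])
  also have "\<dots> = M *\<^sub>v (\<Lambda> *\<^sub>v y)" unfolding cox_mat_mult using M \<Lambda> y by (simp add: assoc_mult_mat_vec[of _ n k _ k])
  finally have Xu: "?X *\<^sub>v ?u = ?u" by (simp add: fixed)
  have "?X ^\<^sub>m c *\<^sub>v l = l - of_nat c \<cdot>\<^sub>v ?u"
  proof (induction c)
    case 0
    show ?case using l u cox_mat_carrier M by (auto intro!: eq_vecI)
  next
    case (Suc c)
    have P: "?X ^\<^sub>m c \<in> carrier_mat n n" using cox_mat_carrier by auto
    have fix': "?X ^\<^sub>m d *\<^sub>v ?u = ?u" for d
    proof (induction d)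
      case 0
      show ?case using u cox_mat_carrier by simp
    next
      case (Suc d)
      have "?X ^\<^sub>m d \<in> carrier_mat n n" using cox_mat_carrier by auto
      then show ?case using Suc u cox_mat_carrier by (simp add: assoc_mult_mat_vec[of _ n n _ n] Xu)
    qed
    have "?X ^\<^sub>m Suc c *\<^sub>v l = ?X ^\<^sub>m c *\<^sub>v (l - ?u)"
      using P l cox_mat_carrier by (simp add: assoc_mult_mat_vec[of _ n n _ n] Xl)
    also have "\<dots> = (l - of_nat c \<cdot>\<^sub>v ?u) - ?u"
      using P l u by (subst mult_minus_distrib_mat_vec[of _ n n]) (simp_all only: Suc fix')
    also have "\<dots> = l - of_nat (Suc c) \<cdot>\<^sub>v ?u"
      using l u M by (auto intro!: eq_vecI simp: algebra_simps simp del: index_mult_mat_vec)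
    finally show ?case .
  qed
  then have e: "l = l - of_nat c \<cdot>\<^sub>v ?u" using one l by simp
  have "?u $ i = 0" if "i < n" for i
  proof -
    have "l $ i = (l - of_nat c \<cdot>\<^sub>v ?u) $ i" using e by simp
    also have "\<dots> = l $ i - of_nat c * ?u $ i" 
      using that l u carrier_vecD[OF u] by (simp del: index_mult_mat_vec dim_mult_mat_vec)
    finally show ?thesis using c by simp
  qed
  then have "?u = 0\<^sub>v n" using u M by (auto intro!: eq_vecI simp del: index_mult_mat_vec)
  then show False using My by simp
qed

end

text \<open>The Gram identity is checked on the sparse side: \<open>E + E\<^sup>T\<close> multiplied
  by \<open>C\<close> from the left and by \<open>C\<^sup>T\<close> from the right is
  \<open>C + C\<^sup>T\<close>, so no entry of \<open>C\<close> has to be computed.\<close>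

lemma gram_factorization_of_euler:
  assumes C: "C \<in> carrier_mat n n" and E: "E \<in> carrier_mat n n" and EC: "E * C = 1\<^sub>m n"
    and M: "M \<in> carrier_mat n k" and L: "L \<in> carrier_mat k k"
    and N: "E * M = N" and NN: "N * N\<^sup>T = E + E\<^sup>T" and lap: "N\<^sup>T * M = 1\<^sub>m k - L"
  shows "gram_factorization n k C E M L"
proof
  have CE: "C * E = 1\<^sub>m n" using int_mat_left_inverse_imp_right[OF E C EC] .
  have ET: "E\<^sup>T * C\<^sup>T = 1\<^sub>m n" using transpose_inverse[OF C E CE] .
  have Nc: "N \<in> carrier_mat n k" using N E M by auto
  have CN: "C * N = M" using C E M by (simp add: N[symmetric] assoc_mult_mat[of _ n n _ n _ k, symmetric] CE)
  have "M * M\<^sup>T = C * N * (N\<^sup>T * C\<^sup>T)" using CN transpose_mult[OF C Nc] by simp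
  also have "\<dots> = C * ((N * N\<^sup>T) * C\<^sup>T)" using C Nc
    by (simp add: assoc_mult_mat[of _ n n _ k _ n] assoc_mult_mat[of _ n k _ n _ n])
  also have "\<dots> = C * (E * C\<^sup>T + 1\<^sub>m n)" unfolding NN
    using C E by (simp add: add_mult_distrib_mat[of _ n n _ _ n] ET)
  also have "\<dots> = (C * E) * C\<^sup>T + C"
    using C E by (simp add: mult_add_distrib_mat[of _ n n _ n] assoc_mult_mat[of _ n n _ n _ n])
  also have "\<dots> = C + C\<^sup>T" using C by (simp add: CE comm_add_mat[of _ n n])
  finally show "C + C\<^sup>T = M * M\<^sup>T" by simp
qed (use assms in auto)

section \<open>Differences of unit vectors, permutation matrices and the characteristic polynomial
  of a cycle\<close>

definition diff_mat :: "nat \<Rightarrow> nat \<Rightarrow> (nat \<Rightarrow> nat) \<Rightarrow> (nat \<Rightarrow> nat) \<Rightarrow> int mat" where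
  "diff_mat n k f g = mat n k (\<lambda>(i, j). of_bool (j = f i) - of_bool (j = g i))"

lemma diff_mat_carrier [simp]: "diff_mat n k f g \<in> carrier_mat n k"
  by (simp add: diff_mat_def)

lemma diff_mat_dim [simp]: "dim_row (diff_mat n k f g) = n" "dim_col (diff_mat n k f g) = k"
  by (simp_all add: diff_mat_def)

lemma diff_mat_index [simp]: "i < n \<Longrightarrow> j < k \<Longrightarrow>
    diff_mat n k f g $$ (i, j) = of_bool (j = f i) - of_bool (j = g i)"
  by (simp add: diff_mat_def)

lemma diff_mat_mult_transpose:
  assumes "\<And>i. i < n \<Longrightarrow> f i < k" "\<And>i. i < n \<Longrightarrow> g i < k" and ij: "i < n" "j < n"
  shows "(diff_mat n k f g * (diff_mat n k f g)\<^sup>T) $$ (i, j) =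
    of_bool (f i = f j) - of_bool (f i = g j) - of_bool (g i = f j) + of_bool (g i = g j)"
proof -
  have "(diff_mat n k f g * (diff_mat n k f g)\<^sup>T) $$ (i, j) =
    (\<Sum>l<k. (of_bool (l = f i) - of_bool (l = g i)) * (of_bool (l = f j) - of_bool (l = g j)))"
    using ij by (simp add: index_mult_sum[of _ n k _ n] del: index_mult_mat(1))
  also have "\<dots> = (\<Sum>l<k. (if l = f i then of_bool (f i = f j) - of_bool (f i = g j) else 0)
      - (if l = g i then of_bool (g i = f j) - of_bool (g i = g j) else 0))"
    by (intro sum.cong) auto
  also have "\<dots> = (of_bool (f i = f j) - of_bool (f i = g j)) - (of_bool (g i = f j) - of_bool (g i = g j))"
    using assms by (simp add: sum_subtractf)
  finally show ?thesis by simp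
qed

definition perm_mat :: "nat \<Rightarrow> (nat \<Rightarrow> nat) \<Rightarrow> int mat" where
  "perm_mat m \<tau> = mat m m (\<lambda>(i, j). of_bool (i = \<tau> j))"

lemma perm_mat_carrier [simp]: "perm_mat m \<tau> \<in> carrier_mat m m"
  by (simp add: perm_mat_def)

lemma perm_mat_dim [simp]: "dim_row (perm_mat m \<tau>) = m" "dim_col (perm_mat m \<tau>) = m"
  by (simp_all add: perm_mat_def)

lemma perm_mat_index [simp]: "i < m \<Longrightarrow> j < m \<Longrightarrow> perm_mat m \<tau> $$ (i, j) = of_bool (i = \<tau> j)"
  by (simp add: perm_mat_def)

lemma mult_perm_mat_index:
  assumes X: "X \<in> carrier_mat n m" and t: "\<tau> j < m" and ij: "i < n" "j < m"
  shows "(X * perm_mat m \<tau>) $$ (i, j) = X $$ (i, \<tau> j)"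
proof -
  have "(X * perm_mat m \<tau>) $$ (i, j) = (\<Sum>l<m. X $$ (i, l) * of_bool (l = \<tau> j))"
    using X ij by (simp add: index_mult_sum[of _ n m _ m] del: index_mult_mat(1))
  also have "\<dots> = (\<Sum>l<m. if l = \<tau> j then X $$ (i, l) else 0)" by (intro sum.cong) auto
  finally show ?thesis using t by simp
qed

lemma perm_mat_pow:
  assumes t: "\<And>j. j < m \<Longrightarrow> \<tau> j < m"
  shows "perm_mat m \<tau> ^\<^sub>m c = perm_mat m (\<tau> ^^ c)"
proof (induction c)
  case 0
  show ?case by (intro eq_matI) (auto)
next
  case (Suc c)
  show ?case
    unfolding pow_mat.simps Suc
    by (intro eq_matI) (simp_all add: mult_perm_mat_index[of _ m] t funpow_Suc_right del: funpow.simps index_mult_mat(1))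
qed

lemma perm_mat_pow_fixes_iff:
  assumes t: "\<And>j. j < k \<Longrightarrow> \<tau> j < k" and M: "M \<in> carrier_mat n k"
  shows "M * perm_mat k \<tau> ^\<^sub>m c = M \<longleftrightarrow> (\<forall>i<n. \<forall>j<k. M $$ (i, (\<tau> ^^ c) j) = M $$ (i, j))"
proof -
  have tc: "(\<tau> ^^ c) j < k" if "j < k" for j using that t by (induction c) auto
  have "M * perm_mat k (\<tau> ^^ c) = M \<longleftrightarrow>
      (\<forall>i<n. \<forall>j<k. (M * perm_mat k (\<tau> ^^ c)) $$ (i, j) = M $$ (i, j))"
    using M by (auto simp del: index_mult_mat(1) intro!: eq_matI)
  then show ?thesis using M tc perm_mat_pow[of k \<tau> c, OF t]
    by (simp add: mult_perm_mat_index[OF M] del: index_mult_mat(1))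
qed

text \<open>Works on the transpose. The first column of \<open>U\<close> is
  \<open>(1, t, ..., t^(m-1))\<close>, which the characteristic matrix sends to zero except for
  \<open>t^m - 1\<close> in the last row. The minor left by expanding there is triangular with
  diagonal -1, and its sign cancels that of the cofactor.\<close>

lemma char_poly_cyclic_perm_mat:
  assumes m: "0 < m"
  shows "char_poly (perm_mat m (\<lambda>j. Suc j mod m)) = monom 1 m - 1"
proof -
  let ?P = "perm_mat m (\<lambda>j. Suc j mod m)"
  let ?t = "[:0, 1:] :: int poly"
  define X where "X = char_poly_matrix (?P\<^sup>T)"
  have X: "X \<in> carrier_mat m m" by (simp add: X_def)
  have Xi: "X $$ (i, j) = of_bool (i = j) * ?t - of_bool (j = Suc i mod m)" if "i < m" "j < m" for i j
    using that by (auto simp: X_def char_poly_matrix_def one_pCons)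
  define U where "U = mat m m (\<lambda>(i, j). if j = 0 then ?t ^ i else of_bool (i = j))"
  have U: "U \<in> carrier_mat m m" by (simp add: U_def)
  have dU: "det U = 1"
  proof -
    have "det U = prod_list (diag_mat U)"
      by (rule det_lower_triangular[OF _ U]) (auto simp: U_def)
    also have "diag_mat U = replicate m 1"
      by (intro nth_equalityI) (auto simp: diag_mat_def U_def)
    finally show ?thesis by simp
  qed
  have sX: "(\<Sum>l<m. X $$ (i, l) * g l) = ?t * g i - g (Suc i mod m)" if "i < m" for i and g :: "nat \<Rightarrow> int poly"
  proof -
    have "(\<Sum>l<m. X $$ (i, l) * g l) =
        (\<Sum>l<m. (if l = i then ?t * g i else 0) - (if l = Suc i mod m then g (Suc i mod m) else 0))"
      using that by (intro sum.cong) (auto simp: Xi left_diff_distrib)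
    then show ?thesis using that m by (simp add: sum_subtractf)
  qed
  have XU: "(X * U) $$ (i, j) = (if j = 0 then (if Suc i = m then ?t ^ m - 1 else 0) else X $$ (i, j))"
    if ij: "i < m" "j < m" for i j
  proof -
    have "(X * U) $$ (i, j) = (\<Sum>l<m. X $$ (i, l) * U $$ (l, j))"
      using X U ij by (simp add: index_mult_sum[of _ m m _ m] del: index_mult_mat(1))
    also have "\<dots> = ?t * U $$ (i, j) - U $$ (Suc i mod m, j)" by (rule sX[OF ij(1)])
    also have "\<dots> = (if j = 0 then (if Suc i = m then ?t ^ m - 1 else 0) else X $$ (i, j))"
      using ij m by (auto simp: U_def Xi simp flip: power_Suc)
    finally show ?thesis .
  qed
  have XUc: "X * U \<in> carrier_mat m m" using X U by auto
  define D where "D = mat_delete (X * U) (m - 1) 0"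
  have Dc: "D \<in> carrier_mat (m - 1) (m - 1)" using X U by (auto simp: D_def mat_delete_def)
  have Di: "D $$ (i, j) = X $$ (i, Suc j)" if "i < m - 1" "j < m - 1" for i j
  proof -
    have "D $$ (i, j) = (X * U) $$ (i, Suc j)"
      using that X U by (simp add: D_def mat_delete_def del: index_mult_mat(1))
    then show ?thesis using XU that by simp
  qed
  have dD: "det D = (-1) ^ (m - 1)"
  proof -
    have "det D = prod_list (diag_mat D)"
      by (rule det_lower_triangular[OF _ Dc]) (auto simp: Di Xi)
    also have "diag_mat D = replicate (m - 1) (-1)"
      using Dc by (intro nth_equalityI) (auto simp: diag_mat_def Di Xi)
    finally show ?thesis by simp
  qed
  have "det (X * U) = (\<Sum>i<m. (X * U) $$ (i, 0) * cofactor (X * U) i 0)"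
    by (rule laplace_expansion_column[OF XUc m])
  also have "\<dots> = (\<Sum>i<m. if i = m - 1 then (?t ^ m - 1) * cofactor (X * U) (m - 1) 0 else 0)"
    using m by (intro sum.cong) (auto simp: XU simp del: index_mult_mat(1))
  also have "\<dots> = (?t ^ m - 1) * ((-1) ^ (m - 1) * (-1) ^ (m - 1))"
    using m by (simp add: cofactor_def dD[unfolded D_def One_nat_def])
  also have "\<dots> = ?t ^ m - 1" by (simp flip: power_mult_distrib)
  finally have "det X = ?t ^ m - 1" using det_mult[OF X U] dU by simp
  then have "char_poly (?P\<^sup>T) = ?t ^ m - 1" by (simp add: char_poly_def X_def)
  then show ?thesis using char_poly_transpose_mat[of ?P m]
    by (simp add: monom_altdef)
qed

lemma char_poly_block_diag:
  fixes A B :: "int mat"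
  assumes A: "A \<in> carrier_mat p p" and B: "B \<in> carrier_mat q q"
  shows "char_poly (four_block_mat A (0\<^sub>m p q) (0\<^sub>m q p) B) = char_poly A * char_poly B"
proof -
  have "char_poly_matrix (four_block_mat A (0\<^sub>m p q) (0\<^sub>m q p) B) =
    four_block_mat (char_poly_matrix A) (0\<^sub>m p q) (0\<^sub>m q p) (char_poly_matrix B)"
    using A B by (intro eq_matI) (auto simp: char_poly_matrix_def)
  then show ?thesis unfolding char_poly_def
    using A B by (simp add: det_four_block_mat_lower_left_zero[of _ p _ q])
qed

section \<open>The two normal forms\<close>

text \<open>The elements of a chain are pairwise comparable, so their roots e_i - e_n may all share
  the tail \<open>n\<close>. The rows of \<open>?N\<close> are the simple roots e_i - e_(i+1), which
  need \<open>n + 1\<close> coordinates; the Coxeter element permutes these cyclically.\<close>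

lemma chain_factorization:
  assumes n: "0 < n" and C: "C \<in> carrier_mat n n" and EC: "word_mat n (replicate (n - 1) True) * C = 1\<^sub>m n"
  shows "gram_factorization n (Suc n) C (word_mat n (replicate (n - 1) True))
    (diff_mat n (Suc n) (\<lambda>i. i) (\<lambda>_. n)) (perm_mat (Suc n) (\<lambda>j. Suc j mod Suc n))"
proof (rule gram_factorization_of_euler[OF C _ EC])
  let ?E = "word_mat n (replicate (n - 1) True)" and ?M = "diff_mat n (Suc n) (\<lambda>i. i) (\<lambda>_. n)"
  let ?N = "diff_mat n (Suc n) (\<lambda>i. i) Suc"
  have R: "(x, y) \<in> word_quiver n (replicate (n - 1) True) \<longleftrightarrow> y = Suc x" if "x < n" "y < n" for x y
    using that by (auto simp: word_quiver_def)
  have sE: "(\<Sum>l<n. ?E $$ (i, l) * g l) = g i - (if Suc i < n then g (Suc i) else 0)"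
    if "i < n" for i and g :: "nat \<Rightarrow> int"
  proof -
    have "(\<Sum>l<n. ?E $$ (i, l) * g l) =
        (\<Sum>l<n. (if l = i then g i else 0) - (if l = Suc i then g (Suc i) else 0))"
      using that by (intro sum.cong) (auto simp: R[unfolded One_nat_def])
    then show ?thesis using that by (simp add: sum_subtractf)
  qed
  show "?E * ?M = ?N"
  proof (intro eq_matI)
    fix i j assume "i < dim_row ?N" "j < dim_col ?N"
    then have ij: "i < n" "j < Suc n" by auto
    then have "(?E * ?M) $$ (i, j) = (\<Sum>l<n. ?E $$ (i, l) * ?M $$ (l, j))"
      by (simp add: index_mult_sum[of _ n n _ "Suc n"] del: index_mult_mat(1))
    also have "\<dots> = ?N $$ (i, j)" unfolding sE[OF ij(1)] using ij by auto
    finally show "(?E * ?M) $$ (i, j) = ?N $$ (i, j)" .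
  qed auto
  show "?N * ?N\<^sup>T = ?E + ?E\<^sup>T"
  proof (intro eq_matI)
    fix i j assume "i < dim_row (?E + ?E\<^sup>T)" "j < dim_col (?E + ?E\<^sup>T)"
    then have ij: "i < n" "j < n" by auto
    then show "(?N * ?N\<^sup>T) $$ (i, j) = (?E + ?E\<^sup>T) $$ (i, j)"
      by (subst diff_mat_mult_transpose) (auto simp: R[unfolded One_nat_def])
  qed auto
  show "?N\<^sup>T * ?M = 1\<^sub>m (Suc n) - perm_mat (Suc n) (\<lambda>j. Suc j mod Suc n)" (is "_ = ?L")
  proof (intro eq_matI)
    fix i j assume "i < dim_row ?L" "j < dim_col ?L"
    then have ij: "i < Suc n" "j < Suc n" by auto
    have "(?N\<^sup>T * ?M) $$ (i, j) = (\<Sum>l<n. ?N $$ (l, i) * ?M $$ (l, j))"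
      using ij by (simp add: index_mult_sum[of _ "Suc n" n _ "Suc n"] del: index_mult_mat(1))
    also have "\<dots> = (\<Sum>l<n. (if l = i then ?M $$ (i, j) else 0) -
        (if l = i - 1 then (if 0 < i then ?M $$ (i - 1, j) else 0) else 0))"
      using ij by (intro sum.cong) auto
    also have "\<dots> = (if i < n then ?M $$ (i, j) else 0) - (if 0 < i then ?M $$ (i - 1, j) else 0)"
      using ij n by (auto simp: sum_subtractf)
    also have "\<dots> = ?L $$ (i, j)" using ij by (cases "j = n") (auto simp: diff_mat_def)
    finally show "(?N\<^sup>T * ?M) $$ (i, j) = ?L $$ (i, j)" .
  qed auto
qed auto

lemma funpow_Suc_mod:
  assumes "x < m" shows "((\<lambda>j. Suc j mod m) ^^ c) x = (x + c) mod m"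
  by (induction c) (use assms in \<open>auto simp: mod_Suc_eq\<close>)

lemma chain_perm_fixes_iff:
  assumes n: "0 < n"
  shows "diff_mat n (Suc n) (\<lambda>i. i) (\<lambda>_. n) * perm_mat (Suc n) (\<lambda>j. Suc j mod Suc n) ^\<^sub>m c =
    diff_mat n (Suc n) (\<lambda>i. i) (\<lambda>_. n) \<longleftrightarrow> Suc n dvd c" (is "?M * ?L ^\<^sub>m c = ?M \<longleftrightarrow> _")
proof -
  have eq: "?M * ?L ^\<^sub>m c = ?M \<longleftrightarrow>
      (\<forall>i<n. \<forall>j<Suc n. ?M $$ (i, (j + c) mod Suc n) = ?M $$ (i, j))"
    by (subst perm_mat_pow_fixes_iff[of "Suc n" _ _ n]) (auto simp: funpow_Suc_mod simp del: diff_mat_index)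
  show ?thesis
  proof
    assume "?M * ?L ^\<^sub>m c = ?M"
    then have "?M $$ (0, (0 + c) mod Suc n) = ?M $$ (0, 0)" using eq n by blast
    then have "c mod Suc n = 0" using n by (auto simp: of_bool_def split: if_splits)
    then show "Suc n dvd c" by auto
  next
    assume "Suc n dvd c"
    then have "(j + c) mod Suc n = j" if "j < Suc n" for j
      using that by (auto elim!: dvdE simp del: mult_Suc)
    then show "?M * ?L ^\<^sub>m c = ?M" unfolding eq by simp
  qed
qed

text \<open>
  The quiver is \<open>0 \<rightarrow> 1 \<rightarrow> \<dots> \<rightarrow> p \<leftarrow> p + 1 \<leftarrow> \<dots> \<leftarrow> n - 1 \<leftarrow> 0\<close>. Row \<open>i\<close> of \<open>M\<close> is
  \<open>e\<^bsub>f i\<^esub> - e\<^bsub>g i\<^esub>\<close>, and row \<open>i\<close> of \<open>N = E M\<close> is \<open>e\<^bsub>a i\<^esub> - e\<^bsub>b i\<^esub>\<close>, where \<open>a\<close> and \<open>b\<close> are permutations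
  with inverses \<open>a'\<close> and \<open>b'\<close>. The permutation \<open>\<tau>\<close> has the cycles \<open>{0..<p}\<close> and \<open>{p..<n}\<close>.
\<close>

locale canonical_cycle =
  fixes p n :: nat
  assumes p: "2 \<le> p" and q: "p + 2 \<le> n"
begin

abbreviation "q \<equiv> n - p"

definition f where "f i = (if 0 < i \<and> i < p then i else 0)"
definition g where "g i = (if p < i then i else p)"
definition a where "a i = (if i = 0 then n - 1 else if i < p then i else if i = p then 0 else i - 1)"
definition b where "b i = (if Suc i < p then Suc i else if Suc i = p then 0 else i)"
definition a' where "a' j = (if j = 0 then p else if j < p then j else if Suc j = n then 0 else Suc j)"
definition b' where "b' j = (if j = 0 then p - 1 else if j < p then j - 1 else j)"

definition \<tau> where "\<tau> j = (if j < p then Suc j mod p else p + (j - p + (q - 1)) mod q)"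

abbreviation "E \<equiv> word_mat n (cycle_word p q)"
abbreviation "M \<equiv> diff_mat n n f g"
abbreviation "N \<equiv> diff_mat n n a b"

lemma quiver: 
  assumes "x < n" "y < n"
  shows "(x, y) \<in> word_quiver n (cycle_word p q) \<longleftrightarrow>
    (x < p \<and> y = Suc x) \<or> (p < x \<and> Suc y = x) \<or> (x = 0 \<and> Suc y = n)"
proof -
  have "Suc x mod n = Suc x" if "x < p" using that q by simp
  moreover have "Suc y mod n = (if Suc y = n then 0 else Suc y)" using assms by simp
  moreover have "cycle_word p q ! i \<longleftrightarrow> i < p" if "i < n" for i
    using that q by (auto simp: cycle_word_def nth_append)
  moreover have "length (cycle_word p q) = n" by (use q in \<open>simp add: cycle_word_def\<close>)
  ultimately show ?thesis using assms p q unfolding word_quiver_def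
    by (auto split: if_splits)
qed

lemma sum_E:
  fixes h :: "nat \<Rightarrow> int"
  assumes i: "i < n"
  shows "(\<Sum>l<n. E $$ (i, l) * h l) = h i - (if i < p then h (Suc i) else 0)
    - (if p < i then h (i - 1) else 0) - (if i = 0 then h (n - 1) else 0)"
proof -
  have "(\<Sum>l<n. E $$ (i, l) * h l) = (\<Sum>l<n. (if l = i then h i else 0)
      - (if l = Suc i then if i < p then h (Suc i) else 0 else 0)
      - (if l = i - 1 then if p < i then h (i - 1) else 0 else 0)
      - (if l = n - 1 then if i = 0 then h (n - 1) else 0 else 0))"
    using i p q by (intro sum.cong) (auto simp: quiver)
  then show ?thesis using i p q by (auto simp: sum_subtractf)
qed

lemma EM: "E * M = N"
proof (intro eq_matI)
  fix i j assume "i < dim_row N" "j < dim_col N"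
  then have ij: "i < n" "j < n" by auto
  then have "(E * M) $$ (i, j) = (\<Sum>l<n. E $$ (i, l) * M $$ (l, j))"
    by (simp add: index_mult_sum[of _ n n _ n] del: index_mult_mat(1))
  also have "\<dots> = N $$ (i, j)" unfolding sum_E[OF ij(1)]
    using ij p q by (auto simp: f_def g_def a_def b_def)
  finally show "(E * M) $$ (i, j) = N $$ (i, j)" .
qed auto

text \<open>Both sides are twice the identity minus the adjacency matrix of the undirected cycle:
  \<open>a\<close> and \<open>b\<close> are permutations, and \<open>a i = b j\<close> holds exactly
  when \<open>j\<close> precedes \<open>i\<close> cyclically.\<close>

lemma NN: "N * N\<^sup>T = E + E\<^sup>T"
proof (intro eq_matI)
  fix i j assume "i < dim_row (E + E\<^sup>T)" "j < dim_col (E + E\<^sup>T)"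
  then have ij: "i < n" "j < n" by auto
  have ab: "\<And>i. i < n \<Longrightarrow> a i < n" "\<And>i. i < n \<Longrightarrow> b i < n" using p q by (auto simp: a_def b_def)
  have inj: "a i = a j \<longleftrightarrow> i = j" "b i = b j \<longleftrightarrow> i = j"
    using ij p q by (auto simp: a_def b_def split: if_splits)
  have ab_iff: "a i = b j \<longleftrightarrow> Suc j = i \<or> (i = 0 \<and> Suc j = n)" if "i < n" "j < n" for i j
    using that p q by (auto simp: a_def b_def split: if_splits)
  have ba: "b i = a j \<longleftrightarrow> Suc i = j \<or> (j = 0 \<and> Suc i = n)" using ab_iff[OF ij(2,1)] by auto
  have "(N * N\<^sup>T) $$ (i, j) = of_bool (i = j) - of_bool (Suc j = i \<or> (i = 0 \<and> Suc j = n))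
      - of_bool (Suc i = j \<or> (j = 0 \<and> Suc i = n)) + of_bool (i = j)"
    by (simp only: diff_mat_mult_transpose[OF ab ij] inj ab_iff[OF ij] ba)
  also have "\<dots> = (of_bool (i = j) - of_bool ((i < p \<and> j = Suc i) \<or> (p < i \<and> Suc j = i) \<or> (i = 0 \<and> Suc j = n)))
     + (of_bool (j = i) - of_bool ((j < p \<and> i = Suc j) \<or> (p < j \<and> Suc i = j) \<or> (j = 0 \<and> Suc i = n)))"
    using ij p q
    by (cases "Suc j = i"; cases "Suc i = j"; cases "i = 0 \<and> Suc j = n"; cases "j = 0 \<and> Suc i = n") auto
  also have "\<dots> = (E + E\<^sup>T) $$ (i, j)"
    using ij by (simp add: quiver)
  finally show "(N * N\<^sup>T) $$ (i, j) = (E + E\<^sup>T) $$ (i, j)" .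
qed auto

lemma a'_b'_less: "j < n \<Longrightarrow> a' j < n" "j < n \<Longrightarrow> b' j < n"
  using p q by (auto simp: a'_def b'_def)

lemma sum_N:
  fixes h :: "nat \<Rightarrow> int"
  assumes j: "j < n"
  shows "(\<Sum>l<n. N $$ (l, j) * h l) = h (a' j) - h (b' j)"
proof -
  have "j = a l \<longleftrightarrow> l = a' j" if "l < n" for l
    using that j p q by (auto simp: a_def a'_def split: if_splits)
  moreover have "j = b l \<longleftrightarrow> l = b' j" if "l < n" for l
    using that j p q by (auto simp: b_def b'_def split: if_splits)
  ultimately have "(\<Sum>l<n. N $$ (l, j) * h l) =
      (\<Sum>l<n. (if l = a' j then h (a' j) else 0) - (if l = b' j then h (b' j) else 0))"
    using j by (intro sum.cong) (auto simp: left_diff_distrib)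
  then show ?thesis using a'_b'_less[OF j] by (simp add: sum_subtractf)
qed

text \<open>On the second cycle \<open>\<tau>\<close> steps back by one; adding \<open>q - 1\<close>
  modulo \<open>q\<close> expresses this without truncated subtraction.\<close>

lemma \<tau>_eq: "j < n \<Longrightarrow> \<tau> j = (if Suc j < p then Suc j else if Suc j = p then 0 else if j = p then n - 1 else j - 1)"
proof -
  assume j: "j < n"
  consider "Suc j < p" | "Suc j = p" | "j = p" | "p < j" by linarith
  then show ?thesis
  proof cases
    case 4
    have "(j - p + (q - 1)) mod q = ((j - p - 1) + q) mod q" using q 4 by (intro arg_cong2[of _ _ _ _ "(mod)"]) auto
    also have "\<dots> = (j - p - 1) mod q" by simp
    also have "\<dots> = j - p - 1" using 4 j q by (intro mod_less) auto
    finally have "(j - p + (q - 1)) mod q = j - p - 1" .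
    then show ?thesis using 4 by (simp add: \<tau>_def)
  qed (use q in \<open>auto simp: \<tau>_def\<close>)
qed

lemma \<tau>_less: "j < n \<Longrightarrow> \<tau> j < n"
  using p q by (auto simp: \<tau>_eq)

definition \<sigma> where
  "\<sigma> i = (if i = 0 then p - 1 else if i < p then i - 1 else if Suc i = n then p else Suc i)"

lemma \<sigma>_less: "i < n \<Longrightarrow> \<sigma> i < n" "\<sigma> i < p \<longleftrightarrow> i < p"
  using p q by (auto simp: \<sigma>_def)

lemma eq_\<tau>_iff: "i < n \<Longrightarrow> j < n \<Longrightarrow> i = \<tau> j \<longleftrightarrow> j = \<sigma> i"
  using p q by (auto simp: \<tau>_eq \<sigma>_def split: if_splits)

lemma laplacian: "N\<^sup>T * M = 1\<^sub>m n - perm_mat n \<tau>" (is "_ = ?L")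
proof (intro eq_matI)
  fix i j assume "i < dim_row ?L" "j < dim_col ?L"
  then have ij: "i < n" "j < n" by auto
  have "(N\<^sup>T * M) $$ (i, j) = (\<Sum>l<n. N $$ (l, i) * M $$ (l, j))"
    using ij by (simp add: index_mult_sum[of _ n n _ n] del: index_mult_mat(1))
  also have "\<dots> = M $$ (a' i, j) - M $$ (b' i, j)" by (rule sum_N[OF ij(1)])
  also have "\<dots> = ?L $$ (i, j)"
  proof -
    consider "i = 0" | "0 < i" "i < p" | "p \<le> i" "Suc i < n" | "p < i" "Suc i = n" using ij q by linarith
    then show ?thesis
      using ij a'_b'_less[OF ij(1)] p q
      by cases (auto simp: eq_\<tau>_iff \<sigma>_def f_def g_def a'_def b'_def)
  qed
  finally show "(N\<^sup>T * M) $$ (i, j) = ?L $$ (i, j)" .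
qed auto

lemma factorization:
  assumes "C \<in> carrier_mat n n" "E * C = 1\<^sub>m n"
  shows "gram_factorization n n C E M (perm_mat n \<tau>)"
  by (rule gram_factorization_of_euler[OF assms(1) _ assms(2) _ _ EM NN laplacian]) auto

lemma funpow_\<tau>_low: "j < p \<Longrightarrow> (\<tau> ^^ c) j = (j + c) mod p"
  by (induction c) (use p in \<open>auto simp: \<tau>_def mod_Suc_eq\<close>)

lemma funpow_\<tau>_high:
  assumes d: "d < q" shows "(\<tau> ^^ c) (p + d) = p + (d + c * (q - 1)) mod q"
proof (induction c)
  case (Suc c)
  have "(\<tau> ^^ Suc c) (p + d) = p + ((d + c * (q - 1)) mod q + (q - 1)) mod q"
    by (simp only: funpow.simps comp_apply Suc \<tau>_def) simp
  also have "\<dots> = p + (d + c * (q - 1) + (q - 1)) mod q" by (simp only: mod_add_left_eq)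
  also have "d + c * (q - 1) + (q - 1) = d + Suc c * (q - 1)" by (simp only: mult_Suc add_ac)
  finally show ?case .
qed (use d in simp)

lemma perm_fixes_iff: "M * perm_mat n \<tau> ^\<^sub>m c = M \<longleftrightarrow> p dvd c \<and> q dvd c"
proof -
  have eq: "M * perm_mat n \<tau> ^\<^sub>m c = M \<longleftrightarrow> (\<forall>i<n. \<forall>j<n. M $$ (i, (\<tau> ^^ c) j) = M $$ (i, j))"
    using \<tau>_less by (intro perm_mat_pow_fixes_iff) auto
  have tc: "(\<tau> ^^ c) j < n" if "j < n" for j
    using that \<tau>_less by (induction c) auto
  show ?thesis
  proof
    assume "M * perm_mat n \<tau> ^\<^sub>m c = M"
    \<comment> \<open>Row \<open>p\<close> of \<open>M\<close> is the unit vector at 0 minus the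
      unit vector at \<open>p\<close>. A power of \<open>\<tau>\<close> that preserves it fixes 0
      and \<open>p\<close>, one point of each cycle.\<close>
    then have 0: "M $$ (p, (\<tau> ^^ c) j) = M $$ (p, j)" if "j < n" for j using eq that p q by simp
    have "(\<tau> ^^ c) 0 = 0" using 0[of 0] tc[of 0] p q by (auto simp: f_def g_def of_bool_def split: if_splits)
    then have "c mod p = 0" using p by (simp add: funpow_\<tau>_low)
    moreover have "(\<tau> ^^ c) p = p" using 0[of p] tc[of p] p q by (auto simp: f_def g_def of_bool_def split: if_splits)
    then have "(c * (q - 1)) mod q = 0" using q funpow_\<tau>_high[of 0 c] by simp
    then have "q dvd c * (q - 1)" by (simp only: dvd_eq_mod_eq_0)
    then have "q dvd c" using q coprime_diff_one_right_nat[of q] by (simp add: coprime_dvd_mult_left_iff)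
    ultimately show "p dvd c \<and> q dvd c" by auto
  next
    assume *: "p dvd c \<and> q dvd c"
    have "(\<tau> ^^ c) j = j" if j: "j < n" for j
    proof (cases "j < p")
      case True
      then show ?thesis using conjunct1[OF *] by (auto simp: funpow_\<tau>_low elim!: dvdE)
    next
      case False
      then have "j - p < q" using j q by simp
      moreover have "q dvd c * (q - 1)" using * by simp
      ultimately have "(j - p + c * (q - 1)) mod q = j - p" by (metis dvdE mod_less mod_mult_self2)
      then show ?thesis using False funpow_\<tau>_high[of "j - p" c] \<open>j - p < q\<close> by simp
    qed
    then show "M * perm_mat n \<tau> ^\<^sub>m c = M" unfolding eq by simp
  qed
qed

text \<open>The second block is a transposed shift because that cycle runs downwards.\<close>

lemma char_poly_perm: "char_poly (perm_mat n \<tau>) = (monom 1 p - 1) * (monom 1 q - 1)"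
proof -
  let ?P = "perm_mat p (\<lambda>j. Suc j mod p)" and ?Q = "perm_mat q (\<lambda>j. Suc j mod q)"
  have "perm_mat n \<tau> = four_block_mat ?P (0\<^sub>m p q) (0\<^sub>m q p) (?Q\<^sup>T)" (is "_ = ?F")
  proof (intro eq_matI)
    fix i j assume "i < dim_row ?F" "j < dim_col ?F"
    then have ij: "i < n" "j < n" using q by auto
    have "j - p = Suc (i - p) mod q \<longleftrightarrow> (if j = p then Suc i = n else Suc i = j)" if "\<not> i < p" "\<not> j < p"
      using that ij q by (cases "Suc (i - p) = q") auto
    moreover have "Suc j mod p = (if Suc j = p then 0 else Suc j)" if "j < p" using that by simp
    ultimately show "perm_mat n \<tau> $$ (i, j) = ?F $$ (i, j)"
      using ij p q by (auto simp: \<tau>_eq)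
  qed (use q in auto)
  then show ?thesis using char_poly_cyclic_perm_mat[of p] char_poly_cyclic_perm_mat[of q] p q
    by (simp add: char_poly_block_diag char_poly_transpose_mat[of ?Q q])
qed

text \<open>Rows 0 and \<open>p\<close> of \<open>M\<close> coincide, and for \<open>j\<close> other
  than 0 and \<open>p\<close> the column \<open>j\<close> is zero off row \<open>j\<close>. So all
  remaining coordinates of a null vector vanish, and those at 0 and \<open>p\<close> cancel.\<close>

lemma kernel_M:
  assumes v: "v \<in> carrier_vec n"
  shows "M\<^sup>T *\<^sub>v v = 0\<^sub>v n \<longleftrightarrow> (\<exists>c. v = c \<cdot>\<^sub>v vec n (\<lambda>i. of_bool (i = p) - of_bool (i = 0)))"
proof
  have e: "(M\<^sup>T *\<^sub>v v) $ j = (\<Sum>i<n. M $$ (i, j) * v $ i)" if "j < n" for j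
    using that v by (simp add: scalar_prod_def lessThan_atLeast0)
  assume 0: "M\<^sup>T *\<^sub>v v = 0\<^sub>v n"
  have s: "(\<Sum>i<n. M $$ (i, j) * v $ i) = 0" if "j < n" for j using 0 e that by simp
  have z: "v $ j = 0" if j: "j < n" "j \<noteq> 0" "j \<noteq> p" for j
  proof -
    have "(\<Sum>i<n. M $$ (i, j) * v $ i) = (\<Sum>i<n. if i = j then (if j < p then v $ j else - v $ j) else 0)"
      using j p q by (intro sum.cong) (auto simp: f_def g_def)
    then show ?thesis using s[of j] j by (simp split: if_splits)
  qed
  have "(\<Sum>i<n. M $$ (i, 0) * v $ i) = (\<Sum>i<n. (if i = 0 then v $ 0 else 0) + (if i = p then v $ p else 0))"
    using p q z by (intro sum.cong) (auto simp: f_def g_def)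
  then have "v $ 0 + v $ p = 0" using s[of 0] p q by (simp add: sum.distrib)
  then have "v = v $ p \<cdot>\<^sub>v vec n (\<lambda>i. of_bool (i = p) - of_bool (i = 0))"
    using v z p by (intro eq_vecI) auto
  then show "\<exists>c. v = c \<cdot>\<^sub>v vec n (\<lambda>i. of_bool (i = p) - of_bool (i = 0))" by blast
next
  assume "\<exists>c. v = c \<cdot>\<^sub>v vec n (\<lambda>i. of_bool (i = p) - of_bool (i = 0))"
  then obtain c where c: "v = c \<cdot>\<^sub>v vec n (\<lambda>i. of_bool (i = p) - of_bool (i = 0))" by blast
  show "M\<^sup>T *\<^sub>v v = 0\<^sub>v n"
  proof (intro eq_vecI)
    fix j assume "j < dim_vec (0\<^sub>v n :: int vec)"
    then have j: "j < n" by simp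
    have "(M\<^sup>T *\<^sub>v v) $ j = (\<Sum>i<n. M $$ (i, j) * v $ i)"
      using j v by (simp add: scalar_prod_def lessThan_atLeast0)
    also have "\<dots> = (\<Sum>i<n. (if i = p then M $$ (p, j) * c else 0) - (if i = 0 then M $$ (0, j) * c else 0))"
      using p by (intro sum.cong) (auto simp: c)
    also have "\<dots> = 0" using p q j by (simp add: sum_subtractf f_def g_def)
    finally show "(M\<^sup>T *\<^sub>v v) $ j = 0\<^sub>v n $ j" using j by simp
  qed simp
qed

lemma cox_mat_pow_ne_one:
  assumes inv: "C \<in> carrier_mat n n" "E * C = 1\<^sub>m n" and c: "1 \<le> c"
  shows "cox_mat C ^\<^sub>m c \<noteq> 1\<^sub>m n"
proof -
  \<comment> \<open>\<open>h\<close> is affine along both paths from source to sink, which makes its image \<open>y\<close> constant on the cycles of \<open>\<tau>\<close>.\<close>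
  define h :: "nat \<Rightarrow> int" where "h i = (if i \<le> p then int q * (int p - int i) else int p * (int i - int p))" for i
  define l where "l = vec n h"
  \<comment> \<open>The rows of \<open>N\<close> are differences of unit vectors, so the image of
    \<open>l\<close> has coordinate sum 0. For a vector constant on cycles of lengths
    \<open>p\<close> and \<open>q\<close> this forces the proportion of \<open>- q\<close> to
    \<open>p\<close>. As the two constants differ, \<open>M *\<^sub>v y\<close> is not zero.\<close>
  define y where "y = vec n (\<lambda>j. if j < p then - int q else int p)"
  have "(E * M)\<^sup>T *\<^sub>v l = y"
  proof (intro eq_vecI)
    fix j assume "j < dim_vec y"
    then have j: "j < n" by (simp add: y_def)
    have "((E * M)\<^sup>T *\<^sub>v l) $ j = (\<Sum>i<n. N $$ (i, j) * h i)"
      using j by (simp add: EM scalar_prod_def lessThan_atLeast0 l_def)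
    also have "\<dots> = h (a' j) - h (b' j)" by (rule sum_N[OF j])
    also have "\<dots> = y $ j"
      using j p q by (auto simp: h_def a'_def b'_def y_def algebra_simps of_nat_diff)
    finally show "((E * M)\<^sup>T *\<^sub>v l) $ j = y $ j" .
  qed (simp add: y_def EM)
  moreover have "perm_mat n \<tau> *\<^sub>v y = y"
  proof (intro eq_vecI)
    fix i assume "i < dim_vec y"
    then have i: "i < n" by (simp add: y_def)
    have "i = \<tau> j \<longleftrightarrow> j = \<sigma> i" if "j < n" for j using eq_\<tau>_iff i that .
    then have "(perm_mat n \<tau> *\<^sub>v y) $ i = (\<Sum>j<n. if j = \<sigma> i then y $ \<sigma> i else 0)"
      using i by (auto simp: scalar_prod_def lessThan_atLeast0 y_def intro!: sum.cong)
    also have "\<dots> = y $ i" using \<sigma>_less i by (simp add: y_def)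
    finally show "(perm_mat n \<tau> *\<^sub>v y) $ i = y $ i" .
  qed (simp add: y_def)
  moreover have "M *\<^sub>v y \<noteq> 0\<^sub>v n"
  proof
    assume "M *\<^sub>v y = 0\<^sub>v n"
    then have "(M *\<^sub>v y) $ 0 = 0" using p q by simp
    moreover have "(M *\<^sub>v y) $ 0 = (\<Sum>j<n. (if j = 0 then y $ 0 else 0) - (if j = p then y $ p else 0))"
      using p q by (auto simp: scalar_prod_def lessThan_atLeast0 y_def f_def g_def intro!: sum.cong)
    moreover have "\<dots> = - int n" using p q by (simp add: sum_subtractf y_def)
    ultimately show False using p q by simp
  qed
  ultimately show ?thesis using gram_factorization.cox_mat_pow_ne_one[OF factorization[OF inv], of l y c] c
    by (auto simp: l_def y_def)
qed

end

section \<open>Root labellings from the Dynkin type\<close>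

text \<open>One positive and one negative integral coordinate already use up the squared length 2,
  so they are 1 and -1 and all others vanish.\<close>

lemma root_vector:
  fixes x :: "nat \<Rightarrow> int"
  assumes T: "finite T" and sum0: "(\<Sum>t\<in>T. x t) = 0" and norm: "(\<Sum>t\<in>T. x t * x t) = 2"
  shows "\<exists>a\<in>T. \<exists>b\<in>T. a \<noteq> b \<and> (\<forall>t\<in>T. x t = of_bool (t = a) - of_bool (t = b))"
proof -
  have nz: "\<not> (\<forall>t\<in>T. x t = 0)"
  proof
    assume "\<forall>t\<in>T. x t = 0"
    then have "(\<Sum>t\<in>T. x t * x t) = 0" by simp
    then show False using norm by simp
  qed
  have "\<exists>a\<in>T. x a > 0"
  proof (rule ccontr)
    assume "\<not> ?thesis"
    then have "\<forall>t\<in>T. 0 \<le> - x t" by auto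
    moreover have "(\<Sum>t\<in>T. - x t) = 0" using sum0 by (simp add: sum_negf)
    ultimately have "\<forall>t\<in>T. - x t = 0" using sum_nonneg_eq_0_iff[OF T, of "\<lambda>t. - x t"] by simp
    then show False using nz by simp
  qed
  then obtain a where a: "a \<in> T" "x a > 0" by blast
  have "\<exists>b\<in>T. x b < 0"
  proof (rule ccontr)
    assume "\<not> ?thesis"
    then have "\<forall>t\<in>T. 0 \<le> x t" by auto
    then have "\<forall>t\<in>T. x t = 0" using sum_nonneg_eq_0_iff[OF T, of x] sum0 by simp
    then show False using nz by simp
  qed
  then obtain b where b: "b \<in> T" "x b < 0" by blast
  have ab: "a \<noteq> b" using a b by auto
  let ?T = "T - {a, b}"
  have split: "x a * x a + x b * x b + (\<Sum>t\<in>?T. x t * x t) = 2"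
  proof -
    have "T - {a} - {b} = ?T" by blast
    then show ?thesis
      using norm T a b ab sum.remove[of T a "\<lambda>t. x t * x t"] sum.remove[of "T - {a}" b "\<lambda>t. x t * x t"] by simp
  qed
  have sq: "1 \<le> x a * x a" "1 \<le> x b * x b" 
    using mult_pos_pos[OF a(2) a(2)] mult_neg_neg[OF b(2) b(2)] by linarith+
  have nn: "0 \<le> (\<Sum>t\<in>?T. x t * x t)" by (intro sum_nonneg) simp
  have "(\<Sum>t\<in>?T. x t * x t) = 0" using split sq nn by linarith
  then have "\<forall>t\<in>?T. x t * x t = 0" using T by (subst (asm) sum_nonneg_eq_0_iff) auto
  moreover have "x a * x a = 1" "x b * x b = 1" using split sq nn by linarith+
  then have "x a = 1" "x b = - 1" using a b by (auto simp: zmult_eq_1_iff)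
  ultimately show ?thesis using a b ab by (intro bexI[of _ a] bexI[of _ b]) auto
qed

text \<open>If two roots have the same head, neither head is the tail of the other, so nothing
  cancels in their inner product; likewise for tails. Conversely a positive product requires a
  common head or tail. Equal roots would have product 2, which antisymmetry forbids for distinct
  elements.\<close>

lemma root_labelling_exists:
  fixes x :: "nat \<Rightarrow> nat \<Rightarrow> int"
  assumes S: "finite S" and po: "partial_order_on S r" and T: "finite T"
    and sum0: "\<And>i. i \<in> S \<Longrightarrow> (\<Sum>t\<in>T. x i t) = 0"
    and prod: "\<And>i j. i \<in> S \<Longrightarrow> j \<in> S \<Longrightarrow>
      (\<Sum>t\<in>T. x i t * x j t) = of_bool ((i, j) \<in> r) + of_bool ((j, i) \<in> r)"
  shows "\<exists>a b. root_labelled_poset S r a b"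
proof -
  have refl: "(i, i) \<in> r" if "i \<in> S" for i
    using partial_order_onD(1)[OF po] that by (auto simp: refl_on_def)
  have antisym: "i = j" if "(i, j) \<in> r" "(j, i) \<in> r" for i j
    using partial_order_onD(3)[OF po] that by (auto dest: antisymD)
  have "\<exists>a b. a \<in> T \<and> b \<in> T \<and> a \<noteq> b \<and> (\<forall>t\<in>T. x i t = of_bool (t = a) - of_bool (t = b))"
    if i: "i \<in> S" for i
  proof -
    have "(\<Sum>t\<in>T. x i t * x i t) = 2" using prod[OF i i] refl[OF i] by simp
    from root_vector[OF T sum0[OF i] this] show ?thesis by blast
  qed
  then obtain a b where ab: "\<And>i. i \<in> S \<Longrightarrow> a i \<in> T \<and> b i \<in> T \<and> a i \<noteq> b i \<and>
      (\<forall>t\<in>T. x i t = of_bool (t = a i) - of_bool (t = b i))"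
    by metis
  have ip: "of_bool ((i, j) \<in> r) + of_bool ((j, i) \<in> r) = 
      of_bool (a i = a j) - of_bool (a i = b j) - of_bool (b i = a j) + (of_bool (b i = b j) :: int)"
    if i: "i \<in> S" and j: "j \<in> S" for i j
  proof -
    have "(\<Sum>t\<in>T. x i t * x j t) = (\<Sum>t\<in>T. (if t = a i then of_bool (a i = a j) - of_bool (a i = b j) else 0)
      - (if t = b i then of_bool (b i = a j) - of_bool (b i = b j) else 0))"
      using ab[OF i] ab[OF j] by (intro sum.cong) auto
    also have "\<dots> = (of_bool (a i = a j) - of_bool (a i = b j)) - (of_bool (b i = a j) - of_bool (b i = b j))"
      using ab[OF i] T by (simp add: sum_subtractf)
    finally show ?thesis using prod[OF i j] by simp
  qed
  have "root_labelled_poset S r a b"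
  proof
    fix i j assume ij: "i \<in> S" "j \<in> S" "i \<noteq> j"
    have "\<not> ((i, j) \<in> r \<and> (j, i) \<in> r)" using antisym ij by blast
    moreover have "a i \<noteq> b i" "a j \<noteq> b j" using ab ij by auto
    ultimately show "((i, j) \<in> r \<or> (j, i) \<in> r) = (a i = a j \<or> b i = b j)"
      using ip[OF ij(1,2)] by (auto simp: of_bool_def split: if_splits)
    show False if "a i = a j" "b i = b j"
      using ip[OF ij(1,2)] that \<open>a i \<noteq> b i\<close> \<open>a j \<noteq> b j\<close> \<open>\<not> ((i, j) \<in> r \<and> (j, i) \<in> r)\<close>
      by (auto simp: of_bool_def split: if_splits)
  qed (use S po in auto)
  then show ?thesis by blast
qed

section \<open>Integral root vectors from the congruence with type A\<close>

lemma sorted_list_of_set_nth_atLeastAtMost: "i < n \<Longrightarrow> sorted_list_of_set {Suc 0..n} ! i = Suc i"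
  by (simp add: atLeastLessThanSuc_atLeastAtMost[symmetric] del: upt_Suc)

lemma incidence_mat_carrier [simp]: "incidence_mat S r \<in> carrier_mat (card S) (card S)"
  by (simp add: incidence_mat_def)

lemma incidence_mat_index:
  "i < n \<Longrightarrow> j < n \<Longrightarrow> incidence_mat {1..n} r $$ (i, j) = of_bool ((Suc i, Suc j) \<in> r)"
  by (simp add: incidence_mat_def sorted_list_of_set_nth_atLeastAtMost)

text \<open>Doubling removes the halves: twice the Gram matrix of type A is
  \<open>?D * ?D\<^sup>T\<close>, the rows of \<open>?D\<close> being the simple roots in
  \<open>m + 1\<close> coordinates.\<close>

lemma gram_congruent_int:
  assumes "Z_congruent (gram_mat S r) (dynkin_gram (Dyn_A m))"
  shows "card S = m" 
    "congruent_mat m (incidence_mat S r + (incidence_mat S r)\<^sup>T)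
      (diff_mat m (Suc m) (\<lambda>i. i) Suc * (diff_mat m (Suc m) (\<lambda>i. i) Suc)\<^sup>T)"
proof -
  let ?C = "incidence_mat S r" and ?D = "diff_mat m (Suc m) (\<lambda>i. i) Suc"
  let ?f = "map_mat real_of_int"
  show m: "card S = m" using assms by (simp add: Z_congruent_def gram_mat_def dynkin_gram_def incidence_mat_def)
  have C: "?C \<in> carrier_mat m m" using m by (metis incidence_mat_carrier)
  have dr: "dim_row (gram_mat S r) = m" using C by (simp add: gram_mat_def)
  obtain B :: "int mat" where B: "B \<in> carrier_mat m m" "invertible_mat B"
    and eq: "(?f B)\<^sup>T * gram_mat S r * ?f B = dynkin_gram (Dyn_A m)"
    using assms unfolding Z_congruent_def dr by blast
  obtain B' where inv: "inverts_mat B B'" "inverts_mat B' B" using B by (auto simp: invertible_mat_def)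
  have "B * B' = 1\<^sub>m m" using inv B by (simp add: inverts_mat_def)
  moreover from this have "dim_col B' = m" by (metis index_mult_mat(3) index_one_mat(3))
  moreover have B'B: "B' * B = 1\<^sub>m (dim_row B')" using inv by (simp add: inverts_mat_def)
  moreover from this have "dim_row B' = m" using B by (metis carrier_matD(2) index_mult_mat(3) index_one_mat(3))
  ultimately have B': "B' \<in> carrier_mat m m" "B * B' = 1\<^sub>m m" "B' * B = 1\<^sub>m m" by auto
  let ?G = "?C + ?C\<^sup>T"
  have G: "?G \<in> carrier_mat m m" using C by auto
  have DD: "?D * ?D\<^sup>T \<in> carrier_mat m m" by auto
  have "?f (?D * ?D\<^sup>T) = 2 \<cdot>\<^sub>m dynkin_gram (Dyn_A m)"
  proof (intro eq_matI)
    fix i j assume "i < dim_row (2 \<cdot>\<^sub>m dynkin_gram (Dyn_A m))" "j < dim_col (2 \<cdot>\<^sub>m dynkin_gram (Dyn_A m))"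
    then have ij: "i < m" "j < m" by (auto simp: dynkin_gram_def)
    have "?f (?D * ?D\<^sup>T) $$ (i, j) = of_int ((?D * ?D\<^sup>T) $$ (i, j))" using ij by simp
    also have "\<dots> = (2 \<cdot>\<^sub>m dynkin_gram (Dyn_A m)) $$ (i, j)"
      using ij by (subst diff_mat_mult_transpose) (auto simp: dynkin_gram_def)
    finally show "?f (?D * ?D\<^sup>T) $$ (i, j) = (2 \<cdot>\<^sub>m dynkin_gram (Dyn_A m)) $$ (i, j)" .
  qed (auto simp: dynkin_gram_def)
  also have "\<dots> = (?f B)\<^sup>T * (2 \<cdot>\<^sub>m gram_mat S r) * ?f B"
    unfolding eq[symmetric] using B dr C
    by (simp add: mult_smult_distrib[of _ m m _ m] mult_smult_assoc_mat[of _ m m _ m] gram_mat_def)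
  also have "2 \<cdot>\<^sub>m gram_mat S r = ?f ?G" by (intro eq_matI) (auto simp: gram_mat_def)
  also have "(?f B)\<^sup>T = ?f (B\<^sup>T)" by (intro eq_matI) auto
  also have "?f (B\<^sup>T) * ?f ?G * ?f B = ?f (B\<^sup>T * ?G * B)"
    using B G by (simp add: of_int_hom.mat_hom_mult[of _ m m _ m])
  finally have "?D * ?D\<^sup>T = B\<^sup>T * ?G * B" by (rule of_int_hom.mat_hom_inj)
  then show "congruent_mat m ?G (?D * ?D\<^sup>T)" unfolding congruent_mat_def using B B' by blast
qed

text \<open>The congruence matrix expresses the basis of the poset in simple roots, so the rows of
  \<open>X = B\<^sup>T * ?D\<close> are the wanted vectors; they have sum 0 because the rows of
  \<open>?D\<close> have.\<close>

lemma dynkin_A_vectors: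
  assumes fin: "finite S" and cong: "Z_congruent (gram_mat S r) (dynkin_gram (Dyn_A m))"
  shows "\<exists>x :: nat \<Rightarrow> nat \<Rightarrow> int. \<forall>i\<in>S. (\<Sum>t<Suc m. x i t) = 0 \<and>
    (\<forall>j\<in>S. (\<Sum>t<Suc m. x i t * x j t) = of_bool ((i, j) \<in> r) + of_bool ((j, i) \<in> r))"
proof -
  let ?C = "incidence_mat S r" and ?D = "diff_mat m (Suc m) (\<lambda>i. i) Suc"
  have m: "card S = m" and con: "congruent_mat m (?C + ?C\<^sup>T) (?D * ?D\<^sup>T)"
    using gram_congruent_int[OF cong] by auto
  have C: "?C \<in> carrier_mat m m" using m by (metis incidence_mat_carrier)
  have "congruent_mat m (?D * ?D\<^sup>T) (?C + ?C\<^sup>T)" by (rule congruent_mat_sym[OF _ con]) (use C in auto)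
  then obtain B where B: "B \<in> carrier_mat m m" and eq: "?C + ?C\<^sup>T = B\<^sup>T * (?D * ?D\<^sup>T) * B"
    unfolding congruent_mat_def by blast
  define X where "X = B\<^sup>T * ?D"
  have X: "X \<in> carrier_mat m (Suc m)" using B by (auto simp: X_def)
  have "B\<^sup>T * (?D * ?D\<^sup>T) * B = B\<^sup>T * ((?D * ?D\<^sup>T) * B)"
    by (rule assoc_mult_mat[of _ m m _ m _ m]) (use B in auto)
  also have "(?D * ?D\<^sup>T) * B = ?D * (?D\<^sup>T * B)"
    by (rule assoc_mult_mat[of _ m "Suc m" _ m _ m]) (use B in auto)
  also have "B\<^sup>T * (?D * (?D\<^sup>T * B)) = B\<^sup>T * ?D * (?D\<^sup>T * B)"
    by (rule assoc_mult_mat[symmetric, of _ m m _ "Suc m" _ m]) (use B in auto)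
  also have "?D\<^sup>T * B = X\<^sup>T"
    unfolding X_def using B by (subst transpose_mult[of _ m m _ "Suc m"]) auto
  finally have XX: "?C + ?C\<^sup>T = X * X\<^sup>T" unfolding eq X_def .
  define ls where "ls = sorted_list_of_set S"
  have ls: "distinct ls" "set ls = S" "length ls = m" using fin m by (auto simp: ls_def)
  then have "\<forall>s\<in>S. \<exists>i<m. ls ! i = s" by (metis in_set_conv_nth)
  then obtain pos where pos: "\<And>s. s \<in> S \<Longrightarrow> pos s < m \<and> ls ! pos s = s" by metis
  have "(\<Sum>t<Suc m. X $$ (pos i, t)) = 0" if "i \<in> S" for i
  proof -
    have "(\<Sum>t<Suc m. X $$ (pos i, t)) = (\<Sum>t<Suc m. \<Sum>l<m. B $$ (l, pos i) * ?D $$ (l, t))"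
      using pos[OF that] B unfolding X_def
      by (intro sum.cong refl) (simp add: index_mult_sum[of _ m m _ "Suc m"] del: index_mult_mat(1))
    also have "\<dots> = (\<Sum>l<m. B $$ (l, pos i) * (\<Sum>t<Suc m. ?D $$ (l, t)))"
      by (subst sum.swap) (simp only: sum_distrib_left)
    also have "\<dots> = 0"
    proof (intro sum.neutral ballI)
      fix l assume "l \<in> {..<m}"
      then have "(\<Sum>t<Suc m. ?D $$ (l, t)) = (\<Sum>t<Suc m. (if t = l then 1 else 0) - (if t = Suc l then 1 else 0))"
        by (intro sum.cong) auto
      also have "\<dots> = 0" using \<open>l \<in> {..<m}\<close> by (simp only: sum_subtractf sum.delta) simp
      finally show "B $$ (l, pos i) * (\<Sum>t<Suc m. ?D $$ (l, t)) = 0" by simp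
    qed
    finally show ?thesis .
  qed
  moreover have "(\<Sum>t<Suc m. X $$ (pos i, t) * X $$ (pos j, t)) = of_bool ((i, j) \<in> r) + of_bool ((j, i) \<in> r)"
    if "i \<in> S" "j \<in> S" for i j
  proof -
    have "(\<Sum>t<Suc m. X $$ (pos i, t) * X $$ (pos j, t)) = (X * X\<^sup>T) $$ (pos i, pos j)"
      using pos[OF that(1)] pos[OF that(2)] X
      by (simp add: index_mult_sum[of _ m "Suc m" _ m] del: index_mult_mat(1))
    also have "\<dots> = (?C + ?C\<^sup>T) $$ (pos i, pos j)" by (simp only: XX)
    also have "\<dots> = of_bool ((i, j) \<in> r) + of_bool ((j, i) \<in> r)"
      using pos[OF that(1)] pos[OF that(2)] by (simp add: incidence_mat_def m flip: ls_def)
    finally show ?thesis .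
  qed
  ultimately show ?thesis by (intro exI[of _ "\<lambda>i t. X $$ (pos i, t)"]) blast
qed

text \<open>Twice the Gram form, summed over elements rather than matrix indices: sums over
  \<open>S\<close> and over \<open>S - K\<close> can then be compared, although their matrices are
  numbered differently.\<close>

definition sym_form :: "nat set \<Rightarrow> nat rel \<Rightarrow> (nat \<Rightarrow> int) \<Rightarrow> (nat \<Rightarrow> int) \<Rightarrow> int" where
  "sym_form S r u v = (\<Sum>i\<in>S. \<Sum>j\<in>S. u i * v j * (of_bool ((i, j) \<in> r) + of_bool ((j, i) \<in> r)))"

lemma sym_form_add_left: "sym_form S r (\<lambda>i. u i + v i) w = sym_form S r u w + sym_form S r v w"
  by (simp add: sym_form_def distrib_right sum.distrib)

lemma sym_form_scale_left: "sym_form S r (\<lambda>i. t * u i) w = t * sym_form S r u w"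
  by (simp add: sym_form_def sum_distrib_left mult.assoc)

lemma sym_form_commute: "sym_form S r u v = sym_form S r v u"
  unfolding sym_form_def by (subst sum.swap) (simp add: mult_ac add_ac)

lemma sym_form_unit:
  assumes "finite S" "s \<in> S" "t \<in> S"
  shows "sym_form S r (\<lambda>i. of_bool (i = s)) (\<lambda>i. of_bool (i = t)) =
    of_bool ((s, t) \<in> r) + of_bool ((t, s) \<in> r)"
proof -
  have "sym_form S r (\<lambda>i. of_bool (i = s)) (\<lambda>i. of_bool (i = t)) =
    (\<Sum>i\<in>S. if i = s then \<Sum>j\<in>S. if j = t then of_bool ((s, t) \<in> r) + of_bool ((t, s) \<in> r) else 0 else 0)"
    unfolding sym_form_def by (intro sum.cong refl) (auto intro!: sum.cong)
  then show ?thesis using assms by simp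
qed

lemma sym_form_radical:
  assumes nonneg: "\<And>u. 0 \<le> sym_form S r u u" and null: "sym_form S r h h = 0"
  shows "sym_form S r h v = 0"
proof (rule ccontr)
  define b w where "b = sym_form S r h v" and "w = sym_form S r v v"
  \<comment> \<open>Chosen so that the value \<open>2 t b + w\<close> of the form at
    \<open>t h + v\<close> becomes \<open>w - 2 b b (w + 1)\<close>, which is negative for every
    integer \<open>b\<close> other than 0; being integral, \<open>t\<close> stays within integer
    vectors.\<close>
  define t where "t = - (b * (w + 1))"
  let ?u = "\<lambda>i. t * h i + v i"
  assume "sym_form S r h v \<noteq> 0"
  then have "0 < b * b" unfolding b_def[symmetric] by (auto simp: zero_less_mult_iff linorder_neq_iff)
  then have b: "1 \<le> b * b" by linarith
  have w: "0 \<le> w" using nonneg by (simp add: w_def)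
  have "sym_form S r ?u ?u = t * sym_form S r h ?u + sym_form S r v ?u"
    by (simp only: sym_form_add_left sym_form_scale_left)
  also have "sym_form S r h ?u = t * sym_form S r h h + b"
    unfolding b_def
    by (subst sym_form_commute) (simp only: sym_form_add_left sym_form_scale_left sym_form_commute[of S r v h])
  also have "sym_form S r v ?u = t * b + w"
    unfolding b_def w_def
    by (subst sym_form_commute) (simp only: sym_form_add_left sym_form_scale_left)
  finally have pos: "0 \<le> 2 * (t * b) + w" using nonneg[of ?u] null by (simp add: mult.commute)
  define X where "X = (b * b) * (w + 1)"
  have "t * b = - X" by (simp add: t_def X_def algebra_simps)
  then have "2 * X \<le> w" using pos by simp
  moreover have "1 * (w + 1) \<le> X" unfolding X_def using w b by (intro mult_right_mono) auto
  ultimately show False using w by presburger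
qed

lemma scalar_prod_mult_mat_vec_sum:
  fixes A :: "'a::comm_ring_1 mat"
  assumes "A \<in> carrier_mat n n" "v \<in> carrier_vec n"
  shows "v \<bullet> (A *\<^sub>v v) = (\<Sum>i<n. \<Sum>j<n. v $ i * v $ j * A $$ (i, j))"
proof -
  have "v \<bullet> (A *\<^sub>v v) = (\<Sum>i<n. v $ i * (\<Sum>j<n. A $$ (i, j) * v $ j))"
    using assms by (auto simp: scalar_prod_def lessThan_atLeast0 intro!: sum.cong)
  then show ?thesis by (simp add: sum_distrib_left mult_ac)
qed

lemma sum_shift: "(\<Sum>i<n. g (Suc i)) = (\<Sum>i\<in>{1..n}. g i)"
  by (rule sum.reindex_bij_witness[of _ "\<lambda>i. i - 1" Suc]) auto

lemma sym_form_nonneg: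
  assumes "nonnegative_poset {1..n} r"
  shows "0 \<le> sym_form {1..n} r u u"
proof -
  let ?G = "gram_mat {1..n} r" and ?x = "vec n (\<lambda>i. real_of_int (u (Suc i)))"
  let ?c = "\<lambda>i j. of_bool ((i, j) \<in> r) + of_bool ((j, i) \<in> r) :: int"
  have G: "?G \<in> carrier_mat n n" by (simp add: gram_mat_def incidence_mat_def)
  have Gi: "?G $$ (i, j) = real_of_int (?c (Suc i) (Suc j)) / 2" if "i < n" "j < n" for i j
    using that by (simp add: gram_mat_def incidence_mat_def sorted_list_of_set_nth_atLeastAtMost)
  have "0 \<le> ?x \<bullet> (?G *\<^sub>v ?x)"
    using assms G by (auto simp: nonnegative_poset_def positive_semidefinite_def)
  also have "\<dots> = (\<Sum>i<n. \<Sum>j<n. u (Suc i) * u (Suc j) * ?c (Suc i) (Suc j)) / 2"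
  proof -
    have "?x \<bullet> (?G *\<^sub>v ?x) = (\<Sum>i<n. \<Sum>j<n. ?x $ i * ?x $ j * ?G $$ (i, j))"
      using G by (intro scalar_prod_mult_mat_vec_sum) auto
    also have "\<dots> = (\<Sum>i<n. \<Sum>j<n. of_int (u (Suc i) * u (Suc j) * ?c (Suc i) (Suc j)) / 2)"
      by (intro sum.cong refl) (simp add: Gi[unfolded One_nat_def])
    finally show ?thesis by (simp add: sum_divide_distrib)
  qed
  also have "(\<Sum>i<n. \<Sum>j<n. u (Suc i) * u (Suc j) * ?c (Suc i) (Suc j)) = sym_form {1..n} r u u"
    unfolding sym_form_def sum_shift[of "\<lambda>j. u (Suc _) * u j * ?c (Suc _) j"]
      sum_shift[of "\<lambda>i. \<Sum>j\<in>{1..n}. u i * u j * ?c i j"] ..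
  finally show ?thesis by simp
qed

lemma sym_form_ker_form:
  assumes "v \<in> ker_form {1..n} r"
  shows "sym_form {1..n} r (\<lambda>i. v $ (i - 1)) (\<lambda>i. v $ (i - 1)) = 0"
proof -
  let ?u = "\<lambda>i. v $ (i - 1)"
  let ?c = "\<lambda>i j. of_bool ((i, j) \<in> r) :: int"
  have v: "v \<in> carrier_vec n" and 0: "v \<bullet> (incidence_mat {1..n} r *\<^sub>v v) = 0"
    using assms by (auto simp: ker_form_def quad_form_def)
  have "v \<bullet> (incidence_mat {1..n} r *\<^sub>v v) = (\<Sum>i<n. \<Sum>j<n. ?u (Suc i) * ?u (Suc j) * ?c (Suc i) (Suc j))"
  proof -
    have "v \<bullet> (incidence_mat {1..n} r *\<^sub>v v) = (\<Sum>i<n. \<Sum>j<n. v $ i * v $ j * incidence_mat {1..n} r $$ (i, j))"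
      using v incidence_mat_carrier[of "{1..n}" r] by (intro scalar_prod_mult_mat_vec_sum) auto
    also have "\<dots> = (\<Sum>i<n. \<Sum>j<n. ?u (Suc i) * ?u (Suc j) * ?c (Suc i) (Suc j))"
      by (intro sum.cong refl) (simp add: incidence_mat_index[unfolded One_nat_def])
    finally show ?thesis .
  qed
  also have "\<dots> = (\<Sum>i\<in>{1..n}. \<Sum>j\<in>{1..n}. ?u i * ?u j * ?c i j)"
    unfolding sum_shift[of "\<lambda>j. ?u (Suc _) * ?u j * ?c (Suc _) j"]
      sum_shift[of "\<lambda>i. \<Sum>j\<in>{1..n}. ?u i * ?u j * ?c i j"] ..
  finally have a: "(\<Sum>i\<in>{1..n}. \<Sum>j\<in>{1..n}. ?u i * ?u j * ?c i j) = 0" using 0 by simp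
  have "(\<Sum>i\<in>{1..n}. \<Sum>j\<in>{1..n}. ?u i * ?u j * ?c j i) = (\<Sum>i\<in>{1..n}. \<Sum>j\<in>{1..n}. ?u i * ?u j * ?c i j)"
    by (subst sum.swap) (simp only: mult.commute[of "?u _" "?u _"])
  then show ?thesis using a by (simp add: sym_form_def distrib_left sum.distrib)
qed

lemma Z_basis_mem:
  assumes "Z_basis n V K h" "k \<in> K" shows "h k \<in> V"
proof -
  have fin: "finite K" and hk: "h k \<in> carrier_vec n" and V: "V = range (Z_comb n K h)"
    using assms by (auto simp: Z_basis_def)
  have "Z_comb n K h (\<lambda>j. of_bool (j = k)) = h k"
  proof (intro eq_vecI)
    fix i assume "i < dim_vec (h k)"
    then have i: "i < n" using hk by simp
    have "(\<Sum>j\<in>K. of_bool (j = k) * h j $ i) = (\<Sum>j\<in>K. if j = k then h k $ i else 0)"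
      by (intro sum.cong) auto
    then show "Z_comb n K h (\<lambda>j. of_bool (j = k)) $ i = h k $ i"
      using fin assms(2) i by (simp add: Z_comb_def)
  qed (use hk in \<open>simp add: Z_comb_def\<close>)
  then show ?thesis unfolding V by (metis rangeI)
qed

lemma dynkin_A_root_labelling:
  assumes po: "partial_order_on {1..n} r" and nonneg: "nonnegative_poset {1..n} r"
    and dyn: "has_dynkin_type n r (Dyn_A m)"
  shows "\<exists>a b. root_labelled_poset {1..n} r a b"
proof -
  let ?S = "{1..n}"
  let ?c = "\<lambda>i j. of_bool ((i, j) \<in> r) + of_bool ((j, i) \<in> r) :: int"
  obtain K h where K: "K \<subseteq> ?S" and basis: "Z_basis n (ker_form ?S r) K h"
    and delta: "\<forall>i\<in>K. \<forall>j\<in>K. h i $ (j - 1) = (if i = j then 1 else 0)"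
    and cong: "Z_congruent (gram_mat (?S - K) r) (dynkin_gram (Dyn_A m))"
    using dyn unfolding has_dynkin_type_def by blast
  have "finite (?S - K)" by simp
  from dynkin_A_vectors[OF this cong] obtain x :: "nat \<Rightarrow> nat \<Rightarrow> int"
    where x: "\<forall>i\<in>?S - K. (\<Sum>t<Suc m. x i t) = 0 \<and> (\<forall>j\<in>?S - K. (\<Sum>t<Suc m. x i t * x j t) = ?c i j)"
    by (elim exE)
  then have x0: "\<And>i. i \<in> ?S - K \<Longrightarrow> (\<Sum>t<Suc m. x i t) = 0"
    and xx: "\<And>i j. i \<in> ?S - K \<Longrightarrow> j \<in> ?S - K \<Longrightarrow> (\<Sum>t<Suc m. x i t * x j t) = ?c i j"
    by blast+
  define e :: "nat \<Rightarrow> nat \<Rightarrow> int" where "e s i = of_bool (i = s)" for s i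
  define g where "g s i = (if s \<in> K then - h s $ (i - 1) else 0)" for s i
  \<comment> \<open>Modulo the radical \<open>y s\<close> equals the basis vector \<open>e s\<close>, but it is supported outside \<open>K\<close>.\<close>
  define y where "y s i = e s i + g s i" for s i
  have g_rad: "sym_form ?S r (g s) v = 0" for s v
  proof (cases "s \<in> K")
    case True
    have "sym_form ?S r (\<lambda>i. - 1 * h s $ (i - 1)) v = - 1 * sym_form ?S r (\<lambda>i. h s $ (i - 1)) v"
      by (rule sym_form_scale_left)
    also have "sym_form ?S r (\<lambda>i. h s $ (i - 1)) v = 0"
      using sym_form_nonneg[OF nonneg] sym_form_ker_form[OF Z_basis_mem[OF basis True]]
      by (rule sym_form_radical)
    finally have "sym_form ?S r (\<lambda>i. - 1 * h s $ (i - 1)) v = 0" by simp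
    moreover have "g s = (\<lambda>i. - 1 * h s $ (i - 1))" using True by (simp add: g_def fun_eq_iff)
    ultimately show ?thesis by (simp only:)
  next
    case False
    then show ?thesis by (simp add: g_def sym_form_def)
  qed
  have y_form: "sym_form ?S r (y s) (y t) = ?c s t" if "s \<in> ?S" "t \<in> ?S" for s t
  proof -
    have "sym_form ?S r (y s) (y t) = sym_form ?S r (e s) (y t)"
      unfolding y_def[of s] sym_form_add_left g_rad by simp
    also have "\<dots> = sym_form ?S r (y t) (e s)" by (rule sym_form_commute)
    also have "\<dots> = sym_form ?S r (e t) (e s)" unfolding y_def[of t] sym_form_add_left g_rad by simp
    also have "\<dots> = ?c t s" unfolding e_def using that by (intro sym_form_unit) auto
    finally show ?thesis by simp
  qed
  have y_K: "y s i = 0" if "i \<in> K" for s i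
    using delta that by (auto simp: y_def e_def g_def)
  \<comment> \<open>\<open>z s\<close> is the image of \<open>y s\<close> under the linear map
    taking the unit vector of each \<open>i\<close> outside \<open>K\<close> to the root
    \<open>x i\<close>. It preserves the form because \<open>y s\<close> vanishes on
    \<open>K\<close>.\<close>
  define z where "z s t = (\<Sum>i\<in>?S - K. y s i * x i t)" for s t
  have "(\<Sum>t<Suc m. z s t) = 0" for s
  proof -
    have "(\<Sum>t<Suc m. z s t) = (\<Sum>i\<in>?S - K. y s i * (\<Sum>t<Suc m. x i t))"
      unfolding z_def by (subst sum.swap) (simp only: sum_distrib_left)
    then show ?thesis using x0 by (simp only: mult_zero_right sum.neutral_const cong: sum.cong)
  qed
  moreover have "(\<Sum>t<Suc m. z s t * z s' t) = ?c s s'" if "s \<in> ?S" "s' \<in> ?S" for s s'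
  proof -
    have "(\<Sum>t<Suc m. z s t * z s' t) =
        (\<Sum>t<Suc m. \<Sum>i\<in>?S - K. \<Sum>j\<in>?S - K. y s i * y s' j * (x i t * x j t))"
      unfolding z_def sum_product by (intro sum.cong refl) (simp only: mult_ac)
    also have "\<dots> = (\<Sum>i\<in>?S - K. \<Sum>t<Suc m. \<Sum>j\<in>?S - K. y s i * y s' j * (x i t * x j t))"
      by (rule sum.swap)
    also have "\<dots> = (\<Sum>i\<in>?S - K. \<Sum>j\<in>?S - K. y s i * y s' j * (\<Sum>t<Suc m. x i t * x j t))"
      by (rule sum.cong[OF refl], subst sum.swap) (simp only: sum_distrib_left)
    also have "\<dots> = (\<Sum>i\<in>?S - K. \<Sum>j\<in>?S - K. y s i * y s' j * ?c i j)"
      by (intro sum.cong refl) (simp only: xx)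
    also have "\<dots> = (\<Sum>i\<in>?S - K. \<Sum>j\<in>?S. y s i * y s' j * ?c i j)"
      using y_K by (intro sum.cong refl sum.mono_neutral_left) auto
    also have "\<dots> = sym_form ?S r (y s) (y s')"
      unfolding sym_form_def using y_K by (intro sum.mono_neutral_left) auto
    finally show ?thesis using y_form[OF that] by simp
  qed
  ultimately show ?thesis
    by (intro root_labelling_exists[OF _ po, of "{..<Suc m}" z]) auto
qed

section \<open>The canonical two peak poset\<close>

lemma path_arrows_Cons: "path_arrows (x # y # zs) = insert (x, y) (path_arrows (y # zs))"
  by (simp add: path_arrows_def)

lemma path_arrows_single [simp]: "path_arrows [x] = {}"
  by (simp add: path_arrows_def)

lemma path_arrows_nth: "path_arrows xs = {(xs ! i, xs ! Suc i) | i. Suc i < length xs}"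
  by (cases xs) (auto simp: path_arrows_def set_zip)

lemma path_arrows_append: "path_arrows (us @ x # vs) = path_arrows (us @ [x]) \<union> path_arrows (x # vs)"
proof (induction us)
  case (Cons u us)
  then show ?case by (cases us) (auto simp: path_arrows_Cons)
qed simp

lemma path_arrows_rev: "path_arrows (rev xs) = (path_arrows xs)\<inverse>"
proof (induction xs rule: induct_list012)
  case (3 x y zs)
  have "path_arrows (rev (x # y # zs)) = path_arrows (rev (y # zs)) \<union> {(y, x)}"
    using path_arrows_append[of "rev zs" y "[x]"] by (simp add: path_arrows_Cons)
  then show ?case using 3 by (auto simp: path_arrows_Cons)
qed (simp_all add: path_arrows_def)

lemma path_arrows_upt:
  "path_arrows (s # [u..<v] @ [n]) = {(x, y). (x = s \<and> y = (if u < v then u else n)) \<or>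
     (u \<le> x \<and> x < v \<and> y = (if Suc x < v then Suc x else n))}"
proof (induction "v - u" arbitrary: s u)
  case 0
  then show ?case by (auto simp: path_arrows_Cons)
next
  case (Suc d)
  then have uv: "u < v" by simp
  have "d = v - Suc u" using Suc by simp
  note IH = Suc(1)[OF this, of u]
  show ?case
    unfolding upt_conv_Cons[OF uv] append_Cons path_arrows_Cons IH using uv by auto
qed

lemma cyclic_steps_eq_path_arrows:
  assumes "xs \<noteq> []" shows "cyclic_steps xs = path_arrows (xs @ [hd xs])"
proof -
  have nth: "(xs @ [hd xs]) ! Suc i = xs ! (Suc i mod length xs)" if "i < length xs" for i
    using that assms by (cases "Suc i = length xs") (auto simp: nth_append hd_conv_nth)
  have "path_arrows (xs @ [hd xs]) = (\<lambda>i. ((xs @ [hd xs]) ! i, (xs @ [hd xs]) ! Suc i)) ` {..<length xs}"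
    unfolding path_arrows_nth by auto
  also have "\<dots> = (\<lambda>i. (xs ! i, xs ! (Suc i mod length xs))) ` {..<length xs}"
    by (intro image_cong refl) (simp add: nth, simp add: nth_append)
  also have "\<dots> = cyclic_steps xs"
    unfolding cyclic_steps_def by auto
  finally show ?thesis by simp
qed

locale two_peak =
  fixes p n :: nat
  assumes p: "2 \<le> p" and q: "p + 2 \<le> n"
begin

abbreviation "R \<equiv> two_peak_arrows p n"

definition A where "A = path_arrows (1 # [3..<p + 1] @ [n])"
definition B where "B = path_arrows (2 # [p + 1..<n - 1] @ [n])"

lemma R_eq: "R = A \<union> B \<union> {(1, n - 1), (2, n - 1)}"
  by (simp add: two_peak_arrows_def A_def B_def)

lemma A_iff: "(x, y) \<in> A \<longleftrightarrow> (x = 1 \<and> y = (if 3 \<le> p then 3 else n)) \<or>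
    (3 \<le> x \<and> x \<le> p \<and> y = (if x < p then Suc x else n))"
  unfolding A_def path_arrows_upt by auto

lemma B_iff: "(x, y) \<in> B \<longleftrightarrow> (x = 2 \<and> y = (if p + 2 < n then p + 1 else n)) \<or>
    (p < x \<and> x + 2 \<le> n \<and> y = (if x + 2 < n then Suc x else n))"
  unfolding B_def path_arrows_upt using p q by auto

lemma R_increasing: "(x, y) \<in> R \<Longrightarrow> x < y"
  using p q by (auto simp: R_eq A_iff B_iff split: if_splits)

lemma R_range: "(x, y) \<in> R \<Longrightarrow> 1 \<le> x \<and> 3 \<le> y \<and> y \<le> n"
  using p q by (auto simp: R_eq A_iff B_iff split: if_splits)

lemma R_out_peak: "(n - 1, y) \<notin> R"
  using p q by (auto simp: R_eq A_iff B_iff split: if_splits)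

lemma R_in_peak: "(x, n - 1) \<in> R \<Longrightarrow> x = 1 \<or> x = 2"
  using p q by (auto simp: R_eq A_iff B_iff split: if_splits)

lemma R_branch: "(x, y) \<in> R \<Longrightarrow> (x, z) \<in> R \<Longrightarrow> y \<noteq> n - 1 \<Longrightarrow> z \<noteq> n - 1 \<Longrightarrow> y = z"
  using p q by (auto simp: R_eq A_iff B_iff split: if_splits)

lemma rtrancl_le: "(x, y) \<in> R\<^sup>* \<Longrightarrow> x \<le> y"
  by (induction rule: rtrancl_induct) (auto dest: R_increasing)

text \<open>Where two arrows leave a vertex, one of them ends in the peak \<open>n - 1\<close>.
  Nothing leaves that peak, and it is entered only from 1 and 2, which no arrow enters. So different
  successors reach no common vertex.\<close>

lemma upper_unique:
  assumes ik: "(i, k) \<in> R" and il: "(i, l) \<in> R" and kj: "(k, j) \<in> R\<^sup>*" and lj: "(l, j) \<in> R\<^sup>*"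
  shows "k = l"
proof (rule ccontr)
  assume kl: "k \<noteq> l"
  have key: False if ik: "(i, k) \<in> R" and "(n - 1, j) \<in> R\<^sup>*" and ne: "k \<noteq> n - 1" and "(k, j) \<in> R\<^sup>*" for k
  proof -
    have "j = n - 1" using that(2) R_out_peak by (metis converse_rtranclE)
    then have "(k, n - 1) \<in> R\<^sup>*" using that by simp
    then obtain m where m: "(k, m) \<in> R\<^sup>*" "(m, n - 1) \<in> R" using ne by (cases rule: rtranclE) auto
    then have "k \<le> 2" using R_in_peak[OF m(2)] rtrancl_le[OF m(1)] by auto
    then show False using R_range[OF ik] by simp
  qed
  show False using R_branch[OF ik il] key[OF ik] key[OF il] kj lj kl by blast
qed

definition cyc where "cyc = 1 # [3..<p + 1] @ n # rev [p + 1..<n - 1] @ [2, n - 1]"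

lemma cyc: "distinct cyc" "set cyc = {1..n}" "length cyc = n"
  using p q by (auto simp: cyc_def)

lemma cyclic_steps_cyc: "cyclic_steps cyc = A \<union> B\<inverse> \<union> {(2, n - 1), (n - 1, 1)}"
proof -
  have "cyclic_steps cyc = path_arrows ((1 # [3..<p + 1]) @ n # (rev [p + 1..<n - 1] @ [2, n - 1, 1]))"
    by (subst cyclic_steps_eq_path_arrows) (simp_all add: cyc_def)
  also have "\<dots> = A \<union> path_arrows ((n # rev [p + 1..<n - 1]) @ 2 # [n - 1, 1])"
    by (subst path_arrows_append) (simp add: A_def)
  also have "path_arrows ((n # rev [p + 1..<n - 1]) @ 2 # [n - 1, 1]) =
      path_arrows (rev (2 # [p + 1..<n - 1] @ [n])) \<union> {(2, n - 1), (n - 1, 1)}"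
    by (subst path_arrows_append) (simp add: path_arrows_Cons)
  finally show ?thesis unfolding path_arrows_rev B_def by (simp only: Un_assoc)
qed

text \<open>The \<open>p - 1\<close> arrows of \<open>A\<close> and the arrow from 2 to
  \<open>n - 1\<close> follow the traversal \<open>cyc\<close>; \<open>B\<close> and the arrow from
  1 to \<open>n - 1\<close> run against it.\<close>

lemma card_cyclic_steps: "card (cyclic_steps cyc \<inter> R) = p"
proof -
  define f where "f x = (x, if x = 1 then if 3 \<le> p then 3 else n else if x < p then Suc x else n)" for x
  have "cyclic_steps cyc \<inter> R = A \<union> {(2, n - 1)}"
  proof -
    have "(x, y) \<notin> R" if "(y, x) \<in> B" for x y
      using R_increasing[of x y] R_increasing[of y x] that unfolding R_eq by auto
    then have "B\<inverse> \<inter> R = {}" by auto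
    moreover have "(n - 1, 1) \<notin> R" using R_out_peak by blast
    ultimately show ?thesis unfolding cyclic_steps_cyc R_eq by blast
  qed
  also have "A = f ` insert 1 {3..p}"
    by (auto simp: A_iff f_def)
  finally have eq: "cyclic_steps cyc \<inter> R = insert (2, n - 1) (f ` insert 1 {3..p})" by simp
  have "inj_on f (insert 1 {3..p})" by (auto simp: inj_on_def f_def)
  then have "card (f ` insert 1 {3..p}) = p - 1" using p by (subst card_image) auto
  moreover have "(2, n - 1) \<notin> f ` insert 1 {3..p}" by (auto simp: f_def)
  ultimately show ?thesis unfolding eq using p by (subst card_insert_disjoint) auto
qed

lemma word: "congruent_mat n (euler_mat n (shift_rel R)) (word_mat n (cycle_word p (n - p)))"
proof -
  have asym: "(y, x) \<notin> R" if "(x, y) \<in> R" for x y using R_increasing that by (meson less_asym)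
  have "R \<union> R\<inverse> = cyclic_steps cyc \<union> (cyclic_steps cyc)\<inverse>"
    unfolding cyclic_steps_cyc R_eq by auto
  note euler_mat_cycle[OF cyc asym this card_cyclic_steps[symmetric] refl]
  then show ?thesis by (metis add_diff_cancel_left')
qed

end

section \<open>Invariants of posets of Dynkin type A\<close>

text \<open>An entry of the product is that of the incidence matrix minus the number of
  \<open>R\<close>-successors of \<open>i\<close> below \<open>j\<close>. By \<open>step\<close> and
  \<open>unique\<close> this number is 1 if \<open>i\<close> is strictly below \<open>j\<close> and
  0 for other distinct \<open>i\<close> and \<open>j\<close>; by \<open>acyc\<close> it is 0 on the
  diagonal.\<close>

lemma euler_mat_incidence_inverse:
  assumes refl_r: "\<And>i. i \<in> {1..n} \<Longrightarrow> (i, i) \<in> r"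
    and R: "R \<subseteq> {1..n} \<times> {1..n}"
    and step: "\<And>i j. i \<in> {1..n} \<Longrightarrow> j \<in> {1..n} \<Longrightarrow> i \<noteq> j \<Longrightarrow>
      (i, j) \<in> r \<longleftrightarrow> (\<exists>k. (i, k) \<in> R \<and> (k, j) \<in> r)"
    and acyc: "\<And>i k. (i, k) \<in> R \<Longrightarrow> (k, i) \<notin> r"
    and unique: "\<And>i j k l. j \<in> {1..n} \<Longrightarrow> (i, k) \<in> R \<Longrightarrow> (k, j) \<in> r \<Longrightarrow> (i, l) \<in> R \<Longrightarrow> (l, j) \<in> r \<Longrightarrow> k = l"
  shows "euler_mat n (shift_rel R) * incidence_mat {1..n} r = 1\<^sub>m n"
proof (intro eq_matI)
  fix i j assume "i < dim_row (1\<^sub>m n :: int mat)" "j < dim_col (1\<^sub>m n :: int mat)"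
  then have ij: "i < n" "j < n" by auto
  let ?c = "\<lambda>i j. of_bool ((Suc i, Suc j) \<in> r) :: int"
  define Q where "Q l \<longleftrightarrow> (Suc i, Suc l) \<in> R \<and> (Suc l, Suc j) \<in> r" for l
  have C: "incidence_mat {1..n} r \<in> carrier_mat n n" using incidence_mat_carrier[of "{1..n}" r] by simp
  have "(euler_mat n (shift_rel R) * incidence_mat {1..n} r) $$ (i, j) =
      (\<Sum>l<n. euler_mat n (shift_rel R) $$ (i, l) * incidence_mat {1..n} r $$ (l, j))"
    using ij by (rule index_mult_sum[OF euler_mat_carrier C])
  also have "\<dots> = (\<Sum>l<n. (if l = i then ?c i j else 0) - of_bool (Q l))"
    using ij by (intro sum.cong refl) (auto simp: incidence_mat_index[unfolded One_nat_def] shift_rel_def Q_def)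
  also have "\<dots> = ?c i j - (\<Sum>l<n. of_bool (Q l))" using ij by (simp add: sum_subtractf)
  also have "\<dots> = of_bool (i = j)"
  proof (cases "(\<exists>l<n. Q l)")
    case True
    then obtain l where l: "l < n" "Q l" by blast
    have "i \<noteq> j" using l acyc by (auto simp: Q_def)
    moreover have "(Suc i, Suc j) \<in> r" using step[of "Suc i" "Suc j"] ij l \<open>i \<noteq> j\<close> by (auto simp: Q_def)
    moreover have "(\<Sum>l<n. of_bool (Q l) :: int) = (\<Sum>k<n. if k = l then 1 else 0)"
    proof (intro sum.cong refl)
      fix k assume "k \<in> {..<n}"
      have "k = l" if "Q k" using unique[of "Suc j" "Suc i" "Suc k" "Suc l"] that l ij by (auto simp: Q_def)
      then show "of_bool (Q k) = (if k = l then 1 else 0 :: int)" using l(2) by (cases "k = l") auto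
    qed
    ultimately show ?thesis using l by simp
  next
    case False
    then have 0: "(\<Sum>l<n. of_bool (Q l) :: int) = 0" by (intro sum.neutral) auto
    have "(Suc i, Suc j) \<notin> r" if ne: "i \<noteq> j"
    proof
      assume "(Suc i, Suc j) \<in> r"
      then obtain k where k: "(Suc i, k) \<in> R" "(k, Suc j) \<in> r" using step[of "Suc i" "Suc j"] ij ne by auto
      then have "k \<in> {1..n}" using R by blast
      then have "Q (k - 1)" "k - 1 < n" using k by (auto simp: Q_def)
      then show False using False by blast
    qed
    moreover have "(Suc i, Suc i) \<in> r" using refl_r ij by simp
    ultimately show ?thesis using 0 by auto
  qed
  finally show "(euler_mat n (shift_rel R) * incidence_mat {1..n} r) $$ (i, j) = 1\<^sub>m n $$ (i, j)"
    using ij by simp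
qed (simp_all add: incidence_mat_def)

lemma (in root_labelled_poset) hasse_euler_inverse:
  assumes S: "S = {1..n}"
  shows "euler_mat n (shift_rel (hasse S r)) * incidence_mat {1..n} r = 1\<^sub>m n"
proof (rule euler_mat_incidence_inverse)
  show "hasse S r \<subseteq> {1..n} \<times> {1..n}"
  proof (rule subrelI)
    fix x y assume "(x, y) \<in> hasse S r"
    then show "(x, y) \<in> {1..n} \<times> {1..n}" using hasse_D(1,2)[of x y] S by simp
  qed
  show "(i, j) \<in> r \<longleftrightarrow> (\<exists>k. (i, k) \<in> hasse S r \<and> (k, j) \<in> r)"
    if "i \<in> {1..n}" "j \<in> {1..n}" "i \<noteq> j" for i j
  proof
    show "\<exists>k. (i, k) \<in> hasse S r \<and> (k, j) \<in> r" if "(i, j) \<in> r"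
      using ex_upper_cover[of i j] \<open>i \<in> {1..n}\<close> \<open>j \<in> {1..n}\<close> \<open>i \<noteq> j\<close> that S by simp
    show "(i, j) \<in> r" if ex: "\<exists>k. (i, k) \<in> hasse S r \<and> (k, j) \<in> r"
    proof -
      obtain k where "(i, k) \<in> hasse S r" "(k, j) \<in> r" using ex by blast
      then show ?thesis using trans[OF hasse_D(3)] by blast
    qed
  qed
  show "(k, i) \<notin> r" if "(i, k) \<in> hasse S r" for i k using hasse_D(3,4)[OF that] antisym by blast
  show "k = l" if "j \<in> {1..n}" "(i, k) \<in> hasse S r" "(k, j) \<in> r" "(i, l) \<in> hasse S r" "(l, j) \<in> r" for i j k l
    using upper_cover_unique[OF _ that(2-5)] that(1) S by simp
qed (use refl S in simp)

lemma chain_euler_inverse: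
  assumes n: "0 < n"
  shows "word_mat n (replicate (n - 1) True) * incidence_mat {1..n} (chain_poset n) = 1\<^sub>m n"
proof -
  let ?R = "{(i, j). 1 \<le> i \<and> j = Suc i \<and> j \<le> n}"
  have "euler_mat n (shift_rel ?R) * incidence_mat {1..n} (chain_poset n) = 1\<^sub>m n"
  proof (rule euler_mat_incidence_inverse)
    show "(i, j) \<in> chain_poset n \<longleftrightarrow> (\<exists>k. (i, k) \<in> ?R \<and> (k, j) \<in> chain_poset n)"
      if "i \<in> {1..n}" "j \<in> {1..n}" "i \<noteq> j" for i j
      using that by (auto simp: chain_poset_def)
  qed (auto simp: chain_poset_def)
  moreover have "euler_mat n (shift_rel ?R) = word_mat n (replicate (n - 1) True)"
    by (rule euler_mat_cong) (auto simp: shift_rel_def word_quiver_def)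
  ultimately show ?thesis by simp
qed

lemma (in two_peak) two_peak_euler_inverse:
  "euler_mat n (shift_rel R) * incidence_mat {1..n} (two_peak_poset p n) = 1\<^sub>m n"
proof (rule euler_mat_incidence_inverse)
  show R: "R \<subseteq> {1..n} \<times> {1..n}" using R_range R_increasing by fastforce
  show "(i, j) \<in> two_peak_poset p n \<longleftrightarrow> (\<exists>k. (i, k) \<in> R \<and> (k, j) \<in> two_peak_poset p n)"
    if i: "i \<in> {1..n}" and j: "j \<in> {1..n}" and ne: "i \<noteq> j" for i j
  proof
    assume "(i, j) \<in> two_peak_poset p n"
    then have "(i, j) \<in> R\<^sup>*" by (simp add: two_peak_poset_def)
    then obtain k where k: "(i, k) \<in> R" "(k, j) \<in> R\<^sup>*" using ne by (cases rule: converse_rtranclE) auto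
    then show "\<exists>k. (i, k) \<in> R \<and> (k, j) \<in> two_peak_poset p n"
      using R j by (intro exI[of _ k]) (auto simp: two_peak_poset_def)
  next
    assume "\<exists>k. (i, k) \<in> R \<and> (k, j) \<in> two_peak_poset p n"
    then show "(i, j) \<in> two_peak_poset p n"
      using i j by (auto simp: two_peak_poset_def intro: converse_rtrancl_into_rtrancl)
  qed
  show "(k, i) \<notin> two_peak_poset p n" if "(i, k) \<in> R" for i k
    using R_increasing[OF that] rtrancl_le[of k i] by (auto simp: two_peak_poset_def)
  show "k = l" if "(i, k) \<in> R" "(k, j) \<in> two_peak_poset p n" "(i, l) \<in> R" "(l, j) \<in> two_peak_poset p n" for i j k l
    using upper_unique[of i k l j] that by (auto simp: two_peak_poset_def)
qed (simp add: two_peak_poset_def)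

section \<open>Kernel and Coxeter invariants under congruence\<close>

lemma coxeter_mat_eq: "coxeter_mat S r = cox_mat (incidence_mat S r)"
  by (simp add: coxeter_mat_def cox_mat_def)

lemma congruent_mat_imp_Z_congruent:
  fixes X Y :: "int mat"
  assumes X: "X \<in> carrier_mat n n" and "congruent_mat n X Y"
  shows "Z_congruent X Y"
proof -
  obtain B B' where B: "B \<in> carrier_mat n n" "B' \<in> carrier_mat n n" "B * B' = 1\<^sub>m n" "B' * B = 1\<^sub>m n"
    and Y: "Y = B\<^sup>T * X * B" using assms unfolding congruent_mat_def by blast
  have "invertible_mat B" unfolding invertible_mat_def inverts_mat_def using B by (intro conjI exI[of _ B']) auto
  moreover have "map_mat of_int B = B" by (intro eq_matI) auto
  ultimately show ?thesis unfolding Z_congruent_def using X B Y by auto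
qed

lemma mult_mat_zero_vec: "A \<in> carrier_mat m k \<Longrightarrow> A *\<^sub>v 0\<^sub>v k = 0\<^sub>v m"
  by (auto simp: scalar_prod_def)

lemma mult_mat_smult_vec:
  fixes A :: "int mat"
  assumes "A \<in> carrier_mat m k" "v \<in> carrier_vec k"
  shows "A *\<^sub>v (c \<cdot>\<^sub>v v) = c \<cdot>\<^sub>v (A *\<^sub>v v)"
  using assms by (intro eq_vecI) (auto simp: scalar_prod_def sum_distrib_left mult_ac intro!: sum.cong)

lemma mult_mat_vec_inverse:
  fixes B B' :: "int mat"
  assumes "B \<in> carrier_mat n n" "B' \<in> carrier_mat n n" "B' * B = 1\<^sub>m n" "v \<in> carrier_vec n" "B *\<^sub>v v = w"
  shows "v = B' *\<^sub>v w"
proof -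
  have "B' *\<^sub>v w = (B' * B) *\<^sub>v v"
    unfolding assms(5)[symmetric] using assms(1-4) by (intro assoc_mult_mat_vec[symmetric, of _ n n _ n])
  then show ?thesis using assms by simp
qed

lemma one_pow_similar_iff:
  fixes X Y :: "int mat"
  assumes wit: "similar_mat_wit X Y P Q" and X: "X \<in> carrier_mat n n"
  shows "X ^\<^sub>m c = 1\<^sub>m n \<longleftrightarrow> Y ^\<^sub>m c = 1\<^sub>m n"
proof -
  have *: "A ^\<^sub>m c = 1\<^sub>m n" if w: "similar_mat_wit A B P Q" and A: "A \<in> carrier_mat n n" and B: "B ^\<^sub>m c = 1\<^sub>m n"
    for A B P Q :: "int mat"
  proof -
    have "dim_row A = n" using A by simp
    note d = similar_mat_witD[OF this[symmetric] w]
    have "A ^\<^sub>m c = P * 1\<^sub>m n * Q" using similar_mat_wit_pow_id[OF w, of c] B by simp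
    then show ?thesis using d by simp
  qed
  have "dim_row X = n" using X by simp
  note d = similar_mat_witD[OF this[symmetric] wit]
  show ?thesis using *[OF wit X] *[OF similar_mat_wit_sym[OF wit] d(5)] by blast
qed

text \<open>Stated for every matrix congruent to that of the chain, as triviality of the kernel, the
  characteristic polynomial and the order of the Coxeter matrix are invariants of
  congruence.\<close>

lemma chain_type:
  assumes n: "0 < n" and con: "congruent_mat n (incidence_mat {1..n} (chain_poset n)) C"
  shows "\<And>v. v \<in> carrier_vec n \<Longrightarrow> v \<bullet> (C *\<^sub>v v) = 0 \<Longrightarrow> v = 0\<^sub>v n"
    and "char_poly (cox_mat C) = (\<Sum>i\<le>n. monom 1 i)"
    and "\<And>c. cox_mat C ^\<^sub>m c = 1\<^sub>m n \<longleftrightarrow> Suc n dvd c"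
proof -
  let ?C = "incidence_mat {1..n} (chain_poset n)"
  let ?M = "diff_mat n (Suc n) (\<lambda>i. i) (\<lambda>_. n)"
  let ?L = "perm_mat (Suc n) (\<lambda>j. Suc j mod Suc n)"
  have C: "?C \<in> carrier_mat n n" using incidence_mat_carrier[of "{1..n}"] by simp
  interpret gram_factorization n "Suc n" ?C "word_mat n (replicate (n - 1) True)" ?M ?L
    by (rule chain_factorization[OF n C chain_euler_inverse[OF n]])
  obtain B B' where B: "B \<in> carrier_mat n n" "B' \<in> carrier_mat n n" "B * B' = 1\<^sub>m n" "B' * B = 1\<^sub>m n"
    and eq: "C = B\<^sup>T * ?C * B" using con unfolding congruent_mat_def by blast
  interpret c: gram_factorization n "Suc n" C "B' * word_mat n (replicate (n - 1) True) * B'\<^sup>T" "B\<^sup>T * ?M" ?L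
    unfolding eq by (rule congruent[OF B])
  have wit: "similar_mat_wit (cox_mat C) (cox_mat ?C) (B\<^sup>T) (B'\<^sup>T)"
    unfolding eq by (rule similar_cox_mat[OF B])
  \<comment> \<open>The first \<open>n\<close> columns of \<open>?M\<close> form the identity, so an
    identity padded by a zero row is a right inverse.\<close>
  define M' :: "int mat" where "M' = mat (Suc n) n (\<lambda>(i, j). of_bool (i = j))"
  have M': "M' \<in> carrier_mat (Suc n) n" by (simp add: M'_def)
  have MM': "?M * M' = 1\<^sub>m n"
  proof (intro eq_matI)
    fix i j assume "i < dim_row (1\<^sub>m n :: int mat)" "j < dim_col (1\<^sub>m n :: int mat)"
    then have ij: "i < n" "j < n" by auto
    have "(?M * M') $$ (i, j) = (\<Sum>l<Suc n. ?M $$ (i, l) * M' $$ (l, j))"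
      using ij M' by (intro index_mult_sum) auto
    also have "\<dots> = (\<Sum>l<Suc n. if l = j then ?M $$ (i, j) else 0)"
      using ij by (intro sum.cong refl) (auto simp: M'_def)
    also have "\<dots> = ?M $$ (i, j)" using ij by (simp only: sum.delta finite_lessThan) simp
    also have "\<dots> = 1\<^sub>m n $$ (i, j)" using ij by simp
    finally show "(?M * M') $$ (i, j) = 1\<^sub>m n $$ (i, j)" .
  qed (use M' in auto)
  show "v = 0\<^sub>v n" if v: "v \<in> carrier_vec n" and 0: "v \<bullet> (C *\<^sub>v v) = 0" for v
  proof -
    have "(B\<^sup>T * ?M)\<^sup>T *\<^sub>v v = 0\<^sub>v (Suc n)" using c.kernel_iff[OF v] 0 by simp
    also have "(B\<^sup>T * ?M)\<^sup>T = ?M\<^sup>T * B"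
      using B by (subst transpose_mult[of _ n n _ "Suc n"]) auto
    finally have z: "?M\<^sup>T *\<^sub>v (B *\<^sub>v v) = 0\<^sub>v (Suc n)"
      using B v by (simp add: assoc_mult_mat_vec[of _ "Suc n" n _ n])
    have Bv: "B *\<^sub>v v \<in> carrier_vec n" using B v by auto
    have "M'\<^sup>T * ?M\<^sup>T = 1\<^sub>m n" using transpose_mult[OF M M'] MM' by simp
    then have "B *\<^sub>v v = (M'\<^sup>T * ?M\<^sup>T) *\<^sub>v (B *\<^sub>v v)" using Bv by simp
    also have "\<dots> = M'\<^sup>T *\<^sub>v (?M\<^sup>T *\<^sub>v (B *\<^sub>v v))"
      using M' Bv by (intro assoc_mult_mat_vec[of _ n "Suc n" _ n]) auto
    also have "\<dots> = 0\<^sub>v n" unfolding z using M' by (intro mult_mat_zero_vec) auto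
    finally have "v = B' *\<^sub>v 0\<^sub>v n" using mult_mat_vec_inverse[OF B(1,2,4) v] by blast
    then show ?thesis using mult_mat_zero_vec[OF B(2)] by simp
  qed
  have "char_poly (cox_mat C) = char_poly (cox_mat ?C)"
    using wit by (intro char_poly_similar) (auto simp: similar_mat_def)
  also have "\<dots> = (\<Sum>i\<le>n. monom 1 i)"
  proof -
    let ?t = "[:-1, 1:] :: int poly"
    have "?t ^ Suc n * char_poly (cox_mat ?C) = ?t ^ n * (monom 1 (Suc n) - 1)"
      using char_poly_cox_mat char_poly_cyclic_perm_mat[of "Suc n"] by simp
    then have "?t ^ n * (?t * char_poly (cox_mat ?C)) = ?t ^ n * (monom 1 (Suc n) - 1)"
      by (simp only: power_Suc mult_ac)
    then have 1: "?t * char_poly (cox_mat ?C) = monom 1 (Suc n) - 1" by simp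
    have "monom 1 (Suc n) - 1 = monom 1 1 ^ Suc n - (1 :: int poly)"
      by (simp only: monom_power) simp
    also have "\<dots> = (monom 1 1 - 1) * (\<Sum>i<Suc n. monom 1 1 ^ i)" by (rule power_diff_1_eq)
    also have "monom 1 1 - 1 = ?t" by (simp add: monom_altdef one_pCons)
    also have "(\<Sum>i<Suc n. monom 1 1 ^ i :: int poly) = (\<Sum>i\<le>n. monom 1 i)"
      by (simp only: monom_power lessThan_Suc_atMost) simp
    finally have "?t * char_poly (cox_mat ?C) = ?t * (\<Sum>i\<le>n. monom 1 i)" using 1 by simp
    then show ?thesis by (subst (asm) mult_cancel_left) simp
  qed
  finally show "char_poly (cox_mat C) = (\<Sum>i\<le>n. monom 1 i)" .
  show "cox_mat C ^\<^sub>m c = 1\<^sub>m n \<longleftrightarrow> Suc n dvd c" for c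
    unfolding one_pow_similar_iff[OF wit c.cox_mat_carrier]
    using cox_mat_pow_eq_one_iff[OF MM' M'] chain_perm_fixes_iff[OF n] by simp
qed

lemma cycle_type:
  assumes p: "2 \<le> p" "p + 2 \<le> n" and C: "C \<in> carrier_mat n n"
    and E: "E \<in> carrier_mat n n" "E * C = 1\<^sub>m n"
    and con: "congruent_mat n E (word_mat n (cycle_word p (n - p)))"
  shows "\<exists>g. g \<noteq> 0\<^sub>v n \<and> g \<in> carrier_vec n \<and> (\<forall>v\<in>carrier_vec n. v \<bullet> (C *\<^sub>v v) = 0 \<longleftrightarrow> (\<exists>c. v = c \<cdot>\<^sub>v g))"
    and "char_poly (cox_mat C) = monom 1 n - monom 1 p - monom 1 (n - p) + 1"
    and "\<And>c. 1 \<le> c \<Longrightarrow> cox_mat C ^\<^sub>m c \<noteq> 1\<^sub>m n"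
    and "\<And>c. (\<forall>i<n. row (cox_mat C ^\<^sub>m c - 1\<^sub>m n) i \<bullet> (C *\<^sub>v row (cox_mat C ^\<^sub>m c - 1\<^sub>m n) i) = 0) \<longleftrightarrow>
      p dvd c \<and> (n - p) dvd c"
proof -
  interpret cc: canonical_cycle p n by standard (use p in auto)
  let ?E = "word_mat n (cycle_word p (n - p))"
  obtain B B' where B: "B \<in> carrier_mat n n" "B' \<in> carrier_mat n n" "B * B' = 1\<^sub>m n" "B' * B = 1\<^sub>m n"
    and eq: "?E = B\<^sup>T * E * B" using con unfolding congruent_mat_def by blast
  \<comment> \<open>\<open>?C\<close> is the inverse of the normal form \<open>?E\<close>. The
    explicit factorization is available for \<open>?C\<close> and is carried back to
    \<open>C\<close> through \<open>Ceq\<close>.\<close>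
  let ?C = "B' * C * B'\<^sup>T"
  note as = assoc_mult_mat[of _ n n _ n _ n]
  have t1: "B\<^sup>T * B'\<^sup>T = 1\<^sub>m n" using transpose_inverse[OF B(2,1,4)] .
  have t2: "B'\<^sup>T * B\<^sup>T = 1\<^sub>m n" using transpose_inverse[OF B(1,2,3)] .
  have Cc: "?C \<in> carrier_mat n n" using B C by auto
  have "?E * ?C = B\<^sup>T * (E * ((B * B') * (C * B'\<^sup>T)))" using B(1,2) C E(1) unfolding eq by (simp add: as)
  also have "\<dots> = B\<^sup>T * (E * (C * B'\<^sup>T))" using B(2) C by (simp add: B(3))
  also have "\<dots> = B\<^sup>T * ((E * C) * B'\<^sup>T)" using B(2) C E(1) by (simp add: as)
  also have "\<dots> = 1\<^sub>m n" using B by (simp add: E(2) t1)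
  finally have EC: "?E * ?C = 1\<^sub>m n" .
  have "(B\<^sup>T)\<^sup>T * ?C * B\<^sup>T = (B * B') * (C * (B'\<^sup>T * B\<^sup>T))" using B(1,2) C by (simp add: as)
  then have Ceq: "C = (B\<^sup>T)\<^sup>T * ?C * B\<^sup>T" using C by (simp add: B(3) t2)
  have D: "B\<^sup>T \<in> carrier_mat n n" "B'\<^sup>T \<in> carrier_mat n n" using B by auto
  interpret gram_factorization n n ?C ?E cc.M "perm_mat n cc.\<tau>" by (rule cc.factorization[OF Cc EC])
  interpret c: gram_factorization n n C "B'\<^sup>T * ?E * (B'\<^sup>T)\<^sup>T" "(B\<^sup>T)\<^sup>T * cc.M" "perm_mat n cc.\<tau>"
    by (subst Ceq) (rule congruent[OF D t1 t2])
  have wit: "similar_mat_wit (cox_mat C) (cox_mat ?C) ((B\<^sup>T)\<^sup>T) ((B'\<^sup>T)\<^sup>T)"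
    by (subst Ceq) (rule similar_cox_mat[OF D t1 t2])
  define g where "g = B'\<^sup>T *\<^sub>v vec n (\<lambda>i. of_bool (i = p) - of_bool (i = 0) :: int)" 
  let ?g = "vec n (\<lambda>i. of_bool (i = p) - of_bool (i = 0) :: int)"
  have gc: "?g \<in> carrier_vec n" by simp
  have g: "g \<in> carrier_vec n" using D by (simp add: g_def)
  have Bg: "B\<^sup>T *\<^sub>v g = ?g"
    unfolding g_def using D t1 by (subst assoc_mult_mat_vec[symmetric, of _ n n _ n]) auto
  have "v \<bullet> (C *\<^sub>v v) = 0 \<longleftrightarrow> (\<exists>c. v = c \<cdot>\<^sub>v g)" if v: "v \<in> carrier_vec n" for v
  proof -
    have Bv: "B\<^sup>T *\<^sub>v v \<in> carrier_vec n" using D v by auto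
    have "v \<bullet> (C *\<^sub>v v) = 0 \<longleftrightarrow> ((B\<^sup>T)\<^sup>T * cc.M)\<^sup>T *\<^sub>v v = 0\<^sub>v n" by (rule c.kernel_iff[OF v])
    also have "((B\<^sup>T)\<^sup>T * cc.M)\<^sup>T = cc.M\<^sup>T * B\<^sup>T" using B by (subst transpose_mult[of _ n n _ n]) auto
    also have "(cc.M\<^sup>T * B\<^sup>T) *\<^sub>v v = cc.M\<^sup>T *\<^sub>v (B\<^sup>T *\<^sub>v v)"
      using D v by (intro assoc_mult_mat_vec[of _ n n _ n]) auto
    also have "\<dots> = 0\<^sub>v n \<longleftrightarrow> (\<exists>c. B\<^sup>T *\<^sub>v v = c \<cdot>\<^sub>v ?g)" by (rule cc.kernel_M[OF Bv])
    also have "\<dots> \<longleftrightarrow> (\<exists>c. v = c \<cdot>\<^sub>v g)"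
    proof -
      have "B\<^sup>T *\<^sub>v v = c \<cdot>\<^sub>v ?g \<longleftrightarrow> v = c \<cdot>\<^sub>v g" for c
      proof
        assume "B\<^sup>T *\<^sub>v v = c \<cdot>\<^sub>v ?g"
        then have "v = B'\<^sup>T *\<^sub>v (c \<cdot>\<^sub>v ?g)" using mult_mat_vec_inverse[OF D t2 v] by blast
        then show "v = c \<cdot>\<^sub>v g" unfolding g_def using mult_mat_smult_vec[OF D(2) gc] by simp
      next
        assume "v = c \<cdot>\<^sub>v g"
        then show "B\<^sup>T *\<^sub>v v = c \<cdot>\<^sub>v ?g" using mult_mat_smult_vec[OF D(1) g] Bg by simp
      qed
      then show ?thesis by simp
    qed
    finally show ?thesis .
  qed
  moreover have "g \<noteq> 0\<^sub>v n"
  proof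
    assume "g = 0\<^sub>v n"
    then have "?g = 0\<^sub>v n" using Bg mult_mat_zero_vec[OF D(1)] by simp
    then have "?g $ p = 0" using p by simp
    then show False using p by simp
  qed
  ultimately show "\<exists>g. g \<noteq> 0\<^sub>v n \<and> g \<in> carrier_vec n \<and> (\<forall>v\<in>carrier_vec n. v \<bullet> (C *\<^sub>v v) = 0 \<longleftrightarrow> (\<exists>c. v = c \<cdot>\<^sub>v g))"
    using g by blast
  have "[:-1, 1:] ^ n * char_poly (cox_mat C) = [:-1, 1:] ^ n * char_poly (perm_mat n cc.\<tau>)"
    by (rule c.char_poly_cox_mat)
  then have "char_poly (cox_mat C) = (monom 1 p - 1) * (monom 1 (n - p) - 1)"
    by (simp add: cc.char_poly_perm)
  also have "\<dots> = monom 1 n - monom 1 p - monom 1 (n - p) + 1"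
    using p by (simp add: algebra_simps mult_monom)
  finally show "char_poly (cox_mat C) = monom 1 n - monom 1 p - monom 1 (n - p) + 1" .
  show "cox_mat C ^\<^sub>m c \<noteq> 1\<^sub>m n" if "1 \<le> c" for c
    unfolding one_pow_similar_iff[OF wit c.cox_mat_carrier] by (rule cc.cox_mat_pow_ne_one[OF Cc EC that])
  show "(\<forall>i<n. row (cox_mat C ^\<^sub>m c - 1\<^sub>m n) i \<bullet> (C *\<^sub>v row (cox_mat C ^\<^sub>m c - 1\<^sub>m n) i) = 0) \<longleftrightarrow>
      p dvd c \<and> (n - p) dvd c" for c
  proof -
    have L: "perm_mat n cc.\<tau> ^\<^sub>m c \<in> carrier_mat n n" by auto
    have "B * cc.M * perm_mat n cc.\<tau> ^\<^sub>m c = B * cc.M \<longleftrightarrow> cc.M * perm_mat n cc.\<tau> ^\<^sub>m c = cc.M"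
    proof
      assume *: "B * cc.M * perm_mat n cc.\<tau> ^\<^sub>m c = B * cc.M"
      have inv: "B' * (B * Y) = Y" if "Y \<in> carrier_mat n n" for Y
        using B that by (simp add: as[symmetric])
      have "cc.M * perm_mat n cc.\<tau> ^\<^sub>m c = B' * (B * (cc.M * perm_mat n cc.\<tau> ^\<^sub>m c))"
        using L by (intro inv[symmetric]) auto
      also have "B * (cc.M * perm_mat n cc.\<tau> ^\<^sub>m c) = B * cc.M" 
        using * B L by (simp add: as)
      finally show "cc.M * perm_mat n cc.\<tau> ^\<^sub>m c = cc.M" using inv by simp
    qed (use B L in \<open>simp add: as\<close>)
    then show ?thesis using c.cox_mat_pow_rows_kernel_iff[of c] cc.perm_fixes_iff[of c] by simp
  qed
qed

text \<open>With at most one reversed step the other steps form an ascending chain of at least three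
  elements. The closing step then either contradicts antisymmetry or is a cover with another element
  strictly between its ends. This gives the bounds on the cycle index.\<close>

lemma cyclic_reversed_steps_ge_2:
  assumes xs: "distinct xs" "3 \<le> length xs" "set xs \<subseteq> S"
    and refl: "\<And>x. x \<in> S \<Longrightarrow> (x, x) \<in> r" and trans: "trans r" and antisym: "antisym r"
    and steps: "cyclic_steps xs \<subseteq> hasse S r \<union> (hasse S r)\<inverse>"
  shows "2 \<le> card (cyclic_steps xs \<inter> (hasse S r)\<inverse>)"
proof (rule ccontr)
  assume "\<not> ?thesis"
  then have le1: "card (cyclic_steps xs \<inter> (hasse S r)\<inverse>) \<le> 1" by simp
  let ?n = "length xs" and ?H = "hasse S r"
  define s where "s i = (xs ! i, xs ! (Suc i mod ?n))" for i
  have n: "0 < ?n" using xs(2) by linarith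
  have s_mem: "s i \<in> cyclic_steps xs" if "i < ?n" for i using that by (auto simp: cyclic_steps_def s_def)
  have s_inj: "i = j" if "i < ?n" "j < ?n" "s i = s j" for i j
    using that xs by (simp add: s_def nth_eq_iff_index_eq)
  have fin: "finite (cyclic_steps xs)" 
  proof -
    have "cyclic_steps xs = s ` {..<?n}" by (auto simp: cyclic_steps_def s_def)
    then show ?thesis by simp
  qed
  have s_cases: "s i \<in> ?H \<or> s i \<in> ?H\<inverse>" if "i < ?n" for i using s_mem[OF that] steps by blast
  have "\<exists>t<?n. \<forall>i<?n. i \<noteq> t \<longrightarrow> s i \<in> ?H"
  proof (cases "\<forall>i<?n. s i \<in> ?H")
    case True
    then show ?thesis using n by blast
  next
    case False
    then obtain t where t: "t < ?n" "s t \<notin> ?H" by blast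
    have "s i \<in> ?H" if "i < ?n" "i \<noteq> t" for i
    proof (rule ccontr)
      assume "s i \<notin> ?H"
      then have sub: "{s i, s t} \<subseteq> cyclic_steps xs \<inter> ?H\<inverse>" using s_cases s_mem t that by blast
      have "s i \<noteq> s t" using s_inj[of i t] t that by blast
      then have "card {s i, s t} = 2" by simp
      moreover have "finite (cyclic_steps xs \<inter> ?H\<inverse>)" using fin by blast
      ultimately show False using card_mono[OF _ sub] le1 by simp
    qed
    then show ?thesis using t by blast
  qed
  then obtain t where t: "t < ?n" and H: "\<And>i. i < ?n \<Longrightarrow> i \<noteq> t \<Longrightarrow> s i \<in> ?H" by blast
  \<comment> \<open>With at most one step \<open>t\<close> reversed, going around from its end gives an ascending chain.\<close>
  define z where "z k = xs ! ((Suc t + k) mod ?n)" for k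
  have zS: "z k \<in> S" for k using n xs by (auto simp: z_def)
  have zstep: "(z k, z (Suc k)) \<in> r" if k: "Suc k < ?n" for k
  proof -
    let ?m = "(Suc t + k) mod ?n"
    have "?m \<noteq> t"
    proof (cases "Suc t + k < ?n")
      case False
      then have "?m = Suc t + k - ?n" using t k by (simp add: mod_if)
      then show ?thesis using t k False by linarith
    qed simp
    then have "s ?m \<in> ?H" using H n by simp
    moreover have "Suc ?m mod ?n = (Suc t + Suc k) mod ?n" by (simp add: mod_Suc_eq)
    ultimately show ?thesis by (simp add: s_def z_def hasse_def)
  qed
  have zmono: "(z j, z (j + d)) \<in> r" if "j + d < ?n" for j d
    using that
  proof (induction d)
    case 0
    then show ?case using refl zS by simp
  next
    case (Suc d)
    then show ?case using zstep[of "j + d"] transD[OF trans] by fastforce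
  qed
  have z_last: "z (?n - 1) = xs ! t"
  proof -
    have "Suc t + (?n - 1) = t + ?n" using n by simp
    then show ?thesis using t by (simp add: z_def)
  qed
  have z_inj: "z i \<noteq> z j" if "i < j" "j < ?n" for i j
  proof -
    have "(Suc t + i) mod ?n \<noteq> (Suc t + j) mod ?n"
    proof
      assume "(Suc t + i) mod ?n = (Suc t + j) mod ?n"
      then have "?n dvd (Suc t + j) - (Suc t + i)" using that by (intro mod_eq_dvd_iff_nat[THEN iffD1]) auto
      then show False using that by (auto dest: dvd_imp_le)
    qed
    then show ?thesis using xs n by (simp add: z_def nth_eq_iff_index_eq)
  qed
  have z0: "xs ! (Suc t mod ?n) = z 0" by (simp add: z_def)
  have "1 + (?n - 2) = ?n - 1" using xs(2) by linarith
  then have a: "(z 0, z (?n - 1)) \<in> r" "(z 0, z 1) \<in> r" "(z 1, z (?n - 1)) \<in> r"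
    using zmono[of 0 "?n - 1"] zmono[of 0 1] zmono[of 1 "?n - 2"] xs(2) by auto
  have d: "z 0 \<noteq> z (?n - 1)" "z 0 \<noteq> z 1" "z 1 \<noteq> z (?n - 1)" using z_inj xs by auto
  have st: "s t = (z (?n - 1), z 0)" by (simp only: s_def z_last z0)
  from s_cases[OF t] show False
  proof
    assume "s t \<in> ?H"
    then have "(z (?n - 1), z 0) \<in> r" by (simp add: st hasse_def)
    then show False using a d antisymD[OF antisym] by metis
  next
    assume "s t \<in> ?H\<inverse>"
    then have "(z 0, z (?n - 1)) \<in> ?H" by (simp add: st)
    then show False using a d zS by (auto simp: hasse_def)
  qed
qed

lemma hasse_converse: "hasse S (r\<inverse>) = (hasse S r)\<inverse>"
  by (auto simp: hasse_def)

lemma hasse_cycle_steps_ge_2: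
  assumes po: "partial_order_on S r" and cyc: "hasse_cycle S r xs"
  shows "2 \<le> card (cyclic_steps xs \<inter> hasse S r)" "2 \<le> card (cyclic_steps xs \<inter> (hasse S r)\<inverse>)"
proof -
  have xs: "distinct xs" "3 \<le> length xs" "set xs \<subseteq> S" using cyc by (auto simp: hasse_cycle_def)
  have steps: "cyclic_steps xs \<subseteq> hasse S r \<union> (hasse S r)\<inverse>" using cyc by (auto simp: hasse_cycle_def)
  note po' = partial_order_onD[OF po]
  show "2 \<le> card (cyclic_steps xs \<inter> (hasse S r)\<inverse>)"
    using po' steps by (intro cyclic_reversed_steps_ge_2[OF xs]) (auto simp: refl_on_def)
  \<comment> \<open>The steps along the order are the reversed steps of the converse order.\<close>
  have "2 \<le> card (cyclic_steps xs \<inter> (hasse S (r\<inverse>))\<inverse>)"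
    using po' steps by (intro cyclic_reversed_steps_ge_2[OF xs]) (auto simp: refl_on_def hasse_converse)
  then show "2 \<le> card (cyclic_steps xs \<inter> hasse S r)" by (simp add: hasse_converse)
qed

text \<open>The definition of the type makes the corank the cardinality of \<open>K\<close>, so it
  is found without computing a rank: each basis vector has an entry 1 and hence is not zero.\<close>

lemma corank_eq_0:
  assumes dyn: "has_dynkin_type n r \<Delta>" and ker: "\<And>v. v \<in> ker_form {1..n} r \<Longrightarrow> v = 0\<^sub>v n"
  shows "corank {1..n} r = 0"
proof -
  obtain K h where K: "K \<subseteq> {1..n}" "card K = corank {1..n} r"
    and basis: "Z_basis n (ker_form {1..n} r) K h"
    and delta: "\<forall>i\<in>K. \<forall>j\<in>K. h i $ (j - 1) = (if i = j then 1 else 0)"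
    using dyn unfolding has_dynkin_type_def by blast
  have "k \<notin> K" for k
  proof
    assume k: "k \<in> K"
    then have "h k = 0\<^sub>v n" using ker Z_basis_mem[OF basis] by blast
    moreover have "h k $ (k - 1) = 1" using delta k by simp
    moreover have "k - 1 < n" using K k by fastforce
    ultimately show False by simp
  qed
  then have "K = {}" by blast
  then show ?thesis using K by simp
qed

text \<open>For distinct \<open>i\<close> and \<open>j\<close> in \<open>K\<close> the vectors
  \<open>h i\<close> and \<open>h j\<close> would be multiples of one vector with entries 1, 0 and
  0, 1 at these two places. An empty \<open>K\<close> would span only the zero vector.\<close>

lemma corank_eq_1:
  assumes dyn: "has_dynkin_type n r \<Delta>" and g: "g \<in> carrier_vec n" "g \<noteq> 0\<^sub>v n"
    and ker: "\<And>v. v \<in> ker_form {1..n} r \<longleftrightarrow> (\<exists>c. v = c \<cdot>\<^sub>v g)"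
  shows "corank {1..n} r = 1"
proof -
  obtain K h where K: "K \<subseteq> {1..n}" "card K = corank {1..n} r"
    and basis: "Z_basis n (ker_form {1..n} r) K h"
    and delta: "\<forall>i\<in>K. \<forall>j\<in>K. h i $ (j - 1) = (if i = j then 1 else 0)"
    using dyn unfolding has_dynkin_type_def by blast
  have h: "\<exists>c. h k = c \<cdot>\<^sub>v g" if "k \<in> K" for k using ker Z_basis_mem[OF basis that] by blast
  have uniq: "i = j" if i: "i \<in> K" and j: "j \<in> K" for i j
  proof (rule ccontr)
    assume ne: "i \<noteq> j"
    obtain c d where c: "h i = c \<cdot>\<^sub>v g" and d: "h j = d \<cdot>\<^sub>v g" using h i j by blast
    have lt: "i - 1 < n" "j - 1 < n" using K i j by fastforce+
    have "c * g $ (i - 1) = 1" "c * g $ (j - 1) = 0" "d * g $ (j - 1) = 1"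
      using delta i j ne c d g lt by (metis carrier_vecD index_smult_vec(1))+
    then show False by auto
  qed
  have "K \<noteq> {}"
  proof
    assume "K = {}"
    have "g \<in> ker_form {1..n} r" using ker[of g] one_smult_vec[of g] by metis
    then obtain c where "g = Z_comb n K h c" using basis unfolding Z_basis_def by blast
    then have "g = 0\<^sub>v n" using \<open>K = {}\<close> by (auto simp: Z_comb_def)
    then show False using g by simp
  qed
  then obtain k where "K = {k}" using uniq by blast
  then show ?thesis using K by simp
qed

lemma Inf_enat_dvd:
  assumes m: "1 \<le> m" shows "Inf {enat c | c. 1 \<le> c \<and> m dvd c} = enat m"
proof (rule antisym)
  show "Inf {enat c | c. 1 \<le> c \<and> m dvd c} \<le> enat m" using m by (intro Inf_lower) auto
  show "enat m \<le> Inf {enat c | c. 1 \<le> c \<and> m dvd c}"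
    by (intro Inf_greatest) (auto dest: dvd_imp_le)
qed

lemma ker_form_iff: "v \<in> ker_form {1..n} r \<longleftrightarrow>
    v \<in> carrier_vec n \<and> v \<bullet> (incidence_mat {1..n} r *\<^sub>v v) = 0"
  by (simp add: ker_form_def quad_form_def)

theorem theorem1p1:
  fixes n :: nat and r :: "nat rel"
  assumes poset: "partial_order_on {1..n} r"
    and conn: "connected_poset {1..n} r"
    and nonneg: "nonnegative_poset {1..n} r"
    and dyn: "has_dynkin_type n r (Dyn_A (n - corank {1..n} r))"
  shows "((positive_poset {1..n} r \<or> principal_poset {1..n} r) \<and> corank {1..n} r \<in> {0, 1}) \<and>
    (positive_poset {1..n} r \<longrightarrow>
      strongly_gram_congruent {1..n} r {1..n} (chain_poset n) \<and>
      coxeter_poly {1..n} r = (\<Sum>i\<le>n. monom 1 i) \<and>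
      coxeter_number {1..n} r = enat (n + 1)) \<and>
    (principal_poset {1..n} r \<longrightarrow>
      (let p = cycle_index {1..n} r in
        (4 \<le> n \<and> n \<le> 2 * p \<and> p \<le> n - 2 \<and>
         strongly_gram_congruent {1..n} r {1..n} (two_peak_poset p n)) \<and>
        coxeter_poly {1..n} r = monom 1 n - monom 1 p - monom 1 (n - p) + 1 \<and>
        coxeter_number {1..n} r = \<infinity> \<and>
        reduced_coxeter_number {1..n} r = enat (lcm p (n - p))))"
proof -
  let ?S = "{1..n}" and ?C = "incidence_mat {1..n} r"
  obtain a b where "root_labelled_poset ?S r a b"
    using dynkin_A_root_labelling[OF poset nonneg dyn] by blast
  then interpret root_labelled_poset ?S r a b .
  let ?H = "hasse ?S r"
  let ?E = "euler_mat n (shift_rel ?H)"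
  have EC: "?E * ?C = 1\<^sub>m n" by (rule hasse_euler_inverse[OF HOL.refl])
  have C: "?C \<in> carrier_mat n n" using incidence_mat_carrier[of ?S r] by simp
  have n: "0 < n" using conn by (auto simp: connected_poset_def)
  have "\<exists>xs L. distinct xs \<and> set xs = ?S \<and> (Suc L = length xs \<or> L = length xs \<and> 3 \<le> length xs) \<and>
     (let P = {(xs ! i, xs ! (Suc i mod length xs)) | i. i < L} in ?H \<union> ?H\<inverse> = P \<union> P\<inverse>)"
  proof (rule connected_degree_le_2_path_or_cycle)
    show "?S \<noteq> {}" using n by simp
    show "?H \<union> ?H\<inverse> \<subseteq> ?S \<times> ?S" by (auto simp: hasse_def)
    show "(u, u) \<notin> ?H \<union> ?H\<inverse>" for u using hasse_D(4) by blast
    show "(u, v) \<in> (?H \<union> ?H\<inverse>)\<^sup>*" if "u \<in> ?S" "v \<in> ?S" for u v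
      using conn that by (simp add: connected_poset_def)
  qed (use hasse_degree_le_2 in auto)
  then obtain xs L where xs: "distinct xs" "set xs = ?S"
    and L: "Suc L = length xs \<or> L = length xs \<and> 3 \<le> length xs"
    and steps: "?H \<union> ?H\<inverse> = {(xs ! i, xs ! (Suc i mod length xs)) | i. i < L} \<union>
      {(xs ! i, xs ! (Suc i mod length xs)) | i. i < L}\<inverse>"
    unfolding Let_def by blast
  have len: "length xs = n" using distinct_card[OF xs(1)] xs(2) by simp
  from L show ?thesis
  proof
    assume L: "Suc L = length xs"
    define w where "w = map (\<lambda>i. (xs ! i, xs ! (Suc i mod n)) \<in> ?H) [0..<L]"
    have "congruent_mat n ?E (word_mat n w)"
      by (rule euler_mat_listing[OF xs len _ hasse_asym steps[unfolded len] HOL.refl w_def]) (use L len in auto)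
    moreover have "congruent_mat n (word_mat n w) (word_mat n (replicate (n - 1) True))"
    proof -
      have "length w = n - 1" "n = Suc (length w)" using L len by (auto simp: w_def)
      then show ?thesis using word_mat_path[of n w] by simp
    qed
    ultimately have con: "congruent_mat n ?E (word_mat n (replicate (n - 1) True))"
      using congruent_mat_trans[OF euler_mat_carrier] by blast
    have D: "incidence_mat {1..n} (chain_poset n) \<in> carrier_mat n n"
      using incidence_mat_carrier[of ?S "chain_poset n"] by simp
    have con': "congruent_mat n ?C (incidence_mat {1..n} (chain_poset n))"
      by (rule congruent_mat_inverse[OF euler_mat_carrier C EC euler_mat_carrier D chain_euler_inverse[OF n] con])
    note ct = chain_type[OF n congruent_mat_sym[OF C con']]
    \<comment> \<open>The shape of the Hasse diagram determines the corank, so in either case one of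
      the two implications to be shown is vacuous.\<close>
    have cr: "corank ?S r = 0"
    proof (rule corank_eq_0[OF dyn])
      show "v = 0\<^sub>v n" if "v \<in> ker_form ?S r" for v using that ct(1) unfolding ker_form_iff by blast
    qed
    have "strongly_gram_congruent ?S r ?S (chain_poset n)"
      unfolding strongly_gram_congruent_def by (rule congruent_mat_imp_Z_congruent[OF C con'])
    moreover have "coxeter_poly ?S r = (\<Sum>i\<le>n. monom 1 i)"
      by (simp add: coxeter_poly_def coxeter_mat_eq ct(2)[unfolded One_nat_def])
    moreover have "coxeter_number ?S r = enat (n + 1)"
      using Inf_enat_dvd[of "Suc n"] by (simp add: coxeter_number_def coxeter_mat_eq ct(3)[unfolded One_nat_def])
    ultimately show ?thesis using cr nonneg by (simp add: positive_poset_def principal_poset_def)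
  next
    assume L: "L = length xs \<and> 3 \<le> length xs"
    have "hasse_cycle ?S r xs"
      using xs L steps by (simp add: hasse_cycle_def cyclic_steps_def)
    \<comment> \<open>\<open>cycle_index\<close> counts along the listing returned by the choice
      operator. \<open>xs\<close> only shows that a listing exists; the counts are taken along
      \<open>ys\<close>.\<close>
    define ys where "ys = (SOME xs. hasse_cycle ?S r xs)"
    have ys: "hasse_cycle ?S r ys" unfolding ys_def by (rule someI[of "hasse_cycle ?S r", OF \<open>hasse_cycle ?S r xs\<close>])
    have ys': "distinct ys" "set ys = ?S" "?H \<union> ?H\<inverse> = cyclic_steps ys \<union> (cyclic_steps ys)\<inverse>"
      using ys by (auto simp: hasse_cycle_def)
    have lys: "length ys = n" using distinct_card[OF ys'(1)] ys'(2) by simp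
    define k l where "k = card (cyclic_steps ys \<inter> ?H)" and "l = card (cyclic_steps ys \<inter> ?H\<inverse>)"
    have k2: "2 \<le> k" and l2: "2 \<le> l" using hasse_cycle_steps_ge_2[OF poset ys] by (auto simp: k_def l_def)
    note ec = euler_mat_cycle[OF ys'(1,2) lys hasse_asym ys'(3) k_def l_def]
    define p where "p = cycle_index ?S r"
    have p: "p = max k l" unfolding p_def cycle_index_def k_def l_def ys_def Let_def ..
    have bounds: "2 \<le> p" "p + 2 \<le> n" "n \<le> 2 * p" using p k2 l2 ec(2) by auto
    \<comment> \<open>Reversing the traversal exchanges the two counts, so the larger one may come
      first.\<close>
    have con: "congruent_mat n ?E (word_mat n (cycle_word p (n - p)))"
    proof (cases "l \<le> k")
      case True
      then have "p = k" "n - p = l" using p ec(2) by auto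
      then show ?thesis using ec(1) by simp
    next
      case False
      then have "p = l" "n - p = k" using p ec(2) by auto
      moreover have "congruent_mat n (word_mat n (cycle_word k l)) (word_mat n (cycle_word l k))"
        using word_mat_cycle_word_commute[of k l] ec(2) by simp
      ultimately show ?thesis using congruent_mat_trans[OF euler_mat_carrier ec(1)] by simp
    qed
    interpret tp: two_peak p n by standard (use bounds in auto)
    let ?T = "incidence_mat {1..n} (two_peak_poset p n)"
    have T: "?T \<in> carrier_mat n n" using incidence_mat_carrier[of ?S "two_peak_poset p n"] by simp
    have "congruent_mat n ?E (euler_mat n (shift_rel tp.R))"
      using congruent_mat_trans[OF euler_mat_carrier con congruent_mat_sym[OF euler_mat_carrier tp.word]] .
    then have con': "congruent_mat n ?C ?T"
      by (rule congruent_mat_inverse[OF euler_mat_carrier C EC euler_mat_carrier T tp.two_peak_euler_inverse])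
    note ct = cycle_type[OF bounds(1,2) C euler_mat_carrier EC con]
    obtain g where g: "g \<noteq> 0\<^sub>v n" "g \<in> carrier_vec n"
      "\<forall>v\<in>carrier_vec n. v \<bullet> (?C *\<^sub>v v) = 0 \<longleftrightarrow> (\<exists>c. v = c \<cdot>\<^sub>v g)" using ct(1) by blast
    have cr: "corank ?S r = 1"
    proof (rule corank_eq_1[OF dyn g(2,1)])
      show "v \<in> ker_form ?S r \<longleftrightarrow> (\<exists>c. v = c \<cdot>\<^sub>v g)" for v
        unfolding ker_form_iff using g(2,3) smult_carrier_vec by blast
    qed
    have rows: "row (cox_mat ?C ^\<^sub>m c - 1\<^sub>m n) i \<in> carrier_vec n" for c i
      by (simp add: row_def)
    have "strongly_gram_congruent ?S r ?S (two_peak_poset p n)"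
      unfolding strongly_gram_congruent_def by (rule congruent_mat_imp_Z_congruent[OF C con'])
    moreover have "coxeter_poly ?S r = monom 1 n - monom 1 p - monom 1 (n - p) + 1"
      unfolding coxeter_poly_def coxeter_mat_eq by (rule ct(2))
    moreover have "coxeter_number ?S r = \<infinity>"
    proof -
      have "{enat c | c. 1 \<le> c \<and> cox_mat ?C ^\<^sub>m c = 1\<^sub>m (card ?S)} = {}" using ct(3) by auto
      then show ?thesis unfolding coxeter_number_def coxeter_mat_eq by (simp only: Inf_empty top_enat_def)
    qed
    moreover have "reduced_coxeter_number ?S r = enat (lcm p (n - p))"
    proof -
      have "(\<forall>i<card ?S. row (cox_mat ?C ^\<^sub>m c - 1\<^sub>m (card ?S)) i \<in> ker_form ?S r) \<longleftrightarrow> lcm p (n - p) dvd c" for c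
        using ct(4)[of c] rows[of c] unfolding ker_form_iff by simp
      moreover have "1 \<le> lcm p (n - p)" using bounds by (simp add: Suc_le_eq lcm_pos_nat)
      ultimately show ?thesis
        unfolding reduced_coxeter_number_def coxeter_mat_eq using Inf_enat_dvd by presburger
    qed
    ultimately show ?thesis unfolding Let_def p_def[symmetric]
      using cr nonneg bounds by (simp add: positive_poset_def principal_poset_def)
  qed
qed

end
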